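(* For $k>2$ and $0<m<k$, let $\mathcal{R}^m_k\subset J^k(\mathbb{R}^2)$ be the system $$u_{k-i,i}=\frac{\lambda^{i+1}}{i+1}+\sum_{j=1}^{\min(m,i+1)}\frac{i!}{(i+1-j)!}\lambda^{i+1-j}\zeta_j,\qquad 0\le i\le k,$$ obtained by eliminating the parameters $\lambda,\zeta_1,\dots,\zeta_m$. Then the Lie algebra of contact symmetries of $\mathcal{R}^m_k$ has dimension $k(k+1)/2+6$ and is isomorphic to the semi-direct product $\mathfrak{n}_{k+1}\rtimes\mathfrak{gl}_2$, i.e. the same Lie algebra as the contact symmetry algebra of the system $\{u_{k-i,i}=\lambda^{i+1}/(i+1):0\le i\le k\}$.
   Context: $J^k(\mathbb{R}^2)$ is the jet space of scalar functions $u(x,y)$ with coordinates $u_{ij}=\partial_x^i\partial_y^ju$. Contact symmetries are contact vector fields on $J^1(\mathbb{R}^2)$ whose prolongations to $J^k$ are tangent to the system. $\mathfrak{n}_{k+1}$ is the truncated double-graded free Lie algebra: $\mathfrak{n}_{k+1}=\mathfrak{g}_{-k-1}\oplus\dots\oplus\mathfrak{g}_{-1}$ with $\mathfrak{g}_{-1}=\langle e_{10},e_{01}\rangle$, $\mathfrak{g}_{-j-1}=\langle e_{j,1},\dots,e_{1,j}\rangle$, $e_{11}=[e_{10},e_{01}]$, $[e_{10},e_{i,j+1}]=[e_{01},e_{i+1,j}]=e_{i+1,j+1}$, all brackets landing below degree $-(k+1)$ being zero. *)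

theory Defs
  imports "HOL-Analysis.Analysis"
begin

text \<open>Coordinates: x, y and u_ij = d_x^i d_y^j u.  A point of the (infinite) jet space is a
  function jvar => real; a function on J^r is a function of such points depending only on the
  coordinates of order at most r.\<close>

datatype jvar = XX | YY | UU nat nat

type_synonym jpt = "jvar \<Rightarrow> real"
type_synonym jfun = "jpt \<Rightarrow> real"
type_synonym vfield = "jvar \<Rightarrow> jfun"   \<comment> \<open>coefficient of d/d(coordinate)\<close>

definition J1 :: "jvar set" where
  "J1 = {XX, YY, UU 0 0, UU 1 0, UU 0 1}"

definition depends_only :: "jvar set \<Rightarrow> jfun \<Rightarrow> bool" where
  "depends_only S F \<longleftrightarrow> (\<forall>v w. (\<forall>c\<in>S. v c = w c) \<longrightarrow> F v = F w)"

definition pd :: "jvar \<Rightarrow> jfun \<Rightarrow> jfun" where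
  "pd c F = (\<lambda>v. deriv (\<lambda>t. F (v(c := t))) (v c))"

definition smooth_in :: "jvar set \<Rightarrow> jfun \<Rightarrow> bool" where
  "smooth_in S F \<longleftrightarrow> depends_only S F \<and>
     (\<forall>cs. set cs \<subseteq> S \<longrightarrow>
        continuous_on UNIV (foldr pd cs F) \<and>
        (\<forall>c\<in>S. \<forall>v. (\<lambda>t. foldr pd cs F (v(c := t))) differentiable (at (v c))))"

text \<open>Total derivatives (N bounds the order of the coordinates the function may depend on).\<close>
definition Dx :: "nat \<Rightarrow> jfun \<Rightarrow> jfun" where
  "Dx N F = (\<lambda>v. pd XX F v + (\<Sum>(i,j)\<in>{(i,j). i + j \<le> N}. v (UU (Suc i) j) * pd (UU i j) F v))"

definition Dy :: "nat \<Rightarrow> jfun \<Rightarrow> jfun" where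
  "Dy N F = (\<lambda>v. pd YY F v + (\<Sum>(i,j)\<in>{(i,j). i + j \<le> N}. v (UU i (Suc j)) * pd (UU i j) F v))"

definition vf_J1 :: "vfield \<Rightarrow> bool" where
  "vf_J1 V \<longleftrightarrow> (\<forall>c. c \<notin> J1 \<longrightarrow> V c = (\<lambda>_. 0)) \<and> (\<forall>c\<in>J1. smooth_in J1 (V c))"

text \<open>Characteristic (generating function) Q = theta(V), theta = du - p dx - q dy.\<close>
definition charf :: "vfield \<Rightarrow> jfun" where
  "charf V = (\<lambda>w. V (UU 0 0) w - w (UU 1 0) * V XX w - w (UU 0 1) * V YY w)"

text \<open>Contact vector field: L_V theta = mu * theta for some function mu.  Writing
  F = theta(V), L_V theta = dF + i_V d theta, with d theta = dx/\dp + dy/\dq.\<close>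
definition contact_field :: "vfield \<Rightarrow> bool" where
  "contact_field V \<longleftrightarrow> vf_J1 V \<and>
    (\<exists>\<mu>. \<forall>w. let F = charf V in
        pd XX F w - V (UU 1 0) w = - w (UU 1 0) * \<mu> w \<and>
        pd YY F w - V (UU 0 1) w = - w (UU 0 1) * \<mu> w \<and>
        pd (UU 0 0) F w = \<mu> w \<and>
        pd (UU 1 0) F w + V XX w = 0 \<and>
        pd (UU 0 1) F w + V YY w = 0)"

definition prol :: "nat \<Rightarrow> vfield \<Rightarrow> nat \<Rightarrow> nat \<Rightarrow> jfun" where
  "prol k V a b = (\<lambda>w. ((Dx (Suc k) ^^ a) ((Dy (Suc k) ^^ b) (charf V))) w
                      + V XX w * w (UU (Suc a) b) + V YY w * w (UU a (Suc b)))"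

definition vf_bracket :: "vfield \<Rightarrow> vfield \<Rightarrow> vfield" where
  "vf_bracket V W = (\<lambda>c w. \<Sum>d\<in>J1. V d w * pd d (W c) w - W d w * pd d (V c) w)"

definition vf_lin :: "real \<Rightarrow> vfield \<Rightarrow> real \<Rightarrow> vfield \<Rightarrow> vfield" where
  "vf_lin a V b W = (\<lambda>c w. a * V c w + b * W c w)"

definition Ppar :: "nat \<Rightarrow> nat \<Rightarrow> real \<Rightarrow> (nat \<Rightarrow> real) \<Rightarrow> real" where
  "Ppar m i l z = l ^ (i + 1) / real (i + 1)
     + (\<Sum>j = 1..min m (i + 1). real (fact i) / real (fact (i + 1 - j)) * l ^ (i + 1 - j) * z j)"

definition dPl :: "nat \<Rightarrow> nat \<Rightarrow> real \<Rightarrow> (nat \<Rightarrow> real) \<Rightarrow> real" where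
  "dPl m i l z = deriv (\<lambda>t. Ppar m i t z) l"

definition dPz :: "nat \<Rightarrow> nat \<Rightarrow> nat \<Rightarrow> real \<Rightarrow> (nat \<Rightarrow> real) \<Rightarrow> real" where
  "dPz m i j l z = deriv (\<lambda>t. Ppar m i l (z(j := t))) (z j)"

definition on_system :: "nat \<Rightarrow> nat \<Rightarrow> real \<Rightarrow> (nat \<Rightarrow> real) \<Rightarrow> jpt \<Rightarrow> bool" where
  "on_system k m l z w \<longleftrightarrow> (\<forall>i\<le>k. w (UU (k - i) i) = Ppar m i l z)"

definition regular_par :: "nat \<Rightarrow> nat \<Rightarrow> real \<Rightarrow> (nat \<Rightarrow> real) \<Rightarrow> bool" where
  "regular_par k m l z \<longleftrightarrow>
     (\<forall>a bb. (\<forall>i\<le>k. a * dPl m i l z + (\<Sum>j = 1..m. bb j * dPz m i j l z) = 0)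
        \<longrightarrow> a = 0 \<and> (\<forall>j\<in>{1..m}. bb j = 0))"

text \<open>Contact symmetries: contact fields whose k-th prolongation is tangent to R^m_k (at its
  regular points).  The coordinates x, y and u_ij (i+j<k) are free on R^m_k, so tangency only
  constrains the top-order components.\<close>
definition contact_syms :: "nat \<Rightarrow> nat \<Rightarrow> vfield set" where
  "contact_syms k m = {V. contact_field V \<and>
     (\<forall>l z w. on_system k m l z w \<and> regular_par k m l z \<longrightarrow>
        (\<exists>a bb. \<forall>i\<le>k. prol k V (k - i) i w = a * dPl m i l z + (\<Sum>j = 1..m. bb j * dPz m i j l z)))}"

definition vf_basis :: "vfield set \<Rightarrow> vfield set \<Rightarrow> bool" where
  "vf_basis S B \<longleftrightarrow> finite B \<and> B \<subseteq> S \<and>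
     (\<forall>c. (\<lambda>d w. \<Sum>b\<in>B. c b * b d w) = (\<lambda>d w. 0) \<longrightarrow> (\<forall>b\<in>B. c b = 0)) \<and>
     (\<forall>V\<in>S. \<exists>c. V = (\<lambda>d w. \<Sum>b\<in>B. c b * b d w))"

text \<open>Basis indices: N i j = e_ij of n_(k+1); G r s = matrix unit E_rs of gl_2.\<close>
datatype gidx = N nat nat | G nat nat

definition nidx :: "nat \<Rightarrow> (nat \<times> nat) set" where
  "nidx k = {(1,0),(0,1)} \<union> {(i,j). 1 \<le> i \<and> 1 \<le> j \<and> i + j \<le> k + 1}"

definition Iset :: "nat \<Rightarrow> gidx set" where
  "Iset k = {N i j |i j. (i,j) \<in> nidx k} \<union> {G r s |r s. r \<in> {1,2} \<and> s \<in> {1,2}}"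

definition mcarrier :: "nat \<Rightarrow> (gidx \<Rightarrow> real) set" where
  "mcarrier k = {X. \<forall>e. e \<notin> Iset k \<longrightarrow> X e = 0}"

definition dl :: "gidx \<Rightarrow> gidx \<Rightarrow> real" where
  "dl x e = (if e = x then 1 else 0)"

definition nb :: "nat \<Rightarrow> nat \<times> nat \<Rightarrow> nat \<times> nat \<Rightarrow> gidx \<Rightarrow> real" where
  "nb k p q e =
    (if p = (1,0) \<and> q = (0,1) then dl (N 1 1) e
     else if p = (0,1) \<and> q = (1,0) then - dl (N 1 1) e
     else if p = (1,0) \<and> 1 \<le> fst q \<and> 1 \<le> snd q then
       (if fst q + snd q + 1 \<le> k + 1 then dl (N (fst q + 1) (snd q)) e else 0)
     else if p = (0,1) \<and> 1 \<le> fst q \<and> 1 \<le> snd q then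
       (if fst q + snd q + 1 \<le> k + 1 then dl (N (fst q) (snd q + 1)) e else 0)
     else if q = (1,0) \<and> 1 \<le> fst p \<and> 1 \<le> snd p then
       (if fst p + snd p + 1 \<le> k + 1 then - dl (N (fst p + 1) (snd p)) e else 0)
     else if q = (0,1) \<and> 1 \<le> fst p \<and> 1 \<le> snd p then
       (if fst p + snd p + 1 \<le> k + 1 then - dl (N (fst p) (snd p + 1)) e else 0)
     else 0)"

text \<open>Action of the matrix A = (a_rs) in gl_2 on basis element e_p of n_(k+1): the unique
  derivation of n_(k+1) extending the standard action on g_(-1) = <e_10, e_01>
  (e_10 -> a11 e_10 + a21 e_01, e_01 -> a12 e_10 + a22 e_01).  On e_ij (i,j>=1), which
  corresponds to x^(i-1) y^(j-1) (x) det, it acts by trace plus the induced action.\<close>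
definition rho_b :: "(nat \<Rightarrow> nat \<Rightarrow> real) \<Rightarrow> nat \<times> nat \<Rightarrow> gidx \<Rightarrow> real" where
  "rho_b A p e =
    (if p = (1,0) then A 1 1 * dl (N 1 0) e + A 2 1 * dl (N 0 1) e
     else if p = (0,1) then A 1 2 * dl (N 1 0) e + A 2 2 * dl (N 0 1) e
     else (let i = fst p; j = snd p in
        (A 1 1 + A 2 2) * dl (N i j) e
        + real (i - 1) * (A 1 1 * dl (N i j) e + A 2 1 * dl (N (i - 1) (j + 1)) e)
        + real (j - 1) * (A 1 2 * dl (N (i + 1) (j - 1)) e + A 2 2 * dl (N i j) e)))"

definition mbr :: "nat \<Rightarrow> (gidx \<Rightarrow> real) \<Rightarrow> (gidx \<Rightarrow> real) \<Rightarrow> gidx \<Rightarrow> real" where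
  "mbr k X Y e =
    (case e of
       N a b \<Rightarrow>
         (\<Sum>p\<in>nidx k. \<Sum>q\<in>nidx k. X (N (fst p) (snd p)) * Y (N (fst q) (snd q)) * nb k p q e)
         + (\<Sum>q\<in>nidx k. Y (N (fst q) (snd q)) * rho_b (\<lambda>r s. X (G r s)) q e)
         - (\<Sum>p\<in>nidx k. X (N (fst p) (snd p)) * rho_b (\<lambda>r s. Y (G r s)) p e)
     | G r s \<Rightarrow> (\<Sum>t\<in>{1,2}. X (G r t) * Y (G t s) - Y (G r t) * X (G t s)))"

definition lie_iso_model :: "nat \<Rightarrow> vfield set \<Rightarrow> ((gidx \<Rightarrow> real) \<Rightarrow> vfield) \<Rightarrow> bool" where
  "lie_iso_model k S T \<longleftrightarrow> bij_betw T (mcarrier k) S \<and>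
     (\<forall>X\<in>mcarrier k. \<forall>Y\<in>mcarrier k. \<forall>a b.
        T (\<lambda>e. a * X e + b * Y e) = vf_lin a (T X) b (T Y)) \<and>
     (\<forall>X\<in>mcarrier k. \<forall>Y\<in>mcarrier k. T (mbr k X Y) = vf_bracket (T X) (T Y))"

definition lie_iso_vf :: "vfield set \<Rightarrow> vfield set \<Rightarrow> (vfield \<Rightarrow> vfield) \<Rightarrow> bool" where
  "lie_iso_vf S S' T \<longleftrightarrow> bij_betw T S S' \<and>
     (\<forall>V\<in>S. \<forall>W\<in>S. \<forall>a b. T (vf_lin a V b W) = vf_lin a (T V) b (T W)) \<and>
     (\<forall>V\<in>S. \<forall>W\<in>S. T (vf_bracket V W) = vf_bracket (T V) (T W))"

end

theory Submission
  imports Defs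
begin

text \<open>A contact field is determined by its generating function \<open>Q(x,y,u,p,q)\<close>. On a fibre of
  \<open>J^k \<rightarrow> J^(k-1)\<close>, with \<open>k > 2\<close>, its prolongation is an affine field whose linear part is a
  multiple of the identity plus an element of \<open>gl_2\<close> with entries \<open>D\<^sub>x Q\<^sub>p, D\<^sub>y Q\<^sub>p, D\<^sub>x Q\<^sub>q, D\<^sub>y Q\<^sub>q\<close>.
  The system is swept out by the \<open>m\<close>-th osculating spaces of the curve
  \<open>\<gamma>\<^sub>i = l^(i+1)/(i+1)\<close>, and its tangent spaces are the osculating spaces of order \<open>m + 1 \<le> k\<close>.
  Letting the \<open>\<zeta>\<^sub>j\<close> tend to zero, tangency forces the affine field to map \<open>\<gamma>(l)\<close> into the
  osculating hyperplane at \<open>l\<close>, for every \<open>l\<close>. Comparing powers of \<open>l\<close> gives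
  \<open>D\<^sub>x Q\<^sub>q = 0\<close>, \<open>Q\<^sub>u + (k+1) D\<^sub>x Q\<^sub>p = D\<^sub>y Q\<^sub>q\<close> and the values of the remaining inhomogeneous terms;
  these equations do not depend on \<open>m\<close>. Their solutions are polynomials
  \<open>Q = - A(x,y) p - B(y) q + C(y) u + c(x,y)\<close> with six free parameters besides the polynomials
  \<open>c\<close> of degree less than \<open>k\<close>. Conversely each of them induces an affine field on the fibres that
  scales and translates the parameter of \<open>\<gamma>\<close>, and hence preserves all its osculating spaces.\<close>

section \<open>Smooth functions on jet space\<close>

text \<open>Tangency enters the necessity proof as one scalar equation: the functional with
  coefficients binom(k,i) (-l)^(k-i) annihilates all tangent vectors at parameter l. For m > 0 the
  curve itself, where all zeta_j vanish, consists of singular points, at which nothing is assumed;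
  but the equation is affine in zeta_m, so two nonzero values of zeta_m determine it at 0. The
  resulting identities hold only at jets whose coordinates of order at least k are zero. They become
  differential equations for Q_p and Q_q by comparing coefficients of coordinates of order k - 1 in
  total derivatives of order k. For k > 2 these coordinates have order at least 2, hence are not
  arguments of Q, and the linear part of the prolongation is constant on the fibre. The polynomial c
  is not free in top degree: its k-th x-derivative must be -A_y, which produces the terms in x^k/k!
  and x^(k+1)/(k+1)!. The remaining monomials carry divided powers of x, so that d/dx shifts the
  index exactly as bracketing with \<open>e_10\<close> does in the model. Since the fields found do
  not involve m, the isomorphism with the case m = 0 is the identity.\<close>

definition part_diff :: "jfun \<Rightarrow> bool" where
  "part_diff F \<longleftrightarrow> (\<forall>c v. (\<lambda>t. F (v(c := t))) differentiable (at (v c)))"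

text \<open>The lists \<open>cs\<close> range over all coordinates, unlike in
  \<open>smooth_in\<close>; this separates smoothness from the question which coordinates a function
  involves.\<close>

definition smooth :: "jfun \<Rightarrow> bool" where
  "smooth F \<longleftrightarrow> (\<forall>cs. continuous_on UNIV (foldr pd cs F) \<and> part_diff (foldr pd cs F))"

lemma smooth_part_diff: "smooth F \<Longrightarrow> part_diff F"
  unfolding smooth_def by (metis foldr_Nil id_apply)

lemma smooth_cont: "smooth F \<Longrightarrow> continuous_on UNIV F"
  unfolding smooth_def by (metis foldr_Nil id_apply)

lemma smooth_pd [simp, intro]: "smooth F \<Longrightarrow> smooth (pd c F)"
proof -
  assume F: "smooth F"
  have e: "foldr pd (cs @ [c]) F = foldr pd cs (pd c F)" for cs
    by simp
  show "smooth (pd c F)"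
    unfolding smooth_def e[symmetric] using F unfolding smooth_def by blast
qed

lemma part_diff_DERIV:
  assumes "part_diff F"
  shows "((\<lambda>t. F (v(c := t))) has_real_derivative pd c F (v(c := t0))) (at t0)"
proof -
  have "(\<lambda>t. F ((v(c := t0))(c := t))) differentiable (at ((v(c := t0)) c))"
    using assms unfolding part_diff_def by blast
  then have "(\<lambda>t. F (v(c := t))) differentiable (at t0)" by simp
  then show ?thesis
    unfolding pd_def
    by (simp add: DERIV_deriv_iff_real_differentiable)
qed

lemma part_diff_DERIV': "part_diff F \<Longrightarrow> ((\<lambda>t. F (v(c := t))) has_real_derivative pd c F v) (at (v c))"
  using part_diff_DERIV[of F v c "v c"] by simp

lemma pd_eqI:
  assumes "\<And>v. ((\<lambda>t. F (v(c := t))) has_real_derivative H v) (at (v c))"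
  shows "pd c F = H"
  unfolding pd_def using assms by (auto intro!: DERIV_imp_deriv)

lemma part_diffI:
  assumes "\<And>c v. \<exists>D. ((\<lambda>t. F (v(c := t))) has_real_derivative D) (at (v c))"
  shows "part_diff F"
  unfolding part_diff_def using assms real_differentiable_def by blast

lemma pd_const [simp]: "pd c (\<lambda>v. a) = (\<lambda>v. 0)"
  by (rule pd_eqI) simp

lemma pd_coord [simp]: "pd c (\<lambda>v. v d) = (\<lambda>v. if d = c then 1 else 0)"
  by (rule pd_eqI) auto

lemma pd_add_part_diff: "part_diff F \<Longrightarrow> part_diff H \<Longrightarrow> pd c (\<lambda>v. F v + H v) = (\<lambda>v. pd c F v + pd c H v)"
  by (rule pd_eqI) (intro DERIV_add part_diff_DERIV')

lemma pd_mult_part_diff: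
  assumes "part_diff F" "part_diff H"
  shows "pd c (\<lambda>v. F v * H v) = (\<lambda>v. pd c F v * H v + F v * pd c H v)"
proof (rule pd_eqI)
  fix v
  show "((\<lambda>t. F (v(c := t)) * H (v(c := t))) has_real_derivative
      pd c F v * H v + F v * pd c H v) (at (v c))"
    using DERIV_mult[OF part_diff_DERIV'[OF assms(1), of v c] part_diff_DERIV'[OF assms(2), of v c]]
    by (simp add: algebra_simps)
qed

text \<open>A class of continuous, partially differentiable functions closed under partial derivatives
  consists of smooth functions, so closure of smoothness under the ring operations is proved by
  rule induction.\<close>

inductive smooth_gen :: "jfun \<Rightarrow> bool" where
  base: "smooth F \<Longrightarrow> smooth_gen F"
| const: "smooth_gen (\<lambda>v. a)"
| coord: "smooth_gen (\<lambda>v. v d)"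
| add: "smooth_gen F \<Longrightarrow> smooth_gen H \<Longrightarrow> smooth_gen (\<lambda>v. F v + H v)"
| mult: "smooth_gen F \<Longrightarrow> smooth_gen H \<Longrightarrow> smooth_gen (\<lambda>v. F v * H v)"

lemma smooth_gen_part_diff: "smooth_gen F \<Longrightarrow> part_diff F"
proof (induction rule: smooth_gen.induct)
  case (base F) then show ?case by (rule smooth_part_diff)
next
  case (const a) then show ?case by (simp add: part_diff_def)
next
  case (coord d)
  show ?case
  proof (rule part_diffI)
    fix c and v :: jpt
    show "\<exists>D. ((\<lambda>t. (v(c := t)) d) has_real_derivative D) (at (v c))"
      by (cases "c = d") (auto intro!: exI derivative_eq_intros)
  qed
next
  case (add F H) then show ?case
    unfolding part_diff_def by (auto intro: differentiable_add)
next
  case (mult F H) then show ?case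
    unfolding part_diff_def by (auto intro: differentiable_mult)
qed

lemma smooth_gen_cont: "smooth_gen F \<Longrightarrow> continuous_on UNIV F"
  by (induction rule: smooth_gen.induct) (auto intro: smooth_cont intro!: continuous_intros)

lemma smooth_gen_pd: "smooth_gen F \<Longrightarrow> smooth_gen (pd c F)"
proof (induction rule: smooth_gen.induct)
  case (coord d) then show ?case by (simp add: smooth_gen.const)
qed (auto intro: smooth_gen.intros simp: pd_add_part_diff pd_mult_part_diff smooth_gen_part_diff)

lemma smooth_gen_smooth: "smooth_gen F \<Longrightarrow> smooth F"
proof -
  assume F: "smooth_gen F"
  have "smooth_gen (foldr pd cs F)" for cs
    by (induction cs) (auto intro: F smooth_gen_pd)
  then show ?thesis unfolding smooth_def by (blast intro: smooth_gen_cont smooth_gen_part_diff)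
qed

lemma smooth_const [simp, intro]: "smooth (\<lambda>v. a)"
  by (rule smooth_gen_smooth, rule smooth_gen.const)
lemma smooth_coord [simp, intro]: "smooth (\<lambda>v. v d)"
  by (rule smooth_gen_smooth, rule smooth_gen.coord)
lemma smooth_add [simp, intro]: "smooth F \<Longrightarrow> smooth H \<Longrightarrow> smooth (\<lambda>v. F v + H v)"
  by (rule smooth_gen_smooth, rule smooth_gen.add; rule smooth_gen.base)
lemma smooth_mult [simp, intro]: "smooth F \<Longrightarrow> smooth H \<Longrightarrow> smooth (\<lambda>v. F v * H v)"
  by (rule smooth_gen_smooth, rule smooth_gen.mult; rule smooth_gen.base)
lemma smooth_minus [simp, intro]: "smooth F \<Longrightarrow> smooth (\<lambda>v. - F v)"
  using smooth_mult[OF smooth_const[of "-1"], of F] by simp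
lemma smooth_diff [simp, intro]: "smooth F \<Longrightarrow> smooth H \<Longrightarrow> smooth (\<lambda>v. F v - H v)"
  using smooth_add[OF _ smooth_minus, of F H] by simp
lemma smooth_power [simp, intro]: "smooth F \<Longrightarrow> smooth (\<lambda>v. F v ^ n)"
  by (induction n) auto
lemma smooth_divide [simp, intro]: "smooth F \<Longrightarrow> smooth (\<lambda>v. F v / a)"
  using smooth_mult[OF _ smooth_const[of "1/a"], of F] by simp
lemma smooth_sum [simp, intro]: "(\<And>i. i \<in> I \<Longrightarrow> smooth (F i)) \<Longrightarrow> smooth (\<lambda>v. \<Sum>i\<in>I. F i v)"
  by (induction I rule: infinite_finite_induct) auto
lemma smooth_if [simp, intro]: "smooth F \<Longrightarrow> smooth H \<Longrightarrow> smooth (\<lambda>v. if b then F v else H v)"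
  by (cases b) auto

lemma pd_add [simp]: "smooth F \<Longrightarrow> smooth H \<Longrightarrow> pd c (\<lambda>v. F v + H v) = (\<lambda>v. pd c F v + pd c H v)"
  by (intro pd_add_part_diff smooth_part_diff)
lemma pd_mult [simp]:
  "smooth F \<Longrightarrow> smooth H \<Longrightarrow> pd c (\<lambda>v. F v * H v) = (\<lambda>v. pd c F v * H v + F v * pd c H v)"
  by (intro pd_mult_part_diff smooth_part_diff)
lemma pd_minus [simp]: "smooth F \<Longrightarrow> pd c (\<lambda>v. - F v) = (\<lambda>v. - pd c F v)"
  using pd_mult[OF smooth_const[of "-1"], of F c] by simp
lemma pd_diff [simp]: "smooth F \<Longrightarrow> smooth H \<Longrightarrow> pd c (\<lambda>v. F v - H v) = (\<lambda>v. pd c F v - pd c H v)"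
  using pd_add[OF _ smooth_minus, of F H c] by simp
lemma pd_divide [simp]: "smooth F \<Longrightarrow> pd c (\<lambda>v. F v / a) = (\<lambda>v. pd c F v / a)"
  using pd_mult[OF _ smooth_const[of "1/a"], of F c] by simp
lemma pd_power [simp]:
  "smooth F \<Longrightarrow> pd c (\<lambda>v. F v ^ n) = (\<lambda>v. real n * F v ^ (n - 1) * pd c F v)"
proof (induction n)
  case (Suc n)
  then have "pd c (\<lambda>v. F v ^ Suc n) = (\<lambda>v. pd c F v * F v ^ n + F v * (real n * F v ^ (n - 1) * pd c F v))"
    by simp
  also have "\<dots> = (\<lambda>v. real (Suc n) * F v ^ (Suc n - 1) * pd c F v)"
    by (cases n) (auto simp: algebra_simps)
  finally show ?case .
qed simp
lemma pd_sum [simp]: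
  "(\<And>i. i \<in> I \<Longrightarrow> smooth (F i)) \<Longrightarrow> pd c (\<lambda>v. \<Sum>i\<in>I. F i v) = (\<lambda>v. \<Sum>i\<in>I. pd c (F i) v)"
  by (induction I rule: infinite_finite_induct) auto
lemma depends_only_mono: "depends_only S F \<Longrightarrow> S \<subseteq> T \<Longrightarrow> depends_only T F"
  unfolding depends_only_def by blast

lemma pd_eq_0:
  assumes "depends_only S F" "c \<notin> S"
  shows "pd c F = (\<lambda>v. 0)"
proof (rule pd_eqI)
  fix v
  have "F (v(c := t)) = F v" for t
    using assms unfolding depends_only_def by (metis fun_upd_other)
  then show "((\<lambda>t. F (v(c := t))) has_real_derivative 0) (at (v c))"
    by simp
qed

lemma depends_only_pd [simp, intro]:
  assumes F: "depends_only S F"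
  shows "depends_only S (pd c F)"
proof (cases "c \<in> S")
  case True
  show ?thesis
    unfolding depends_only_def
  proof (intro allI impI)
    fix v w :: jpt assume vw: "\<forall>c\<in>S. v c = w c"
    then have "F (v(c := t)) = F (w(c := t))" for t
      by (intro F[unfolded depends_only_def, rule_format]) auto
    with vw True show "pd c F v = pd c F w" unfolding pd_def by simp
  qed
next
  case False
  then show ?thesis using pd_eq_0[OF F] by (simp add: depends_only_def)
qed

lemma depends_only_foldr: "depends_only S F \<Longrightarrow> depends_only S (foldr pd cs F)"
  by (induction cs) auto

text \<open>Partial derivatives along coordinates outside \<open>S\<close> vanish identically, so
  lists leaving \<open>S\<close> add only zero functions.\<close>

lemma smooth_in_iff: "smooth_in S F \<longleftrightarrow> depends_only S F \<and> smooth F"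
proof
  assume s: "smooth_in S F"
  then have d: "depends_only S F" by (simp add: smooth_in_def)
  have "continuous_on UNIV (foldr pd cs F) \<and> part_diff (foldr pd cs F)" for cs
  proof (cases "set cs \<subseteq> S")
    case True
    have "(\<lambda>t. foldr pd cs F (v(c := t))) differentiable (at (v c))" for c v
    proof (cases "c \<in> S")
      case True then show ?thesis using s \<open>set cs \<subseteq> S\<close> unfolding smooth_in_def by blast
    next
      case False
      then have "foldr pd cs F (v(c := t)) = foldr pd cs F v" for t
        using depends_only_foldr[OF d, of cs] unfolding depends_only_def by (metis fun_upd_other)
      then show ?thesis by simp
    qed
    then show ?thesis using s True unfolding smooth_in_def part_diff_def by blast
  next
    case False
    have "foldr pd cs F = (\<lambda>v. 0)" using False
    proof (induction cs)
      case (Cons c cs)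
      show ?case
      proof (cases "set cs \<subseteq> S")
        case True
        then have "c \<notin> S" using Cons by auto
        then show ?thesis using pd_eq_0[OF depends_only_foldr[OF d]] by simp
      next
        case False then show ?thesis using Cons by simp
      qed
    qed simp
    then show ?thesis by (simp add: part_diff_def)
  qed
  then show "depends_only S F \<and> smooth F" using d by (simp add: smooth_def)
next
  assume "depends_only S F \<and> smooth F"
  then show "smooth_in S F" unfolding smooth_in_def smooth_def part_diff_def by blast
qed

section \<open>Equality of mixed partial derivatives\<close>

text \<open>The second difference of f over a square of side h equals h^2 times a value of either
  mixed partial inside the square, by two applications of the mean value theorem in either order. As
  h tends to 0 continuity forces the values at the corner to agree.\<close>

lemma mixed_partials_eq:
  fixes f :: "real \<Rightarrow> real \<Rightarrow> real"
  assumes f1: "\<And>s t. ((\<lambda>s. f s t) has_real_derivative f1 s t) (at s)"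
    and f2: "\<And>s t. ((\<lambda>t. f s t) has_real_derivative f2 s t) (at t)"
    and f12: "\<And>s t. ((\<lambda>t. f1 s t) has_real_derivative f12 s t) (at t)"
    and f21: "\<And>s t. ((\<lambda>s. f2 s t) has_real_derivative f21 s t) (at s)"
    and c12: "continuous_on UNIV (\<lambda>z. f12 (fst z) (snd z))"
    and c21: "continuous_on UNIV (\<lambda>z. f21 (fst z) (snd z))"
  shows "f12 s t = f21 s t"
proof -
  have ex: "\<exists>a b a' b'. s < a \<and> a < s + h \<and> t < b \<and> b < t + h \<and> s < a' \<and> a' < s + h \<and> t < b' \<and> b' < t + h
      \<and> f12 a b = f21 a' b'" if h: "h > 0" for h
  proof -
    have "\<exists>a. s < a \<and> a < s + h \<and> (f (s+h) (t+h) - f (s+h) t) - (f s (t+h) - f s t)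
        = (s + h - s) * (f1 a (t+h) - f1 a t)"
      using h by (intro MVT2) (auto intro!: DERIV_diff f1)
    then obtain a where a: "s < a" "a < s + h" "(f (s+h) (t+h) - f (s+h) t) - (f s (t+h) - f s t)
        = h * (f1 a (t+h) - f1 a t)" by auto
    have "\<exists>b. t < b \<and> b < t + h \<and> f1 a (t+h) - f1 a t = (t + h - t) * f12 a b"
      using h by (intro MVT2) (auto intro!: f12)
    then obtain b where b: "t < b" "b < t + h" "f1 a (t+h) - f1 a t = h * f12 a b" by auto
    have "\<exists>b. t < b \<and> b < t + h \<and> (f (s+h) (t+h) - f s (t+h)) - (f (s+h) t - f s t)
        = (t + h - t) * (f2 (s+h) b - f2 s b)"
      using h by (intro MVT2) (auto intro!: DERIV_diff f2)
    then obtain b' where b': "t < b'" "b' < t + h" "(f (s+h) (t+h) - f s (t+h)) - (f (s+h) t - f s t)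
        = h * (f2 (s+h) b' - f2 s b')" by auto
    have "\<exists>a. s < a \<and> a < s + h \<and> f2 (s+h) b' - f2 s b' = (s + h - s) * f21 a b'"
      using h by (intro MVT2) (auto intro!: f21)
    then obtain a' where a': "s < a'" "a' < s + h" "f2 (s+h) b' - f2 s b' = h * f21 a' b'" by auto
    have "h * (h * f12 a b) = h * (h * f21 a' b')"
      using a(3) b'(3) unfolding b(3) a'(3) by linarith
    then have "f12 a b = f21 a' b'" using h by simp
    then show ?thesis using a b a' b' by blast
  qed
  have "\<exists>a b a' b'. s < a \<and> a < s + inverse (real (Suc n)) \<and> t < b \<and> b < t + inverse (real (Suc n)) \<and>
      s < a' \<and> a' < s + inverse (real (Suc n)) \<and> t < b' \<and> b' < t + inverse (real (Suc n))
      \<and> f12 a b = f21 a' b'" for n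
    by (rule ex) simp
  then obtain a b a' b' where ab:
    "\<And>n. s < a n \<and> a n < s + inverse (real (Suc n)) \<and> t < b n \<and> b n < t + inverse (real (Suc n)) \<and>
      s < a' n \<and> a' n < s + inverse (real (Suc n)) \<and> t < b' n \<and> b' n < t + inverse (real (Suc n))
      \<and> f12 (a n) (b n) = f21 (a' n) (b' n)" by metis
  have sq: "x \<longlonglongrightarrow> l" if "\<And>n. l < x n \<and> x n < l + inverse (real (Suc n))" for x :: "nat \<Rightarrow> real" and l
  proof (rule tendsto_sandwich[of "\<lambda>_. l" x _ "\<lambda>n. l + inverse (real (Suc n))"])
    show "(\<lambda>n. l + inverse (real (Suc n))) \<longlonglongrightarrow> l"
      using LIMSEQ_inverse_real_of_nat_add[of l] by simp
  qed (use that less_imp_le in \<open>blast intro: always_eventually tendsto_const\<close>)+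
  have "(\<lambda>n. (a n, b n)) \<longlonglongrightarrow> (s, t)" "(\<lambda>n. (a' n, b' n)) \<longlonglongrightarrow> (s, t)"
    using ab by (auto intro!: tendsto_Pair sq)
  then have "(\<lambda>n. f12 (a n) (b n)) \<longlonglongrightarrow> f12 s t" "(\<lambda>n. f21 (a' n) (b' n)) \<longlonglongrightarrow> f21 s t"
    using continuous_on_tendsto_compose[OF c12] continuous_on_tendsto_compose[OF c21] by fastforce+
  then show ?thesis using ab LIMSEQ_unique by simp
qed

lemma continuous_on_two_coords:
  "continuous_on UNIV (\<lambda>z::real \<times> real. (v(c := fst z, d := snd z)) :: jpt)"
proof (rule continuous_on_coordinatewise_then_product)
  fix i
  show "continuous_on UNIV (\<lambda>z::real \<times> real. (v(c := fst z, d := snd z)) i)"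
    by (cases "i = d"; cases "i = c") (auto intro: continuous_intros)
qed

lemma pd_commute:
  assumes F: "smooth F"
  shows "pd c (pd d F) = pd d (pd c F)"
proof (cases "c = d")
  case False
  show ?thesis
  proof
    fix v :: jpt
    have sw: "v(c := s, d := t) = v(d := t, c := s)" for s t
      using False by (simp add: fun_upd_twist)
    have cont: "continuous_on UNIV (\<lambda>z::real \<times> real. H (v(c := fst z, d := snd z)))" if "smooth H" for H
      by (rule continuous_on_compose2[OF smooth_cont[OF that] continuous_on_two_coords]) auto
    have c1: "((\<lambda>s. H (v(c := s, d := t))) has_real_derivative pd c H (v(c := s, d := t))) (at s)"
      if "smooth H" for H s t
      unfolding sw by (rule part_diff_DERIV[OF smooth_part_diff[OF that]])
    have d1: "((\<lambda>t. H (v(c := s, d := t))) has_real_derivative pd d H (v(c := s, d := t))) (at t)"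
      if "smooth H" for H s t
      by (rule part_diff_DERIV[OF smooth_part_diff[OF that]])
    have "pd d (pd c F) (v(c := v c, d := v d)) = pd c (pd d F) (v(c := v c, d := v d))"
      by (rule mixed_partials_eq[where f = "\<lambda>s t. F (v(c := s, d := t))"
            and ?f1.0 = "\<lambda>s t. pd c F (v(c := s, d := t))" and ?f2.0 = "\<lambda>s t. pd d F (v(c := s, d := t))"
            and ?f12.0 = "\<lambda>s t. pd d (pd c F) (v(c := s, d := t))"
            and ?f21.0 = "\<lambda>s t. pd c (pd d F) (v(c := s, d := t))"])
        (auto intro!: c1 d1 cont F)
    then show "pd c (pd d F) v = pd d (pd c F) v" by simp
  qed
qed simp

section \<open>Total derivatives and contact vector fields\<close>

abbreviation "pp \<equiv> UU (Suc 0) 0"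
abbreviation "qq \<equiv> UU 0 (Suc 0)"
abbreviation "uu \<equiv> UU 0 0"

definition jets :: "nat \<Rightarrow> jvar set" where
  "jets n = {XX, YY} \<union> {UU i j |i j. i + j \<le> n}"

lemma jets_simps [simp]: "XX \<in> jets n" "YY \<in> jets n" "UU i j \<in> jets n \<longleftrightarrow> i + j \<le> n"
  by (auto simp: jets_def)

lemma jets_mono: "m \<le> n \<Longrightarrow> jets m \<subseteq> jets n"
  by (auto simp: jets_def)

lemma J1_eq_jets: "J1 = jets 1"
proof -
  have "i + j \<le> 1 \<longleftrightarrow> (i, j) \<in> {(0,0),(1,0),(0,1)}" for i j :: nat
    by auto
  then show ?thesis unfolding J1_def jets_def by auto
qed

lemma finite_order_le [simp]: "finite {(i::nat,j). i + j \<le> M}"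
  by (rule finite_subset[of _ "{..M} \<times> {..M}"]) auto

text \<open>The common form of the two total derivatives: \<open>e\<close> is the independent variable and \<open>s\<close>
  maps the index of a jet coordinate to its derivative along \<open>e\<close>.\<close>

definition Dtot :: "jvar \<Rightarrow> (nat \<times> nat \<Rightarrow> jvar) \<Rightarrow> nat \<Rightarrow> jfun \<Rightarrow> jfun" where
  "Dtot e s M F = (\<lambda>v. pd e F v + (\<Sum>q\<in>{(i,j). i + j \<le> M}. v (s q) * pd (UU (fst q) (snd q)) F v))"

lemma Dx_Dtot: "Dx M = Dtot XX (\<lambda>q. UU (Suc (fst q)) (snd q)) M"
  by (simp add: Dx_def Dtot_def fun_eq_iff case_prod_unfold)

lemma Dy_Dtot: "Dy M = Dtot YY (\<lambda>q. UU (fst q) (Suc (snd q))) M"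
  by (simp add: Dy_def Dtot_def fun_eq_iff case_prod_unfold)

lemma smooth_Dtot: "smooth F \<Longrightarrow> smooth (Dtot e s M F)"
  unfolding Dtot_def by (intro smooth_add smooth_sum smooth_mult smooth_pd smooth_coord)

lemma Dtot_add: "smooth F \<Longrightarrow> smooth H \<Longrightarrow> Dtot e s M (\<lambda>v. F v + H v) = (\<lambda>v. Dtot e s M F v + Dtot e s M H v)"
  by (simp add: Dtot_def algebra_simps sum.distrib)

lemma Dtot_mult: "smooth F \<Longrightarrow> smooth H \<Longrightarrow>
    Dtot e s M (\<lambda>v. F v * H v) = (\<lambda>v. Dtot e s M F v * H v + F v * Dtot e s M H v)"
  by (simp add: Dtot_def algebra_simps sum.distrib sum_distrib_left sum_distrib_right)

lemma Dtot_const: "Dtot e s M (\<lambda>v. a) = (\<lambda>v. 0)"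
  by (simp add: Dtot_def)

lemma Dtot_coord:
  "i + j \<le> M \<Longrightarrow> Dtot e s M (\<lambda>v. v (UU i j)) = (\<lambda>v. (if e = UU i j then 1 else 0) + v (s (i, j)))"
proof -
  assume ij: "i + j \<le> M"
  have "(\<Sum>q\<in>{(i,j). i + j \<le> M}. v (s q) * (if UU i j = UU (fst q) (snd q) then 1 else 0))
      = (\<Sum>q\<in>{(i,j). i + j \<le> M}. if q = (i, j) then v (s q) else 0)" for v :: jpt
    by (rule sum.cong) (auto simp: prod_eq_iff)
  then show ?thesis using ij by (auto simp: Dtot_def fun_eq_iff)
qed

lemma Dtot_base: "e = XX \<or> e = YY \<Longrightarrow> d = XX \<or> d = YY \<Longrightarrow>
    Dtot e s M (\<lambda>v. v d) = (\<lambda>v. if d = e then 1 else 0)"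
  by (auto simp: Dtot_def fun_eq_iff intro!: sum.neutral)

text \<open>The coefficients \<open>v (s q)\<close> of the total derivative are themselves
  coordinates; differentiating those with \<open>s q = c\<close> gives the commutator term.\<close>

lemma pd_Dtot:
  assumes "smooth F"
  shows "pd c (Dtot e s M F) = (\<lambda>v. Dtot e s M (pd c F) v
    + (\<Sum>q\<in>{q. fst q + snd q \<le> M \<and> s q = c}. pd (UU (fst q) (snd q)) F v))"
proof -
  have "pd c (Dtot e s M F) v = Dtot e s M (pd c F) v
    + (\<Sum>q\<in>{(i,j). i + j \<le> M}. if s q = c then pd (UU (fst q) (snd q)) F v else 0)" for v
    unfolding Dtot_def using assms
    by (simp add: pd_commute[OF assms, of c] sum.distrib algebra_simps if_distrib[of "\<lambda>x. x * _"] cong: if_cong)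
  moreover have "{q. fst q + snd q \<le> M \<and> s q = c} = {q \<in> {(i,j). i + j \<le> M}. s q = c}" by auto
  ultimately show ?thesis
    by (simp only: fun_eq_iff sum.inter_filter[OF finite_order_le]) simp
qed

lemma depends_Dtot:
  assumes F: "depends_only (jets n) F" and e: "e = XX \<or> e = YY"
    and s: "\<And>i j. i + j \<le> n \<Longrightarrow> s (i,j) \<in> jets (Suc n)"
  shows "depends_only (jets (Suc n)) (Dtot e s M F)"
  unfolding depends_only_def
proof (intro allI impI)
  fix v w :: jpt assume vw: "\<forall>c\<in>jets (Suc n). v c = w c"
  then have vw': "\<forall>c\<in>jets n. v c = w c"
    using jets_mono[of n "Suc n"] by auto
  have pdvw: "pd c F v = pd c F w" for c
    using depends_only_pd[OF F, of c] vw' unfolding depends_only_def by blast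
  have "v (s q) * pd (UU (fst q) (snd q)) F v = w (s q) * pd (UU (fst q) (snd q)) F w" for q
  proof (cases "fst q + snd q \<le> n")
    case True
    then have "s q \<in> jets (Suc n)" using s[of "fst q" "snd q"] by simp
    then show ?thesis using vw pdvw by simp
  next
    case False
    then have "UU (fst q) (snd q) \<notin> jets n" by simp
    then show ?thesis by (simp add: pd_eq_0[OF F])
  qed
  then show "Dtot e s M F v = Dtot e s M F w"
    unfolding Dtot_def pdvw[of e] by (intro arg_cong2[where f = plus] refl sum.cong)
qed

lemma smooth_Dx [simp, intro]: "smooth F \<Longrightarrow> smooth (Dx M F)" and smooth_Dy [simp, intro]: "smooth F \<Longrightarrow> smooth (Dy M F)"
  by (simp_all add: Dx_Dtot Dy_Dtot smooth_Dtot)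

lemma Dx_add [simp]: "smooth F \<Longrightarrow> smooth H \<Longrightarrow> Dx M (\<lambda>v. F v + H v) = (\<lambda>v. Dx M F v + Dx M H v)"
  and Dy_add [simp]: "smooth F \<Longrightarrow> smooth H \<Longrightarrow> Dy M (\<lambda>v. F v + H v) = (\<lambda>v. Dy M F v + Dy M H v)"
  by (simp_all add: Dx_Dtot Dy_Dtot Dtot_add)

lemma Dx_mult [simp]: "smooth F \<Longrightarrow> smooth H \<Longrightarrow> Dx M (\<lambda>v. F v * H v) = (\<lambda>v. Dx M F v * H v + F v * Dx M H v)"
  and Dy_mult [simp]: "smooth F \<Longrightarrow> smooth H \<Longrightarrow> Dy M (\<lambda>v. F v * H v) = (\<lambda>v. Dy M F v * H v + F v * Dy M H v)"
  by (simp_all add: Dx_Dtot Dy_Dtot Dtot_mult)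

lemma Dx_const [simp]: "Dx M (\<lambda>v. a) = (\<lambda>v. 0)" and Dy_const [simp]: "Dy M (\<lambda>v. a) = (\<lambda>v. 0)"
  by (simp_all add: Dx_Dtot Dy_Dtot Dtot_const)

lemma Dx_coord [simp]: "Dx M (\<lambda>v. v XX) = (\<lambda>v. 1)" "Dx M (\<lambda>v. v YY) = (\<lambda>v. 0)"
    "i + j \<le> M \<Longrightarrow> Dx M (\<lambda>v. v (UU i j)) = (\<lambda>v. v (UU (Suc i) j))"
  and Dy_coord [simp]: "Dy M (\<lambda>v. v YY) = (\<lambda>v. 1)" "Dy M (\<lambda>v. v XX) = (\<lambda>v. 0)"
    "i + j \<le> M \<Longrightarrow> Dy M (\<lambda>v. v (UU i j)) = (\<lambda>v. v (UU i (Suc j)))"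
  by (simp_all add: Dx_Dtot Dy_Dtot Dtot_base Dtot_coord)

lemma Dx_if [simp]: "Dx M (\<lambda>v. if b then F v else H v) = (\<lambda>v. if b then Dx M F v else Dx M H v)"
  and Dy_if [simp]: "Dy M (\<lambda>v. if b then F v else H v) = (\<lambda>v. if b then Dy M F v else Dy M H v)"
  by (cases b; simp)+

lemma Dx_minus [simp]: "smooth F \<Longrightarrow> Dx M (\<lambda>v. - F v) = (\<lambda>v. - Dx M F v)"
  and Dy_minus [simp]: "smooth F \<Longrightarrow> Dy M (\<lambda>v. - F v) = (\<lambda>v. - Dy M F v)"
  using Dx_mult[OF smooth_const[of "-1"], of F M] Dy_mult[OF smooth_const[of "-1"], of F M] by simp_all

lemma Dx_diff [simp]: "smooth F \<Longrightarrow> smooth H \<Longrightarrow> Dx M (\<lambda>v. F v - H v) = (\<lambda>v. Dx M F v - Dx M H v)"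
  and Dy_diff [simp]: "smooth F \<Longrightarrow> smooth H \<Longrightarrow> Dy M (\<lambda>v. F v - H v) = (\<lambda>v. Dy M F v - Dy M H v)"
  using Dx_add[OF _ smooth_minus, of F H M] Dy_add[OF _ smooth_minus, of F H M] by simp_all

lemma pd_Dx:
  assumes "smooth F"
  shows "pd XX (Dx M F) = Dx M (pd XX F)" "pd YY (Dx M F) = Dx M (pd YY F)"
    "pd (UU 0 j) (Dx M F) = Dx M (pd (UU 0 j) F)"
    "i + j \<le> M \<Longrightarrow> pd (UU (Suc i) j) (Dx M F) = (\<lambda>v. Dx M (pd (UU (Suc i) j) F) v + pd (UU i j) F v)"
proof -
  have "{q. fst q + snd q \<le> M \<and> UU (Suc (fst q)) (snd q) = UU (Suc i) j} = {(i, j)}" if "i + j \<le> M"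
    using that by auto
  then show "i + j \<le> M \<Longrightarrow> pd (UU (Suc i) j) (Dx M F) = (\<lambda>v. Dx M (pd (UU (Suc i) j) F) v + pd (UU i j) F v)"
    unfolding Dx_Dtot pd_Dtot[OF assms] by simp
qed (simp_all add: Dx_Dtot pd_Dtot[OF assms])

lemma pd_Dy:
  assumes "smooth F"
  shows "pd XX (Dy M F) = Dy M (pd XX F)" "pd YY (Dy M F) = Dy M (pd YY F)"
    "pd (UU i 0) (Dy M F) = Dy M (pd (UU i 0) F)"
    "i + j \<le> M \<Longrightarrow> pd (UU i (Suc j)) (Dy M F) = (\<lambda>v. Dy M (pd (UU i (Suc j)) F) v + pd (UU i j) F v)"
proof -
  have "{q. fst q + snd q \<le> M \<and> UU (fst q) (Suc (snd q)) = UU i (Suc j)} = {(i, j)}" if "i + j \<le> M"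
    using that by auto
  then show "i + j \<le> M \<Longrightarrow> pd (UU i (Suc j)) (Dy M F) = (\<lambda>v. Dy M (pd (UU i (Suc j)) F) v + pd (UU i j) F v)"
    unfolding Dy_Dtot pd_Dtot[OF assms] by simp
qed (simp_all add: Dy_Dtot pd_Dtot[OF assms])

lemma depends_Dx: "depends_only (jets n) F \<Longrightarrow> depends_only (jets (Suc n)) (Dx M F)"
  and depends_Dy: "depends_only (jets n) F \<Longrightarrow> depends_only (jets (Suc n)) (Dy M F)"
  unfolding Dx_Dtot Dy_Dtot by (rule depends_Dtot; simp)+

section \<open>Iterated total derivatives and their highest-order coefficients\<close>

definition total_deriv :: "nat \<Rightarrow> nat \<Rightarrow> nat \<Rightarrow> jfun \<Rightarrow> jfun" where
  "total_deriv M a b F = (Dx M ^^ a) ((Dy M ^^ b) F)"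

lemma total_deriv_0 [simp]: "total_deriv M 0 0 F = F"
  and total_deriv_Suc_x: "total_deriv M (Suc a) b F = Dx M (total_deriv M a b F)"
  and total_deriv_Suc_y: "total_deriv M 0 (Suc b) F = Dy M (total_deriv M 0 b F)"
  by (simp_all add: total_deriv_def)

text \<open>The cases follow the nesting in \<open>total_deriv\<close>: y-derivatives innermost,
  with a = 0, then x-derivatives around them.\<close>

lemma total_deriv_induct [case_names 0 y x]:
  assumes "P 0 0" "\<And>b. P 0 b \<Longrightarrow> P 0 (Suc b)" "\<And>a b. P a b \<Longrightarrow> P (Suc a) b"
  shows "P a b"
proof (induction a)
  case 0 show ?case by (induction b) (use assms in auto)
qed (use assms in auto)

lemma smooth_total_deriv [simp, intro]: "smooth F \<Longrightarrow> smooth (total_deriv M a b F)"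
  by (induction a b rule: total_deriv_induct) (auto simp: total_deriv_Suc_x total_deriv_Suc_y)

lemma depends_total_deriv: "depends_only (jets n) F \<Longrightarrow> depends_only (jets (n + a + b)) (total_deriv M a b F)"
  by (induction a b rule: total_deriv_induct) (auto simp: total_deriv_Suc_x total_deriv_Suc_y depends_Dx depends_Dy)

lemma total_deriv_lin: "smooth F \<Longrightarrow> smooth H \<Longrightarrow>
    total_deriv M a b (\<lambda>v. r * F v + s * H v) = (\<lambda>v. r * total_deriv M a b F v + s * total_deriv M a b H v)"
  by (induction a b rule: total_deriv_induct) (auto simp: total_deriv_Suc_x total_deriv_Suc_y)

lemma pd_total_deriv_above:
  "depends_only (jets 1) Q \<Longrightarrow> i + j > Suc (a + b) \<Longrightarrow> pd (UU i j) (total_deriv M a b Q) = (\<lambda>v. 0)"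
  by (rule pd_eq_0[OF depends_total_deriv]) auto

text \<open>Each total derivative moves the top coefficient to the next coordinate; lower-order
  contributions vanish because the inner derivative has order too small. The same two coefficients
  occur with opposite sign in \<open>prol_contact_vf\<close>.\<close>

lemma pd_total_deriv_order_Suc:
  assumes Q: "smooth Q" "depends_only (jets 1) Q" and "a + b \<le> M" "i + j = Suc (a + b)"
  shows "pd (UU i j) (total_deriv M a b Q) = (\<lambda>v. (if i = Suc a \<and> j = b then pd pp Q v else 0)
      + (if i = a \<and> j = Suc b then pd qq Q v else 0))"
  using assms(3,4)
proof (induction a b arbitrary: i j rule: total_deriv_induct)
  case 0
  then have "i = 1 \<and> j = 0 \<or> i = 0 \<and> j = 1" by auto
  then show ?case by auto
next
  case (y b)
  note z = pd_total_deriv_above[OF Q(2), of 0 b i j M]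
  show ?case
  proof (cases j)
    case 0 then show ?thesis using y z by (auto simp: total_deriv_Suc_y pd_Dy Q)
  next
    case (Suc j') then show ?thesis using y.IH[of i j'] y.prems z by (auto simp: total_deriv_Suc_y pd_Dy Q)
  qed
next
  case (x a b)
  note z = pd_total_deriv_above[OF Q(2), of a b i j M]
  show ?case
  proof (cases i)
    case 0 then show ?thesis using x z by (auto simp: total_deriv_Suc_x pd_Dx Q)
  next
    case (Suc i') then show ?thesis using x.IH[of i' j] x.prems z by (auto simp: total_deriv_Suc_x pd_Dx Q)
  qed
qed

text \<open>The coefficients of the order \<open>a + b\<close> coordinates only involve coordinates of order at most
  two, because the total derivatives commute with the partial ones up to lowering the order.\<close>

lemma pd_total_deriv_order_eq:
  assumes Q: "smooth Q" "depends_only (jets 1) Q" and "a + b \<le> M" "i + j = a + b"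
  shows "pd (UU i j) (total_deriv M a b Q) = (\<lambda>v.
      (if i = a \<and> j = b then pd uu Q v + real a * Dx M (pd pp Q) v + real b * Dy M (pd qq Q) v else 0)
      + (if i = Suc a \<and> Suc j = b then real b * Dy M (pd pp Q) v else 0)
      + (if Suc i = a \<and> j = Suc b then real a * Dx M (pd qq Q) v else 0))"
  using assms(3,4)
proof (induction a b arbitrary: i j rule: total_deriv_induct)
  case 0
  then show ?case by auto
next
  case (y b)
  note z = pd_total_deriv_order_Suc[OF Q, of 0 b M i j]
  show ?case
  proof (cases j)
    case 0 then show ?thesis using y z by (auto simp: total_deriv_Suc_y pd_Dy Q)
  next
    case (Suc j')
    have "pd (UU i j) (total_deriv M 0 (Suc b) Q) = (\<lambda>v. Dy M (pd (UU i j) (total_deriv M 0 b Q)) v + pd (UU i j') (total_deriv M 0 b Q) v)"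
      unfolding total_deriv_Suc_y Suc using y.prems Suc by (intro pd_Dy(4)) (auto simp: Q)
    also have "\<dots> = (\<lambda>v. Dy M (\<lambda>v. (if i = Suc 0 \<and> j = b then pd pp Q v else 0)
      + (if i = 0 \<and> j = Suc b then pd qq Q v else 0)) v + pd (UU i j') (total_deriv M 0 b Q) v)"
      using z y.prems by simp
    finally show ?thesis
      using y.IH[of i j'] y.prems Suc by (cases "j' = b"; cases "Suc j' = b") (auto simp: Q algebra_simps)
  qed
next
  case (x a b)
  note z = pd_total_deriv_order_Suc[OF Q, of a b M i j]
  show ?case
  proof (cases i)
    case 0 then show ?thesis using x z by (auto simp: total_deriv_Suc_x pd_Dx Q)
  next
    case (Suc i')
    have "pd (UU i j) (total_deriv M (Suc a) b Q) = (\<lambda>v. Dx M (pd (UU i j) (total_deriv M a b Q)) v + pd (UU i' j) (total_deriv M a b Q) v)"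
      unfolding total_deriv_Suc_x Suc using x.prems Suc by (intro pd_Dx(4)) (auto simp: Q)
    also have "\<dots> = (\<lambda>v. Dx M (\<lambda>v. (if i = Suc a \<and> j = b then pd pp Q v else 0)
      + (if i = a \<and> j = Suc b then pd qq Q v else 0)) v + pd (UU i' j) (total_deriv M a b Q) v)"
      using z x.prems by simp
    finally show ?thesis
      using x.IH[of i' j] x.prems Suc by (cases "i' = a"; cases "i' = Suc a"; cases "Suc i' = a") (auto simp: Q algebra_simps)
  qed
qed

section \<open>Contact fields and their generating functions\<close>

text \<open>The signs are those for which theta(V) = Q with theta = du - p dx - q dy.\<close>

definition contact_vf :: "jfun \<Rightarrow> vfield" where
  "contact_vf Q c = (case c of XX \<Rightarrow> (\<lambda>v. - pd pp Q v) | YY \<Rightarrow> (\<lambda>v. - pd qq Q v)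
     | UU i j \<Rightarrow> (if i = 0 \<and> j = 0 then (\<lambda>v. Q v - v pp * pd pp Q v - v qq * pd qq Q v)
        else if i = 1 \<and> j = 0 then (\<lambda>v. pd XX Q v + v pp * pd uu Q v)
        else if i = 0 \<and> j = 1 then (\<lambda>v. pd YY Q v + v qq * pd uu Q v)
        else (\<lambda>v. 0)))"

lemma charf_contact_vf: "charf (contact_vf Q) = Q"
  by (simp add: charf_def contact_vf_def fun_eq_iff)

lemma depends_only_const [simp]: "depends_only S (\<lambda>v. a)"
  and depends_only_coord [simp]: "c \<in> S \<Longrightarrow> depends_only S (\<lambda>v. v c)"
  by (simp_all add: depends_only_def)

lemma depends_only_ops [simp]:
  assumes "depends_only S F"
  shows "depends_only S (\<lambda>v. - F v)"
    and "depends_only S H \<Longrightarrow> depends_only S (\<lambda>v. F v + H v)"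
    and "depends_only S H \<Longrightarrow> depends_only S (\<lambda>v. F v - H v)"
    and "depends_only S H \<Longrightarrow> depends_only S (\<lambda>v. F v * H v)"
    and "depends_only S (\<lambda>v. F v ^ n)"
    and "depends_only S (\<lambda>v. F v / a)"
  using assms unfolding depends_only_def by metis+

lemma depends_only_sum [simp]:
  "(\<And>i. i \<in> I \<Longrightarrow> depends_only S (F i)) \<Longrightarrow> depends_only S (\<lambda>v. \<Sum>i\<in>I. F i v)"
  by (induction I rule: infinite_finite_induct) auto

lemma J1_mem [simp]: "XX \<in> J1" "YY \<in> J1" "uu \<in> J1" "pp \<in> J1" "qq \<in> J1"
  by (auto simp: J1_def)

lemma vf_J1_contact_vf: "smooth Q \<Longrightarrow> depends_only J1 Q \<Longrightarrow> vf_J1 (contact_vf Q)"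
  unfolding vf_J1_def
proof (intro conjI allI impI ballI)
  fix c assume "c \<notin> J1" then show "contact_vf Q c = (\<lambda>v. 0)"
    by (auto simp: contact_vf_def J1_def split: jvar.splits)
next
  fix c assume Q: "smooth Q" "depends_only J1 Q" and c: "c \<in> J1"
  from c consider "c = XX" | "c = YY" | "c = uu" | "c = pp" | "c = qq"
    by (auto simp: J1_def)
  then show "smooth_in J1 (contact_vf Q c)"
    unfolding smooth_in_iff by cases (simp_all add: contact_vf_def Q)
qed

text \<open>The equation for d/du identifies the factor \<mu> with Q_u; the other four then express
  the components of V along x, y, p, q through Q, and Q = theta(V) gives the one along u.\<close>

lemma contact_field_iff:
  "contact_field V \<longleftrightarrow> (\<exists>Q. smooth Q \<and> depends_only J1 Q \<and> V = contact_vf Q)"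
proof
  assume V: "contact_field V"
  then have vf: "vf_J1 V" by (simp add: contact_field_def)
  have s: "smooth (V c)" "depends_only J1 (V c)" if "c \<in> J1" for c
    using vf that by (auto simp: vf_J1_def smooth_in_iff)
  have smQ: "smooth (charf V)"
    unfolding charf_def by (simp add: s)
  have dQ: "depends_only J1 (charf V)"
    unfolding charf_def by (simp add: s)
  obtain \<mu> where \<mu>: "\<And>w. pd XX (charf V) w - V pp w = - w pp * \<mu> w \<and>
        pd YY (charf V) w - V qq w = - w qq * \<mu> w \<and>
        pd uu (charf V) w = \<mu> w \<and>
        pd pp (charf V) w + V XX w = 0 \<and>
        pd qq (charf V) w + V YY w = 0"
    using V unfolding contact_field_def Let_def by auto
  have "V = contact_vf (charf V)"
  proof (intro ext)
    fix c w
    have XY: "V XX w = - pd pp (charf V) w" "V YY w = - pd qq (charf V) w"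
      using \<mu>[of w] by linarith+
    have PQ: "V pp w = pd XX (charf V) w + w pp * pd uu (charf V) w"
        "V qq w = pd YY (charf V) w + w qq * pd uu (charf V) w"
      using \<mu>[of w] by auto
    have U: "V uu w = charf V w - w pp * pd pp (charf V) w - w qq * pd qq (charf V) w"
      using XY by (simp add: charf_def)
    have "V c w = 0" if "c \<notin> J1"
      using vf that by (simp add: vf_J1_def)
    then show "V c w = contact_vf (charf V) c w"
      using XY PQ U by (auto simp: contact_vf_def J1_def split: jvar.split)
  qed
  then show "\<exists>Q. smooth Q \<and> depends_only J1 Q \<and> V = contact_vf Q" using smQ dQ by blast
next
  assume "\<exists>Q. smooth Q \<and> depends_only J1 Q \<and> V = contact_vf Q"
  then obtain Q where Q: "smooth Q" "depends_only J1 Q" "V = contact_vf Q" by blast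
  show "contact_field V"
    unfolding contact_field_def Let_def Q(3) charf_contact_vf
    using vf_J1_contact_vf[OF Q(1,2)]
    by (auto simp: contact_vf_def intro!: exI[of _ "pd uu Q"])
qed

lemma prol_contact_vf:
  "prol k (contact_vf Q) a b w = total_deriv (Suc k) a b Q w - pd pp Q w * w (UU (Suc a) b) - pd qq Q w * w (UU a (Suc b))"
  by (simp add: prol_def charf_contact_vf total_deriv_def[symmetric] contact_vf_def)

lemma contact_vf_lin: "smooth F \<Longrightarrow> smooth H \<Longrightarrow> vf_lin r (contact_vf F) s (contact_vf H) = contact_vf (\<lambda>v. r * F v + s * H v)"
  by (auto simp: vf_lin_def contact_vf_def fun_eq_iff algebra_simps split: jvar.split)

lemma contact_vf_inject: "contact_vf F = contact_vf H \<longleftrightarrow> F = H"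
  using charf_contact_vf by metis

lemma prol_contact_vf_lin: "smooth F \<Longrightarrow> smooth H \<Longrightarrow>
    prol k (contact_vf (\<lambda>v. r * F v + s * H v)) a b w = r * prol k (contact_vf F) a b w + s * prol k (contact_vf H) a b w"
  by (simp add: prol_contact_vf total_deriv_lin algebra_simps)

section \<open>Osculating spaces of the curve\<close>

text \<open>\<open>mcurve j i l\<close> is the derivative of order \<open>j - 1\<close> of \<open>l ^ i\<close>, that is the \<open>i\<close>-th component of
  the \<open>j\<close>-th derivative of the curve \<open>l ^ (i + 1) / (i + 1)\<close>.\<close>

definition mcurve :: "nat \<Rightarrow> nat \<Rightarrow> real \<Rightarrow> real" where
  "mcurve j i l = (if j \<le> Suc i then fact i / fact (Suc i - j) * l ^ (Suc i - j) else 0)"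

lemma mcurve_1 [simp]: "mcurve (Suc 0) i l = l ^ i"
  by (simp add: mcurve_def)

lemma Ppar_eq: "Ppar m i l z = l ^ Suc i / real (Suc i) + (\<Sum>j = 1..m. mcurve j i l * z j)"
proof -
  have "(\<Sum>j = 1..min m (i + 1). real (fact i) / real (fact (i + 1 - j)) * l ^ (i + 1 - j) * z j)
      = (\<Sum>j = 1..min m (i + 1). mcurve j i l * z j)"
    by (rule sum.cong) (auto simp: mcurve_def)
  also have "\<dots> = (\<Sum>j = 1..m. mcurve j i l * z j)"
    by (rule sum.mono_neutral_left) (auto simp: mcurve_def)
  finally show ?thesis by (simp add: Ppar_def)
qed

lemma DERIV_mcurve: "(mcurve j i has_real_derivative mcurve (Suc j) i l) (at l)"
proof (cases "j \<le> i")
  case True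
  then have f: "fact (Suc i - j) = real (Suc i - j) * fact (i - j)"
    by (simp add: Suc_diff_le)
  have s: "Suc i - j - Suc 0 = i - j" by simp
  have "mcurve j i = (\<lambda>l. fact i / fact (Suc i - j) * l ^ (Suc i - j))"
    using True by (simp add: mcurve_def fun_eq_iff)
  moreover have "((\<lambda>l::real. fact i / fact (Suc i - j) * l ^ (Suc i - j)) has_real_derivative
      fact i / fact (Suc i - j) * (real (Suc i - j) * l ^ (Suc i - j - Suc 0))) (at l)"
    by (rule derivative_eq_intros refl | simp)+
  moreover have "fact i / fact (Suc i - j) * (real (Suc i - j) * l ^ (Suc i - j - Suc 0)) = mcurve (Suc j) i l"
    unfolding f s using True by (simp add: mcurve_def)
  ultimately show ?thesis by simp
next
  case False
  then have "mcurve j i = (\<lambda>l. if j = Suc i then fact i else 0)" "mcurve (Suc j) i l = 0"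
    by (auto simp: mcurve_def fun_eq_iff)
  then show ?thesis by (cases "j = Suc i") simp_all
qed

lemma dPl_eq: "dPl m i l z = mcurve 1 i l + (\<Sum>j = 1..m. mcurve (Suc j) i l * z j)"
proof -
  have "((\<lambda>t. t ^ Suc i / real (Suc i)) has_real_derivative l ^ i) (at l)"
    using DERIV_cdivide[OF DERIV_pow[of "Suc i" l], of "real (Suc i)"] by simp
  then have "((\<lambda>t. t ^ Suc i / real (Suc i) + (\<Sum>j = 1..m. mcurve j i t * z j)) has_real_derivative
      l ^ i + (\<Sum>j = 1..m. mcurve (Suc j) i l * z j)) (at l)"
    by (intro DERIV_add DERIV_sum DERIV_cmult_right DERIV_mcurve)
  then show ?thesis
    unfolding dPl_def Ppar_eq by (simp add: DERIV_imp_deriv)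
qed

lemma dPz_eq:
  assumes "j \<in> {1..m}"
  shows "dPz m i j l z = mcurve j i l"
proof -
  have "Ppar m i l (z(j := t)) = l ^ Suc i / real (Suc i)
      + ((\<Sum>n\<in>{1..m} - {j}. mcurve n i l * z n) + mcurve j i l * t)" for t
    unfolding Ppar_eq using assms by (subst sum.remove[of _ j]) (auto intro!: sum.cong)
  moreover have "((\<lambda>t. l ^ Suc i / real (Suc i)
      + ((\<Sum>n\<in>{1..m} - {j}. mcurve n i l * z n) + mcurve j i l * t)) has_real_derivative mcurve j i l) (at (z j))"
    by (auto intro!: derivative_eq_intros)
  ultimately show ?thesis unfolding dPz_def by (simp add: DERIV_imp_deriv)
qed

text \<open>Applying the functional \<open>(binom(n,i) (-l)^(n-i))\<^sub>i\<close> to the powers \<open>t ^ i\<close> gives \<open>(t - l) ^ n\<close>;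
  its derivatives at \<open>t = l\<close> make these functionals dual to the derivatives of the curve.\<close>

lemma osc_functional:
  "(\<Sum>i\<le>n. real (n choose i) * (- l) ^ (n - i) * mcurve (Suc r) i t) = mcurve (Suc r) n (t - l)"
proof (induction r arbitrary: t)
  case 0
  have "(t - l) ^ n = (\<Sum>i\<le>n. real (n choose i) * t ^ i * (- l) ^ (n - i))"
    using binomial_ring[of t "- l" n] by simp
  then show ?case by (simp add: mult_ac)
next
  case (Suc r)
  have "((\<lambda>t. \<Sum>i\<le>n. real (n choose i) * (- l) ^ (n - i) * mcurve (Suc r) i t) has_real_derivative
      (\<Sum>i\<le>n. real (n choose i) * (- l) ^ (n - i) * mcurve (Suc (Suc r)) i t)) (at t)"
    by (intro DERIV_sum DERIV_cmult DERIV_mcurve)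
  moreover have "((\<lambda>t. mcurve (Suc r) n (t - l)) has_real_derivative mcurve (Suc (Suc r)) n (t - l)) (at t)"
    using DERIV_shift[of "mcurve (Suc r) n" _ t "- l"] DERIV_mcurve[of "Suc r" n "t - l"] by simp
  ultimately show ?case unfolding Suc.IH by (rule DERIV_unique)
qed

text \<open>For n = k this is the equation of the osculating hyperplane at \<open>l\<close>: it
  kills the derivatives of the curve of orders 1 to k. Smaller n supply the rest of the basis dual
  to the derivatives, used for regularity.\<close>

definition osc :: "nat \<Rightarrow> real \<Rightarrow> (nat \<Rightarrow> real) \<Rightarrow> real" where
  "osc n l f = (\<Sum>i\<le>n. real (n choose i) * (- l) ^ (n - i) * f i)"

lemma osc_lin: "osc n l (\<lambda>i. a * f i + b * g i) = a * osc n l f + b * osc n l g"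
  by (simp add: osc_def algebra_simps sum.distrib sum_distrib_left)

lemma osc_sum: "osc n l (\<lambda>i. \<Sum>j\<in>J. a j * f j i) = (\<Sum>j\<in>J. a j * osc n l (f j))"
  by (simp add: osc_def sum_distrib_left sum.swap[of _ "{..n}"] mult_ac)

lemma osc_mcurve: "osc n l (\<lambda>i. mcurve (Suc r) i l) = (if r = n then fact n else 0)"
  unfolding osc_def osc_functional by (auto simp: mcurve_def)

text \<open>Since \<open>dPl\<close> is the first derivative of the curve plus the derivatives of
  order j + 1 weighted by \<open>z j\<close>, and \<open>dPz\<close> is the derivative of order j,
  duality reads off n! times the coefficient of the derivative of order n + 1.\<close>

lemma osc_tangent:
  assumes "n \<le> k"
  shows "osc n l (\<lambda>i. a * dPl m i l z + (\<Sum>j = 1..m. bb j * dPz m i j l z))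
    = a * ((if n = 0 then 1 else 0) + (\<Sum>j = 1..m. z j * (if j = n then fact n else 0)))
      + (\<Sum>j = 1..m. bb j * (if j = Suc n then fact n else 0))"
proof -
  have "osc n l (\<lambda>i. a * dPl m i l z + (\<Sum>j = 1..m. bb j * dPz m i j l z))
      = osc n l (\<lambda>i. a * (1 * mcurve (Suc 0) i l + 1 * (\<Sum>j = 1..m. z j * mcurve (Suc j) i l))
          + 1 * (\<Sum>j = 1..m. bb j * mcurve (Suc (j - 1)) i l))"
    by (intro arg_cong[where f = "osc n l"] ext)
      (auto simp: dPl_eq dPz_eq mult_ac intro!: sum.cong arg_cong2[where f = plus] arg_cong2[where f = times])
  also have "\<dots> = a * ((if 0 = n then fact n else 0) + (\<Sum>j = 1..m. z j * (if j = n then fact n else 0)))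
      + (\<Sum>j = 1..m. bb j * (if j - 1 = n then fact n else 0))"
    unfolding osc_lin osc_sum osc_mcurve by simp
  also have "(\<Sum>j = 1..m. bb j * (if j - 1 = n then fact n else 0))
      = (\<Sum>j = 1..m. bb j * (if j = Suc n then fact n else 0))"
    by (rule sum.cong) auto
  finally show ?thesis by auto
qed

text \<open>Tangent vectors only involve derivatives of order at most m + 1, and m + 1 \<le> k. This
  equation is all that the necessity argument extracts from tangency.\<close>

lemma osc_tangent_zero:
  "m < k \<Longrightarrow> osc k l (\<lambda>i. a * dPl m i l z + (\<Sum>j = 1..m. bb j * dPz m i j l z)) = 0"
  by (subst osc_tangent[of k k]) (auto intro!: sum.neutral)

text \<open>The system is triangular in the dual basis: the functional of order m sees only a times
  \<open>z m\<close> (just a if m = 0), and once a = 0 the functional of order n - 1 isolates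
  \<open>bb n\<close>.\<close>

lemma regular_parI:
  assumes "m \<le> k" "m = 0 \<or> z m \<noteq> 0"
  shows "regular_par k m l z"
  unfolding regular_par_def
proof (intro allI impI)
  fix a bb
  assume 0: "\<forall>i\<le>k. a * dPl m i l z + (\<Sum>j = 1..m. bb j * dPz m i j l z) = 0"
  have o: "a * ((if n = 0 then 1 else 0) + (\<Sum>j = 1..m. z j * (if j = n then fact n else 0)))
      + (\<Sum>j = 1..m. bb j * (if j = Suc n then fact n else 0)) = 0" if "n \<le> m" for n
    unfolding osc_tangent[of n n l, OF order_refl, symmetric]
    using 0 that assms(1) by (auto simp: osc_def intro!: sum.neutral)
  have a: "a = 0"
  proof (cases "m = 0")
    case True then show ?thesis using o[of 0] by simp
  next
    case False
    have "(\<Sum>j = 1..m. z j * (if j = m then fact m else 0)) = z m * fact m"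
      using False by (subst sum.remove[of _ m]) (auto intro!: sum.neutral)
    moreover have "(\<Sum>j = 1..m. bb j * (if j = Suc m then fact m else 0)) = 0"
      by (rule sum.neutral) auto
    ultimately show ?thesis using o[of m] False assms(2) by simp
  qed
  have "bb n = 0" if n: "n \<in> {1..m}" for n
  proof -
    have "(\<Sum>j = 1..m. bb j * (if j = Suc (n - 1) then fact (n - 1) else 0)) = bb n * fact (n - 1)"
      using n by (subst sum.remove[of _ n]) (auto intro!: sum.neutral)
    moreover have "n - 1 \<le> m" using n by auto
    ultimately show ?thesis using o[of "n - 1"] a by simp
  qed
  then show "a = 0 \<and> (\<forall>j\<in>{1..m}. bb j = 0)" using a by blast
qed

text \<open>Euler's identity, as \<open>mcurve j i\<close> is homogeneous of degree i + 1 - j in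
  \<open>l\<close>.\<close>

lemma mcurve_Euler: "real (Suc i) * mcurve j i l = l * mcurve (Suc j) i l + real j * mcurve j i l"
proof (cases "j \<le> i")
  case True
  then obtain e where e: "i = j + e" using le_Suc_ex by blast
  have "mcurve j i l = fact i / (real (Suc e) * fact e) * l ^ Suc e" "mcurve (Suc j) i l = fact i / fact e * l ^ e"
    unfolding mcurve_def by (simp_all add: e)
  then have "real (Suc e) * mcurve j i l = l * mcurve (Suc j) i l"
    by (simp del: of_nat_Suc)
  then show ?thesis by (simp add: e algebra_simps)
next
  case False
  then show ?thesis by (cases "j = Suc i") (auto simp: mcurve_def)
qed

lemma mcurve_shift: "0 < j \<Longrightarrow> real i * mcurve j (i - 1) l = mcurve (Suc j) i l"
  by (cases i) (auto simp: mcurve_def)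

text \<open>Infinitesimal scaling and translation of the parameter of the curve, in the ambient space.\<close>

lemma Ppar_scaling:
  "real (Suc i) * Ppar m i l z = l * dPl m i l z + (\<Sum>j = 1..m. real j * z j * dPz m i j l z)"
proof -
  have "real (Suc i) * (\<Sum>j = 1..m. mcurve j i l * z j)
      = (\<Sum>j = 1..m. (real (Suc i) * mcurve j i l) * z j)"
    by (simp add: sum_distrib_left mult_ac)
  also have "\<dots> = l * (\<Sum>j = 1..m. mcurve (Suc j) i l * z j) + (\<Sum>j = 1..m. real j * z j * dPz m i j l z)"
    unfolding mcurve_Euler by (simp add: sum_distrib_left sum.distrib[symmetric] algebra_simps dPz_eq)
  finally show ?thesis
    unfolding dPl_eq Ppar_eq distrib_left by simp
qed

text \<open>The case distinction supplies the derivative 1 of the component l with index 0, which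
  has no predecessor. Translation of the parameter is thus an affine, not a linear, field on the
  fibre.\<close>

lemma Ppar_translation: "real i * Ppar m (i - 1) l z + (if i = 0 then 1 else 0) = dPl m i l z"
proof -
  have "real i * (\<Sum>j = 1..m. mcurve j (i - 1) l * z j) = (\<Sum>j = 1..m. (real i * mcurve j (i - 1) l) * z j)"
    by (simp add: sum_distrib_left mult_ac)
  also have "\<dots> = (\<Sum>j = 1..m. mcurve (Suc j) i l * z j)"
    by (rule sum.cong) (auto simp: mcurve_shift[simplified])
  finally show ?thesis
    unfolding dPl_eq Ppar_eq distrib_left by (cases i) simp_all
qed

section \<open>Alternating binomial sums\<close>

text \<open>This is the integral of (1 - t)^k over [0,1]. The absorption identity turns it into the
  full alternating sum for k + 1 without its term of index 0.\<close>

lemma alternating_sum_Suc: "(\<Sum>i\<le>k. (-1) ^ i * real (k choose i) / real (i + 1)) = 1 / real (k + 1)"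
proof -
  have "real (k + 1) * (\<Sum>i\<le>k. (-1) ^ i * real (k choose i) / real (i + 1)) = (\<Sum>i\<le>k. (-1) ^ i * real (Suc k choose Suc i))"
    unfolding sum_distrib_left
  proof (rule sum.cong)
    fix i
    have "real (Suc i) * real (Suc k choose Suc i) = real (Suc k) * real (k choose i)"
      by (metis Suc_times_binomial_eq mult.commute of_nat_mult)
    then have "real (k + 1) * real (k choose i) / real (i + 1) = real (Suc k choose Suc i)"
      by (simp add: field_simps del: binomial_Suc_Suc)
    then show "real (k + 1) * ((-1) ^ i * real (k choose i) / real (i + 1)) = (-1) ^ i * real (Suc k choose Suc i)"
      by (metis mult.left_commute times_divide_eq_right)
  qed simp
  also have "\<dots> = 1 - (\<Sum>i\<le>Suc k. (-1) ^ i * real (Suc k choose i))"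
    by (simp only: sum.atMost_Suc_shift) (simp add: sum_negf del: binomial_Suc_Suc)
  also have "\<dots> = 1" by (simp only: choose_alternating_sum[of "Suc k"])
  finally show ?thesis by (simp add: field_simps)
qed

text \<open>This is the integral of t (1 - t)^k over [0,1]. Both sums serve to show that certain
  polynomial coefficients below are nonzero.\<close>

lemma alternating_sum_Suc2:
  "(\<Sum>i\<le>k. (-1) ^ i * real (k choose i) / real (i + 2)) = 1 / (real (k + 1) * real (k + 2))"
proof -
  have "real (k + 1) * real (k + 2) * (\<Sum>i\<le>k. (-1) ^ i * real (k choose i) / real (i + 2))
      = (\<Sum>i\<le>k. (-1) ^ i * (real (Suc (Suc i)) - 1) * real (Suc (Suc k) choose Suc (Suc i)))"
    unfolding sum_distrib_left
  proof (rule sum.cong)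
    fix i
    have "real (Suc i) * real (Suc k choose Suc i) = real (Suc k) * real (k choose i)"
      "real (Suc (Suc i)) * real (Suc (Suc k) choose Suc (Suc i)) = real (Suc (Suc k)) * real (Suc k choose Suc i)"
      by (metis Suc_times_binomial_eq mult.commute of_nat_mult)+
    then have "real (Suc (Suc i)) * (real (Suc i) * real (Suc (Suc k) choose Suc (Suc i)))
        = real (Suc (Suc k)) * (real (Suc k) * real (k choose i))"
      by (metis mult.left_commute)
    then have "real (k + 1) * real (k + 2) * real (k choose i) / real (i + 2) = real (Suc i) * real (Suc (Suc k) choose Suc (Suc i))"
      by (simp add: field_simps del: binomial_Suc_Suc)
    then show "real (k + 1) * real (k + 2) * ((-1) ^ i * real (k choose i) / real (i + 2))
        = (-1) ^ i * (real (Suc (Suc i)) - 1) * real (Suc (Suc k) choose Suc (Suc i))"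
      by (metis mult.assoc mult.left_commute times_divide_eq_right add_diff_cancel_right' of_nat_Suc add.commute)
  qed simp
  \<comment> \<open>Completing the range adds -1 at index 0 and nothing at index 1, where the factor
    \<open>real i - 1\<close> vanishes.\<close>
  also have "\<dots> = 1 + (\<Sum>i\<le>Suc (Suc k). (-1) ^ i * (real i - 1) * real (Suc (Suc k) choose i))"
    by (simp only: sum.atMost_Suc_shift) (simp del: binomial_Suc_Suc)
  also have "(\<Sum>i\<le>Suc (Suc k). (-1) ^ i * (real i - 1) * real (Suc (Suc k) choose i))
      = (\<Sum>i\<le>Suc (Suc k). (-1) ^ i * real i * real (Suc (Suc k) choose i)) - (\<Sum>i\<le>Suc (Suc k). (-1) ^ i * real (Suc (Suc k) choose i))"
    by (simp only: sum_subtractf[symmetric] left_diff_distrib right_diff_distrib mult_1_right)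
  also have "\<dots> = 0"
    by (simp only: choose_alternating_sum[of "Suc (Suc k)"] choose_alternating_linear_sum[of "Suc (Suc k)"])
  finally have 1: "real (k + 1) * real (k + 2) * (\<Sum>i\<le>k. (-1) ^ i * real (k choose i) / real (i + 2)) = 1"
    by simp
  have "S = 1 / x" if "x * S = 1" for x S :: real
    using that by (metis mult_zero_left nonzero_mult_div_cancel_left zero_neq_one)
  from this[OF 1] show ?thesis .
qed

section \<open>The symmetry condition on a fibre\<close>

lemma depends_onlyD: "depends_only S F \<Longrightarrow> (\<And>c. c \<in> S \<Longrightarrow> v c = w c) \<Longrightarrow> F v = F w"
  unfolding depends_only_def by blast

lemma depends_only_if [simp]:
  "depends_only S F \<Longrightarrow> depends_only S H \<Longrightarrow> depends_only S (\<lambda>v. if b then F v else H v)"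
  by (cases b) auto

text \<open>The coordinates in \<open>C\<close> are set to zero one at a time; the slope along each
  of them is blind to all of \<open>C\<close>, so it keeps its value at \<open>v\<close>
  throughout.\<close>

lemma affine_in_coords:
  assumes F: "smooth F" and C: "finite C" and dep: "\<And>c. c \<in> C \<Longrightarrow> depends_only (- C) (pd c F)"
  shows "F v = F (\<lambda>d. if d \<in> C then 0 else v d) + (\<Sum>c\<in>C. v c * pd c F v)"
proof -
  have "F v = F (\<lambda>d. if d \<in> C' then 0 else v d) + (\<Sum>c\<in>C'. v c * pd c F v)" if "finite C'" "C' \<subseteq> C" for C'
    using that
  proof (induction rule: finite_subset_induct')
    case empty then show ?case by simp
  next
    case (insert c A)
    define u where "u = (\<lambda>d. if d \<in> A then 0 else v d)"
    have const: "pd c F (u(c := t)) = pd c F v" for t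
      by (rule depends_onlyD[OF dep[OF insert(2)]]) (use insert in \<open>auto simp: u_def\<close>)
    have "((\<lambda>t. F (u(c := t)) - t * pd c F v) has_real_derivative 0) (at t)" for t
      using part_diff_DERIV[OF smooth_part_diff[OF F], of u c t] unfolding const
      by (auto intro!: derivative_eq_intros)
    then have "F (u(c := u c)) - u c * pd c F v = F (u(c := 0)) - 0 * pd c F v"
      using DERIV_isconst_all by blast
    then have "F u = F (u(c := 0)) + u c * pd c F v" by simp
    moreover have "u(c := 0) = (\<lambda>d. if d \<in> insert c A then 0 else v d)" "u c = v c"
      using insert by (auto simp: u_def fun_eq_iff)
    ultimately show ?case using insert by (simp add: u_def[symmetric])
  qed
  then show ?thesis using C by blast
qed

lemma depends_Dx_pd: "depends_only (jets 1) Q \<Longrightarrow> depends_only (jets 2) (Dx M (pd c Q))"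
  and depends_Dy_pd: "depends_only (jets 1) Q \<Longrightarrow> depends_only (jets 2) (Dy M (pd c Q))"
  using depends_Dx[of 1 "pd c Q" M] depends_Dy[of 1 "pd c Q" M] by (simp_all add: numeral_2_eq_2)

text \<open>The coefficients of the order k coordinates live on jets of order 2. As k > 2 they do
  not change along the fibre, so the total derivative is affine there, with a tridiagonal linear
  part.\<close>

lemma linear_in_top:
  assumes Q: "smooth Q" "depends_only (jets 1) Q" and k: "2 < k" and i: "i \<le> k" and M: "k \<le> M"
    and w: "\<And>a b. a + b = k \<Longrightarrow> w (UU a b) = 0"
  shows "total_deriv M (k - i) i Q (\<lambda>d. case d of UU a b \<Rightarrow> if a + b = k then P b else w d | _ \<Rightarrow> w d)
    = total_deriv M (k - i) i Q w
      + (pd uu Q w + real (k - i) * Dx M (pd pp Q) w + real i * Dy M (pd qq Q) w) * P i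
      + real i * Dy M (pd pp Q) w * P (i - 1) + real (k - i) * Dx M (pd qq Q) w * P (Suc i)"
proof -
  define W where "W = (\<lambda>d. case d of UU a b \<Rightarrow> if a + b = k then P b else w d | _ \<Rightarrow> w d)"
  define C where "C = (\<lambda>j. UU (k - j) j) ` {..k}"
  have inj: "inj_on (\<lambda>j. UU (k - j) j) {..k}" by (auto simp: inj_on_def)
  have memC: "UU a b \<in> C \<longleftrightarrow> a + b = k" for a b
    by (auto simp: C_def intro!: image_eqI[of _ _ b])
  have jC: "jets 2 \<subseteq> - C" using k by (auto simp: jets_def C_def)
  define A where "A = (\<lambda>v. pd uu Q v + real (k - i) * Dx M (pd pp Q) v + real i * Dy M (pd qq Q) v)"
  define B where "B = (\<lambda>v. real i * Dy M (pd pp Q) v)"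
  define E where "E = (\<lambda>v. real (k - i) * Dx M (pd qq Q) v)"
  have uu2: "depends_only (jets 2) (pd uu Q)"
    using depends_only_mono[OF depends_only_pd[OF Q(2)] jets_mono[of 1 2]] by simp
  have dABE: "depends_only (jets 2) A" "depends_only (jets 2) B" "depends_only (jets 2) E"
    unfolding A_def B_def E_def using Q uu2 by (simp_all add: depends_Dx_pd depends_Dy_pd)
  have Ww: "F W = F w" if "depends_only (jets 2) F" for F
    by (rule depends_onlyD[OF that]) (use k in \<open>auto simp: W_def jets_def\<close>)
  note WABE = Ww[OF dABE(1)] Ww[OF dABE(2)] Ww[OF dABE(3)]
  have WP: "W (UU (k - j) j) = P j" if "j \<le> k" for j using that by (simp add: W_def)
  have pd_eq: "pd (UU (k - j) j) (total_deriv M (k - i) i Q) = (\<lambda>v. (if j = i then A v else 0)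
      + (if Suc j = i then B v else 0) + (if j = Suc i then E v else 0))" if "j \<le> k" for j
  proof -
    have c: "k - j = k - i \<and> j = i \<longleftrightarrow> j = i" "k - j = Suc (k - i) \<and> Suc j = i \<longleftrightarrow> Suc j = i"
      "Suc (k - j) = k - i \<and> j = Suc i \<longleftrightarrow> j = Suc i" using that i by auto
    show ?thesis
      using pd_total_deriv_order_eq[OF Q, of "k - i" i M "k - j" j] that i M
      unfolding c A_def B_def E_def by simp
  qed
  have "total_deriv M (k - i) i Q W = total_deriv M (k - i) i Q (\<lambda>d. if d \<in> C then 0 else W d)
      + (\<Sum>c\<in>C. W c * pd c (total_deriv M (k - i) i Q) W)"
  proof (rule affine_in_coords)
    fix c assume "c \<in> C"
    then obtain j where j: "j \<le> k" "c = UU (k - j) j" by (auto simp: C_def)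
    have "depends_only (jets 2) (pd c (total_deriv M (k - i) i Q))"
      unfolding j(2) pd_eq[OF j(1)] using dABE by simp
    then show "depends_only (- C) (pd c (total_deriv M (k - i) i Q))"
      using jC depends_only_mono by blast
  qed (auto simp: C_def Q)
  also have "(\<lambda>d. if d \<in> C then 0 else W d) = w"
    by (auto simp: fun_eq_iff W_def memC w split: jvar.split) (auto simp: C_def)
  also have "(\<Sum>c\<in>C. W c * pd c (total_deriv M (k - i) i Q) W)
      = (\<Sum>j\<le>k. P j * ((if j = i then A w else 0) + (if Suc j = i then B w else 0) + (if j = Suc i then E w else 0)))"
    unfolding C_def sum.reindex[OF inj] by (intro sum.cong) (simp_all add: pd_eq WABE WP)
  also have "\<dots> = (\<Sum>j\<le>k. if j = i then A w * P i else 0) + (\<Sum>j\<le>k. if Suc j = i then B w * P (i - 1) else 0)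
      + (\<Sum>j\<le>k. if j = Suc i then E w * P (Suc i) else 0)"
    unfolding sum.distrib[symmetric] by (rule sum.cong) auto
  also have "(\<Sum>j\<le>k. if j = i then A w * P i else 0) = A w * P i" using i by simp
  \<comment> \<open>For i = 0, and below for i = k, the neighbouring index leaves the range, but
    then the factor \<open>real i\<close> or \<open>real (k - i)\<close> in \<open>B\<close> or
    \<open>E\<close> vanishes.\<close>
  also have "(\<Sum>j\<le>k. if Suc j = i then B w * P (i - 1) else 0) = B w * P (i - 1)"
    using i by (cases i) (simp_all add: B_def)
  also have "(\<Sum>j\<le>k. if j = Suc i then E w * P (Suc i) else 0) = E w * P (Suc i)"
    using i by (cases "i = k") (simp_all add: E_def)
  finally show ?thesis unfolding W_def A_def B_def E_def by simp
qed

text \<open>The polynomial condition that an affine vector field with linear part in \<open>gl_2\<close> maps the curve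
  into its osculating hyperplanes.\<close>

lemma osc_affine_zero:
  assumes k: "0 < k" and 0: "\<And>l. osc k l (\<lambda>i. c i + (\<alpha> + real (k - i) * s + real i * r) * (l ^ Suc i / real (Suc i))
      + real i * \<sigma> * (l ^ Suc (i - 1) / real (Suc (i - 1)))
      + real (k - i) * \<tau> * (l ^ Suc (Suc i) / real (Suc (Suc i)))) = 0"
  shows "\<tau> = 0" "\<alpha> + real (k + 1) * s - r = 0" "c 0 = \<sigma>" "\<And>i. 0 < i \<Longrightarrow> i \<le> k \<Longrightarrow> c i = 0"
proof -
  define e where "e = (\<lambda>i. real (k choose i) * (-1) ^ (k - i))"
  define K1 where "K1 = (\<Sum>i\<le>k. e i * (\<alpha> + real (k - i) * s + real i * r) / real (Suc i))"
  define K2 where "K2 = (\<Sum>i\<le>k. e i * real (k - i) / real (Suc (Suc i)))"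
  define K0 where "K0 = (\<Sum>i\<le>k. e i * (if i = 0 then 0 else 1))"
  \<comment> \<open>The functional multiplies component i by l^(k-i). Hence the constants
    \<open>c i\<close> land in degree k - i, the \<sigma> terms in degree k, the diagonal terms in
    degree k + 1 and the \<tau> terms in degree k + 2.\<close>
  define co where "co = (\<lambda>n. if n \<le> k then e (k - n) * c (k - n) + (if n = k then \<sigma> * K0 else 0)
      else if n = Suc k then K1 else \<tau> * K2)"
  have em: "e i = (-1) ^ k * ((-1) ^ i * real (k choose i))" if "i \<le> k" for i
  proof -
    have "(-1::real) ^ k = (-1) ^ (k - i) * (-1) ^ i" using that by (simp flip: power_add)
    moreover have "(-1::real) ^ i * (-1) ^ i = 1" by (simp flip: power_add)
    ultimately have "(-1::real) ^ k * (-1) ^ i = (-1) ^ (k - i)" by (metis mult.assoc mult.right_neutral)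
    then show ?thesis unfolding e_def by (simp add: mult_ac)
  qed
  have "(\<Sum>n\<le>Suc (Suc k). co n * l ^ n) = 0" for l
  proof -
    have lp: "(- l) ^ (k - i) = (-1) ^ (k - i) * l ^ (k - i)" for i by (metis mult_minus1 power_mult_distrib)
    have "0 = (\<Sum>i\<le>k. e i * l ^ (k - i) * (c i + (\<alpha> + real (k - i) * s + real i * r) * (l ^ Suc i / real (Suc i))
      + real i * \<sigma> * (l ^ Suc (i - 1) / real (Suc (i - 1)))
      + real (k - i) * \<tau> * (l ^ Suc (Suc i) / real (Suc (Suc i)))))"
      using 0[of l] unfolding osc_def lp e_def by (simp add: mult_ac)
    also have "\<dots> = (\<Sum>i\<le>k. e i * c i * l ^ (k - i) + l ^ Suc k * (e i * (\<alpha> + real (k - i) * s + real i * r) / real (Suc i))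
      + \<sigma> * l ^ k * (e i * (if i = 0 then 0 else 1)) + \<tau> * l ^ Suc (Suc k) * (e i * real (k - i) / real (Suc (Suc i))))"
    proof (rule sum.cong)
      fix i assume "i \<in> {..k}"
      then have i: "l ^ k = l ^ (k - i) * l ^ i" by (simp add: power_add[symmetric])
      have "real i * \<sigma> * (l ^ Suc (i - 1) / real (Suc (i - 1))) = \<sigma> * l ^ i * (if i = 0 then 0 else 1)"
        by (cases i) simp_all
      then show "e i * l ^ (k - i) * (c i + (\<alpha> + real (k - i) * s + real i * r) * (l ^ Suc i / real (Suc i))
        + real i * \<sigma> * (l ^ Suc (i - 1) / real (Suc (i - 1)))
        + real (k - i) * \<tau> * (l ^ Suc (Suc i) / real (Suc (Suc i)))) =
        e i * c i * l ^ (k - i) + l ^ Suc k * (e i * (\<alpha> + real (k - i) * s + real i * r) / real (Suc i))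
        + \<sigma> * l ^ k * (e i * (if i = 0 then 0 else 1)) + \<tau> * l ^ Suc (Suc k) * (e i * real (k - i) / real (Suc (Suc i)))"
        unfolding power_Suc i by (simp add: algebra_simps add_divide_distrib)
    qed simp
    also have "\<dots> = (\<Sum>i\<le>k. e i * c i * l ^ (k - i)) + l ^ Suc k * K1 + \<sigma> * l ^ k * K0 + \<tau> * l ^ Suc (Suc k) * K2"
      unfolding K1_def K2_def K0_def sum.distrib sum_distrib_left ..
    also have "(\<Sum>i\<le>k. e i * c i * l ^ (k - i)) = (\<Sum>n\<le>k. e (k - n) * c (k - n) * l ^ n)"
      by (rule sum.reindex_bij_witness[of _ "\<lambda>n. k - n" "\<lambda>n. k - n"]) auto
    also have "\<dots> + l ^ Suc k * K1 + \<sigma> * l ^ k * K0 + \<tau> * l ^ Suc (Suc k) * K2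
        = ((\<Sum>n\<le>k. e (k - n) * c (k - n) * l ^ n) + (\<Sum>n\<le>k. (if n = k then \<sigma> * K0 else 0) * l ^ n))
          + l ^ Suc k * K1 + \<tau> * l ^ Suc (Suc k) * K2"
      by (simp add: if_distrib[of "\<lambda>x. x * _"] cong: if_cong)
    also have "\<dots> = (\<Sum>n\<le>k. co n * l ^ n) + co (Suc k) * l ^ Suc k + co (Suc (Suc k)) * l ^ Suc (Suc k)"
      unfolding sum.distrib[symmetric] co_def by (simp add: algebra_simps)
    finally show ?thesis by simp
  qed
  then have co: "co n = 0" if "n \<le> Suc (Suc k)" for n
    using polyfun_eq_0[of co "Suc (Suc k)"] that by blast
  have S0: "(\<Sum>i\<le>k. e i) = 0"
  proof -
    have "(\<Sum>i\<le>k. e i) = (-1) ^ k * (\<Sum>i\<le>k. (-1) ^ i * real (k choose i))"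
      unfolding sum_distrib_left by (rule sum.cong) (auto simp: em)
    then show ?thesis using choose_alternating_sum[of k, where 'a = real] k by simp
  qed
  have S1: "(\<Sum>i\<le>k. e i / real (Suc i)) = (-1) ^ k / real (k + 1)"
  proof -
    have "(\<Sum>i\<le>k. e i / real (Suc i)) = (-1) ^ k * (\<Sum>i\<le>k. (-1) ^ i * real (k choose i) / real (i + 1))"
      unfolding sum_distrib_left by (rule sum.cong) (auto simp: em)
    then show ?thesis unfolding alternating_sum_Suc by simp
  qed
  have S2: "(\<Sum>i\<le>k. e i / real (Suc (Suc i))) = (-1) ^ k / (real (k + 1) * real (k + 2))"
  proof -
    have "(\<Sum>i\<le>k. e i / real (Suc (Suc i))) = (-1) ^ k * (\<Sum>i\<le>k. (-1) ^ i * real (k choose i) / real (i + 2))"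
      unfolding sum_distrib_left by (rule sum.cong) (auto simp: em)
    then show ?thesis unfolding alternating_sum_Suc2 by simp
  qed
  \<comment> \<open>From k - i = (k + 2) - (i + 2), so that K2 is a nonzero multiple of the sum in
    \<open>S2\<close>.\<close>
  have "K2 = real (k + 2) * (\<Sum>i\<le>k. e i / real (Suc (Suc i))) - (\<Sum>i\<le>k. e i)"
    unfolding K2_def sum_distrib_left sum_subtractf[symmetric]
    by (rule sum.cong) (auto simp: of_nat_diff field_simps)
  then show "\<tau> = 0" using co[of "Suc (Suc k)"] unfolding S0 S2 by (simp add: co_def)
  \<comment> \<open>The numerator is (\<alpha> + (k+1) s - r) + (r - s)(i + 1); its second part
    cancels the denominator and meets the vanishing sum \<open>S0\<close>.\<close>
  have "K1 = (\<alpha> + real (k + 1) * s - r) * (\<Sum>i\<le>k. e i / real (Suc i)) + (r - s) * (\<Sum>i\<le>k. e i)"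
    unfolding K1_def sum_distrib_left sum.distrib[symmetric]
    by (rule sum.cong) (auto simp: of_nat_diff field_simps)
  then show "\<alpha> + real (k + 1) * s - r = 0" using co[of "Suc k"] unfolding S0 S1 by (simp add: co_def)
  \<comment> \<open>Only the term i = 0 is missing from the vanishing sum. In degree k this leaves
    \<open>e 0\<close> times \<open>c 0 - \<sigma>\<close>.\<close>
  have "K0 = (\<Sum>i\<le>k. e i) - (\<Sum>i\<le>k. if i = 0 then e i else 0)"
    unfolding K0_def sum_subtractf[symmetric] by (rule sum.cong) auto
  then have "K0 = - e 0" unfolding S0 by simp
  then show "c 0 = \<sigma>" using co[of k] by (simp add: co_def e_def)
  show "c i = 0" if "0 < i" "i \<le> k" for i
  proof -
    have "k - i \<le> Suc (Suc k)" "k - i \<noteq> k" "k - (k - i) = i" using that by auto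
    then show ?thesis using co[of "k - i"] that by (simp add: co_def e_def)
  qed
qed

text \<open>At \<open>w\<close> the fibre coordinates are zero, so the total derivatives at
  \<open>w\<close> are the constant part of the affine field. The zeros in order k + 1 also remove
  the two extra terms of the prolongation.\<close>

lemma symmetry_pointwise:
  assumes Q: "smooth Q" "depends_only (jets 1) Q" and k: "2 < k" and m: "m < k"
    and V: "contact_vf Q \<in> contact_syms k m"
    and w: "\<And>a b. k \<le> a + b \<Longrightarrow> w (UU a b) = 0"
  shows "Dx (Suc k) (pd qq Q) w = 0"
    and "pd uu Q w + real (k + 1) * Dx (Suc k) (pd pp Q) w - Dy (Suc k) (pd qq Q) w = 0"
    and "total_deriv (Suc k) k 0 Q w = Dy (Suc k) (pd pp Q) w"
    and "\<And>i. 0 < i \<Longrightarrow> i \<le> k \<Longrightarrow> total_deriv (Suc k) (k - i) i Q w = 0"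
proof -
  define M where "M = Suc k"
  define A where "A = (\<lambda>i. pd uu Q w + real (k - i) * Dx M (pd pp Q) w + real i * Dy M (pd qq Q) w)"
  define \<sigma> where "\<sigma> = Dy M (pd pp Q) w"
  define \<tau> where "\<tau> = Dx M (pd qq Q) w"
  define c where "c = (\<lambda>i. total_deriv M (k - i) i Q w)"
  define R where "R = (\<lambda>c P i. c i + A i * P i + real i * \<sigma> * P (i - 1) + real (k - i) * \<tau> * P (Suc i))"
  have "osc k l (R c (\<lambda>i. l ^ Suc i / real (Suc i))) = 0" for l
  proof -
    define \<gamma> where "\<gamma> = (\<lambda>i. l ^ Suc i / real (Suc i))"
    define \<delta> where "\<delta> = (\<lambda>i. if m = 0 then 0 else mcurve m i l)"
    have "osc k l (R c \<gamma>) + e * osc k l (R (\<lambda>_. 0) \<delta>) = 0" if e: "e \<noteq> 0" for e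
    proof -
      \<comment> \<open>Only the last parameter is perturbed: \<open>z m\<close> nonzero already
        makes the point regular, and for m = 0 nothing changes.\<close>
      define z where "z = (\<lambda>j. if j = m then e else 0)"
      define W where "W = (\<lambda>d. case d of UU a b \<Rightarrow> if a + b = k then Ppar m b l z else w d | _ \<Rightarrow> w d)"
      have P: "Ppar m i l z = \<gamma> i + e * \<delta> i" for i
      proof (cases "m = 0")
        case True then show ?thesis by (simp add: Ppar_eq \<gamma>_def \<delta>_def)
      next
        case False
        then have "(\<Sum>j = 1..m. mcurve j i l * z j) = mcurve m i l * e"
          by (subst sum.remove[of _ m]) (auto simp: z_def intro!: sum.neutral)
        then show ?thesis using False by (simp add: Ppar_eq \<gamma>_def \<delta>_def)
      qed
      have "on_system k m l z W" "regular_par k m l z"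
        using m e by (auto simp: on_system_def W_def z_def intro!: regular_parI)
      then obtain a bb where ab: "\<And>i. i \<le> k \<Longrightarrow> prol k (contact_vf Q) (k - i) i W = a * dPl m i l z + (\<Sum>j = 1..m. bb j * dPz m i j l z)"
        using V unfolding contact_syms_def by blast
      have "prol k (contact_vf Q) (k - i) i W = 1 * R c \<gamma> i + e * R (\<lambda>_. 0) \<delta> i" if i: "i \<le> k" for i
      proof -
        have "prol k (contact_vf Q) (k - i) i W = total_deriv M (k - i) i Q W"
          using i w by (simp add: prol_contact_vf W_def M_def)
        also have "\<dots> = R c (\<lambda>i. Ppar m i l z) i"
          unfolding W_def R_def c_def A_def \<sigma>_def \<tau>_def
          by (rule linear_in_top[OF Q k i]) (auto simp: M_def w)
        also have "\<dots> = 1 * R c \<gamma> i + e * R (\<lambda>_. 0) \<delta> i"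
          unfolding P R_def by (simp add: algebra_simps)
        finally show ?thesis .
      qed
      then have "osc k l (\<lambda>i. 1 * R c \<gamma> i + e * R (\<lambda>_. 0) \<delta> i)
          = osc k l (\<lambda>i. a * dPl m i l z + (\<Sum>j = 1..m. bb j * dPz m i j l z))"
        unfolding osc_def using ab by (intro sum.cong) auto
      then show ?thesis unfolding osc_lin osc_tangent_zero[OF m] by simp
    qed
    \<comment> \<open>An affine function of e vanishing at 1 and 2 has zero constant term, which is
      the condition on the curve itself.\<close>
    from this[of 1] this[of 2] show ?thesis by (simp add: \<gamma>_def)
  qed
  note osc = this
  have k0: "0 < k" using k by simp
  from osc_affine_zero[OF k0 osc[unfolded R_def A_def]]
  show "Dx (Suc k) (pd qq Q) w = 0"
    "pd uu Q w + real (k + 1) * Dx (Suc k) (pd pp Q) w - Dy (Suc k) (pd qq Q) w = 0"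
    "total_deriv (Suc k) k 0 Q w = Dy (Suc k) (pd pp Q) w"
    "\<And>i. 0 < i \<Longrightarrow> i \<le> k \<Longrightarrow> total_deriv (Suc k) (k - i) i Q w = 0"
    by (simp_all add: M_def c_def \<sigma>_def \<tau>_def)
qed

section \<open>The explicit symmetries\<close>

definition nset :: "nat \<Rightarrow> (nat \<times> nat) set" where
  "nset k = {(i,j). 1 \<le> i \<and> 1 \<le> j \<and> i + j \<le> k + 1}"

lemma finite_nset [simp]: "finite (nset k)"
  by (rule finite_subset[of _ "{..k+1} \<times> {..k+1}"]) (auto simp: nset_def)

text \<open>The value 0 for i + j > k + 1 overrides truncated subtraction in the exponent and
  mirrors the vanishing of brackets below degree -(k+1).\<close>

definition dmonom :: "nat \<Rightarrow> nat \<Rightarrow> nat \<Rightarrow> jfun" where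
  "dmonom k i j v = (if i + j \<le> k + 1 then v XX ^ (k + 1 - i - j) / fact (k + 1 - i - j) * v YY ^ (j - 1) else 0)"

text \<open>Components of the point field A d/dx + B d/dy + (C u + c) d/du; an appended x or y
  denotes the partial derivative.\<close>

definition cA :: "(gidx \<Rightarrow> real) \<Rightarrow> jfun" where
  "cA X v = X (N 1 0) + X (N 0 1) * v YY - X (G 1 1) * v XX - X (G 2 1) * v XX * v YY"
definition cAx :: "(gidx \<Rightarrow> real) \<Rightarrow> jfun" where
  "cAx X v = - X (G 1 1) - X (G 2 1) * v YY"
definition cAy :: "(gidx \<Rightarrow> real) \<Rightarrow> jfun" where
  "cAy X v = X (N 0 1) - X (G 2 1) * v XX"
definition cB :: "(gidx \<Rightarrow> real) \<Rightarrow> jfun" where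
  "cB X v = X (G 1 2) + (X (G 2 2) - X (G 1 1)) * v YY - X (G 2 1) * (v YY * v YY)"
definition cBy :: "(gidx \<Rightarrow> real) \<Rightarrow> jfun" where
  "cBy X v = X (G 2 2) - X (G 1 1) - 2 * X (G 2 1) * v YY"
definition cC :: "nat \<Rightarrow> (gidx \<Rightarrow> real) \<Rightarrow> jfun" where
  "cC k X v = - (real k * X (G 1 1)) - X (G 2 2) - (real k - 1) * X (G 2 1) * v YY"
text \<open>The two leading terms are chosen so that the k-th x-derivative is -A_y; the sum is a
  general polynomial of degree less than k.\<close>

definition c0 :: "nat \<Rightarrow> (gidx \<Rightarrow> real) \<Rightarrow> jfun" where
  "c0 k X v = - X (N 0 1) / fact k * v XX ^ k + X (G 2 1) / fact (k + 1) * v XX ^ (k + 1)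
     - (\<Sum>q\<in>nset k. X (N (fst q) (snd q)) * dmonom k (fst q) (snd q) v)"

text \<open>The generating function of the vector field corresponding to an element of the model:
  \<open>e\<^sub>1\<^sub>0 \<mapsto> \<partial>\<^sub>x\<close>, \<open>e\<^sub>0\<^sub>1 \<mapsto> y \<partial>\<^sub>x - x^k/k! \<partial>\<^sub>u\<close>, \<open>E\<^sub>1\<^sub>2 \<mapsto> \<partial>\<^sub>y\<close>, \<open>E\<^sub>1\<^sub>1 \<mapsto> - x \<partial>\<^sub>x - y \<partial>\<^sub>y - k u \<partial>\<^sub>u\<close>,
  \<open>E\<^sub>2\<^sub>2 \<mapsto> y \<partial>\<^sub>y - u \<partial>\<^sub>u\<close>, \<open>E\<^sub>2\<^sub>1 \<mapsto> - x y \<partial>\<^sub>x - y^2 \<partial>\<^sub>y - ((k-1) y u - x^(k+1)/(k+1)!) \<partial>\<^sub>u\<close>; the brackets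
  then force \<open>e\<^sub>i\<^sub>j \<mapsto> - x^a/a! y^(j-1) \<partial>\<^sub>u\<close> with \<open>a = k + 1 - i - j\<close>.\<close>

definition genfun :: "nat \<Rightarrow> (gidx \<Rightarrow> real) \<Rightarrow> jfun" where
  "genfun k X v = - (cA X v * v pp) - cB X v * v qq + cC k X v * v uu + c0 k X v"

lemma smooth_coeffs [simp]: "smooth (cA X)" "smooth (cAx X)" "smooth (cAy X)" "smooth (cB X)" "smooth (cBy X)" "smooth (cC k X)"
    "smooth (dmonom k i j)" "smooth (c0 k X)"
proof -
  show m: "smooth (dmonom k i j)" for i j unfolding dmonom_def[abs_def] by (intro smooth_if smooth_mult smooth_divide smooth_power smooth_coord smooth_const)
  show "smooth (c0 k X)" unfolding c0_def[abs_def] by (intro smooth_diff smooth_add smooth_mult smooth_sum smooth_power smooth_coord smooth_const m)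
qed (simp_all add: cA_def[abs_def] cAx_def[abs_def] cAy_def[abs_def] cB_def[abs_def] cBy_def[abs_def] cC_def[abs_def])

lemma depends_coeffs [simp]:
  assumes "XX \<in> S" "YY \<in> S"
  shows "depends_only S (cA X)" "depends_only S (cAx X)" "depends_only S (cAy X)" "depends_only S (cB X)"
    "depends_only S (cBy X)" "depends_only S (cC k X)" "depends_only S (dmonom k i j)" "depends_only S (c0 k X)"
proof -
  show m: "depends_only S (dmonom k i j)" for i j unfolding dmonom_def[abs_def] using assms by simp
  show "depends_only S (c0 k X)" unfolding c0_def[abs_def] using assms m by simp
qed (use assms in \<open>simp_all add: cA_def[abs_def] cAx_def[abs_def] cAy_def[abs_def] cB_def[abs_def]
    cBy_def[abs_def] cC_def[abs_def]\<close>)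

lemma smooth_genfun [simp]: "smooth (genfun k X)"
  unfolding genfun_def[abs_def] by simp

lemma depends_genfun: "depends_only J1 (genfun k X)"
  unfolding genfun_def[abs_def] by simp

lemma D_coeffs [simp]:
  "Dx M (cA X) = cAx X" "Dy M (cA X) = cAy X"
  "Dx M (cAx X) = (\<lambda>v. 0)" "Dx M (cAy X) = (\<lambda>v. - X (G 2 1))" "Dy M (cAy X) = (\<lambda>v. 0)"
  "Dx M (cB X) = (\<lambda>v. 0)" "Dy M (cB X) = cBy X"
  "Dx M (cBy X) = (\<lambda>v. 0)" "Dy M (cBy X) = (\<lambda>v. - 2 * X (G 2 1))"
  "Dx M (cC k X) = (\<lambda>v. 0)" "Dy M (cC k X) = (\<lambda>v. - ((real k - 1) * X (G 2 1)))"
  by (simp_all add: cA_def[abs_def] cAx_def[abs_def] cAy_def[abs_def] cB_def[abs_def] cBy_def[abs_def]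
      cC_def[abs_def] fun_eq_iff algebra_simps)

section \<open>Derivatives of polynomials in x and y\<close>

definition base_deriv :: "nat \<Rightarrow> nat \<Rightarrow> jfun \<Rightarrow> jfun" where
  "base_deriv a b F = (pd XX ^^ a) ((pd YY ^^ b) F)"

lemma base_deriv_0 [simp]: "base_deriv 0 0 F = F"
  and base_deriv_Suc_x: "base_deriv (Suc a) b F = pd XX (base_deriv a b F)"
  and base_deriv_Suc_y: "base_deriv 0 (Suc b) F = pd YY (base_deriv 0 b F)"
  by (simp_all add: base_deriv_def)

lemma smooth_base_deriv [simp]: "smooth F \<Longrightarrow> smooth (base_deriv a b F)"
  by (induction a b rule: total_deriv_induct) (auto simp: base_deriv_Suc_x base_deriv_Suc_y)

lemma depends_base_deriv: "depends_only S F \<Longrightarrow> depends_only S (base_deriv a b F)"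
  by (induction a b rule: total_deriv_induct) (auto simp: base_deriv_Suc_x base_deriv_Suc_y)

lemma base_deriv_add: "smooth F \<Longrightarrow> smooth H \<Longrightarrow> base_deriv a b (\<lambda>v. F v + H v) = (\<lambda>v. base_deriv a b F v + base_deriv a b H v)"
  by (induction a b rule: total_deriv_induct) (auto simp: base_deriv_Suc_x base_deriv_Suc_y)

lemma base_deriv_cmult: "smooth F \<Longrightarrow> base_deriv a b (\<lambda>v. r * F v) = (\<lambda>v. r * base_deriv a b F v)"
  by (induction a b rule: total_deriv_induct) (auto simp: base_deriv_Suc_x base_deriv_Suc_y)

lemma base_deriv_diff: "smooth F \<Longrightarrow> smooth H \<Longrightarrow> base_deriv a b (\<lambda>v. F v - H v) = (\<lambda>v. base_deriv a b F v - base_deriv a b H v)"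
  by (induction a b rule: total_deriv_induct) (auto simp: base_deriv_Suc_x base_deriv_Suc_y)

lemma base_deriv_sum: "(\<And>i. i \<in> I \<Longrightarrow> smooth (F i)) \<Longrightarrow> base_deriv a b (\<lambda>v. \<Sum>i\<in>I. F i v) = (\<lambda>v. \<Sum>i\<in>I. base_deriv a b (F i) v)"
  by (induction a b rule: total_deriv_induct) (auto simp: base_deriv_Suc_x base_deriv_Suc_y)

text \<open>The products are falling factorials. Natural subtraction puts a zero factor into them as
  soon as a > r or b > s, which makes the truncated exponents harmless.\<close>

lemma base_deriv_monomial:
  "base_deriv a b (\<lambda>v. v XX ^ r * v YY ^ s)
    = (\<lambda>v. (\<Prod>i<a. real (r - i)) * v XX ^ (r - a) * ((\<Prod>i<b. real (s - i)) * v YY ^ (s - b)))"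
  by (induction a b rule: total_deriv_induct) (simp_all add: base_deriv_Suc_x base_deriv_Suc_y, simp_all add: fun_eq_iff)

lemma base_deriv_monomial_zero: "r + s < a + b \<Longrightarrow> base_deriv a b (\<lambda>v. v XX ^ r * v YY ^ s) = (\<lambda>v. 0)"
proof -
  assume "r + s < a + b"
  then have "r < a \<or> s < b" by auto
  moreover have "(\<Prod>i<n. real (t - i)) = 0" if "t < n" for n t :: nat
    by (rule prod_zero) (use that in auto)
  ultimately show ?thesis unfolding base_deriv_monomial by auto
qed

lemma D_base_function:
  assumes "depends_only {XX, YY} F"
  shows "Dx M F = pd XX F" "Dy M F = pd YY F"
  using pd_eq_0[OF assms] by (simp_all add: Dx_def Dy_def fun_eq_iff case_prod_unfold)

text \<open>Leibniz' rule, which stops early because A is bilinear in x and y, B quadratic in y and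
  C affine in y. Every occurrence of \<open>b - 1\<close> carries a factor
  \<open>real b\<close>.\<close>

lemma total_deriv_genfun:
  assumes "a + b \<le> M" "0 < M"
  shows "total_deriv M a b (genfun k X) = (\<lambda>v.
    - (cA X v * v (UU (Suc a) b) + real a * cAx X v * v (UU a b) + real b * cAy X v * v (UU (Suc a) (b - 1))
        - real a * real b * X (G 2 1) * v (UU a (b - 1)))
    - (cB X v * v (UU a (Suc b)) + real b * cBy X v * v (UU a b) - real b * (real b - 1) * X (G 2 1) * v (UU a (b - 1)))
    + cC k X v * v (UU a b) - real b * (real k - 1) * X (G 2 1) * v (UU a (b - 1)) + base_deriv a b (c0 k X) v)"
  using assms(1)
proof (induction a b rule: total_deriv_induct)
  case 0 show ?case by (simp add: genfun_def[abs_def])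
next
  case (y b)
  have d: "depends_only {XX, YY} (base_deriv 0 b (c0 k X))" by (intro depends_base_deriv) simp
  have le: "0 + b \<le> M" using y.prems by simp
  show ?case
  proof (cases b)
    case 0 show ?thesis
      unfolding total_deriv_Suc_y base_deriv_Suc_y y.IH[OF le] using y.prems assms(2)
      by (simp add: 0 D_base_function(2)[of "c0 k X"]) (simp add: fun_eq_iff algebra_simps)
  next
    case (Suc b') show ?thesis
      unfolding total_deriv_Suc_y base_deriv_Suc_y y.IH[OF le] using y.prems
      by (simp add: Suc D_base_function(2)[OF d[unfolded Suc]]) (simp add: fun_eq_iff algebra_simps)
  qed
next
  case (x a b)
  have d: "depends_only {XX, YY} (base_deriv a b (c0 k X))" by (intro depends_base_deriv) simp
  have le: "a + b \<le> M" using x.prems by simp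
  show ?case
  proof (cases b)
    case 0 show ?thesis
      unfolding total_deriv_Suc_x base_deriv_Suc_x x.IH[OF le] using x.prems
      by (simp add: 0 D_base_function(1)[OF d[unfolded 0]]) (simp add: fun_eq_iff algebra_simps)
  next
    case (Suc b') show ?thesis
      unfolding total_deriv_Suc_x base_deriv_Suc_x x.IH[OF le] using x.prems
      by (simp add: Suc D_base_function(1)[OF d[unfolded Suc]]) (simp add: fun_eq_iff algebra_simps)
  qed
qed

lemma base_deriv_c0:
  assumes "a + b = k"
  shows "base_deriv a b (c0 k X) = (\<lambda>v. if b = 0 then - cAy X v else 0)"
proof -
  have m: "base_deriv a b (dmonom k i j) = (\<lambda>v. 0)" if "(i, j) \<in> nset k" for i j
  proof -
    have e: "dmonom k i j = (\<lambda>v. 1 / fact (k + 1 - i - j) * (v XX ^ (k + 1 - i - j) * v YY ^ (j - 1)))"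
      using that by (auto simp: dmonom_def nset_def)
    have "k + 1 - i - j + (j - 1) < a + b" using that assms by (auto simp: nset_def)
    from base_deriv_monomial_zero[OF this] show ?thesis
      unfolding e by (subst base_deriv_cmult) (intro smooth_mult smooth_power smooth_coord, simp)
  qed
  have s: "smooth (\<lambda>v. X (N (fst q) (snd q)) * dmonom k (fst q) (snd q) v)" for q by simp
  have c0: "c0 k X = (\<lambda>v. (- X (N 0 1) / fact k * (v XX ^ k * v YY ^ 0) + X (G 2 1) / fact (k + 1) * (v XX ^ (k + 1) * v YY ^ 0))
     - (\<Sum>q\<in>nset k. X (N (fst q) (snd q)) * dmonom k (fst q) (snd q) v))"
    by (simp add: c0_def fun_eq_iff)
  have "base_deriv a b (c0 k X) = (\<lambda>v. - X (N 0 1) / fact k * base_deriv a b (\<lambda>v. v XX ^ k * v YY ^ 0) v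
      + X (G 2 1) / fact (k + 1) * base_deriv a b (\<lambda>v. v XX ^ (k + 1) * v YY ^ 0) v
      - (\<Sum>q\<in>nset k. X (N (fst q) (snd q)) * base_deriv a b (dmonom k (fst q) (snd q)) v))"
    unfolding c0 by (subst base_deriv_diff base_deriv_add base_deriv_cmult base_deriv_sum; (intro smooth_add smooth_mult smooth_sum smooth_power smooth_coord smooth_const smooth_coeffs)?)+ simp
  also have "\<dots> = (\<lambda>v. - X (N 0 1) / fact k * base_deriv a b (\<lambda>v. v XX ^ k * v YY ^ 0) v
      + X (G 2 1) / fact (k + 1) * base_deriv a b (\<lambda>v. v XX ^ (k + 1) * v YY ^ 0) v)"
    using m by (simp add: fun_eq_iff)
  also have "\<dots> = (\<lambda>v. if b = 0 then - cAy X v else 0)"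
  proof (cases b)
    case 0
    then have a: "a = k" using assms by simp
    have "(\<Prod>i<k. real (k - i)) = fact k" by (simp add: fact_prod_rev lessThan_atLeast0)
    moreover have "(\<Prod>i<k. real (Suc k - i)) = fact (Suc k)"
      using fact_prod_rev[of "Suc k", where 'a = real] by (simp add: lessThan_atLeast0)
    ultimately show ?thesis unfolding base_deriv_monomial by (simp add: 0 a cAy_def fun_eq_iff)
  next
    case (Suc b')
    then show ?thesis unfolding base_deriv_monomial by (simp add: fun_eq_iff prod.lessThan_Suc_shift)
  qed
  finally show ?thesis .
qed

lemma pd_genfun:
  "pd pp (genfun k X) v = - cA X v" "pd qq (genfun k X) v = - cB X v"
proof -
  have z: "pd c (cA X) = (\<lambda>v. 0)" "pd c (cB X) = (\<lambda>v. 0)" "pd c (cC k X) = (\<lambda>v. 0)" "pd c (c0 k X) = (\<lambda>v. 0)"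
    if "c \<notin> {XX, YY}" for c
    by (rule pd_eq_0[of "{XX, YY}"]; use that in simp)+
  show "pd pp (genfun k X) v = - cA X v" "pd qq (genfun k X) v = - cB X v"
    unfolding genfun_def[abs_def] by (simp_all add: z)
qed

text \<open>The coordinates of order k + 1 cancel. What remains is a multiple of the scaling in
  \<open>Ppar_scaling\<close> plus a multiple of the translation in \<open>Ppar_translation\<close>,
  with factors depending only on x and y.\<close>

lemma prol_genfun:
  assumes "a + b = k" "0 < k"
  shows "prol k (contact_vf (genfun k X)) a b v = (X (G 2 1) * v YY - X (G 2 2)) * (real (Suc b) * v (UU a b))
    - cAy X v * (real b * v (UU (Suc a) (b - 1)) + (if b = 0 then 1 else 0))"
proof -
  have k: "real k = real a + real b" using assms by auto
  show ?thesis
    using assms unfolding prol_contact_vf pd_genfun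
    by (simp add: total_deriv_genfun base_deriv_c0 cA_def cAx_def cAy_def cB_def cBy_def cC_def k algebra_simps)
qed

lemma genfun_symmetry:
  assumes "0 < k"
  shows "contact_vf (genfun k X) \<in> contact_syms k m"
  unfolding contact_syms_def
proof (intro CollectI conjI allI impI)
  show "contact_field (contact_vf (genfun k X))"
    unfolding contact_field_iff using depends_genfun smooth_genfun by blast
next
  fix l z w assume "on_system k m l z w \<and> regular_par k m l z"
  then have w: "w (UU (k - i) i) = Ppar m i l z" if "i \<le> k" for i
    using that by (simp add: on_system_def)
  define \<kappa> where "\<kappa> = X (G 2 1) * w YY - X (G 2 2)"
  have "prol k (contact_vf (genfun k X)) (k - i) i w = (\<kappa> * l - cAy X w) * dPl m i l z
      + (\<Sum>j = 1..m. \<kappa> * (real j * z j) * dPz m i j l z)" if i: "i \<le> k" for i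
  proof -
    have "real i * w (UU (Suc (k - i)) (i - 1)) = real i * Ppar m (i - 1) l z"
      using w[of "i - 1"] i by (cases i) (simp_all add: Suc_diff_Suc)
    then have "prol k (contact_vf (genfun k X)) (k - i) i w = \<kappa> * (real (Suc i) * Ppar m i l z)
        - cAy X w * (real i * Ppar m (i - 1) l z + (if i = 0 then 1 else 0))"
      using i assms w[OF i] by (simp add: prol_genfun \<kappa>_def)
    also have "\<dots> = \<kappa> * (l * dPl m i l z + (\<Sum>j = 1..m. real j * z j * dPz m i j l z)) - cAy X w * dPl m i l z"
      unfolding Ppar_scaling Ppar_translation ..
    finally show ?thesis by (simp add: algebra_simps sum_distrib_left)
  qed
  then show "\<exists>a bb. \<forall>i\<le>k. prol k (contact_vf (genfun k X)) (k - i) i w = a * dPl m i l z + (\<Sum>j = 1..m. bb j * dPz m i j l z)"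
    by (intro exI[of _ "\<kappa> * l - cAy X w"] exI[of _ "\<lambda>j. \<kappa> * (real j * z j)"]) simp
qed

lemma genfun_lin: "genfun k (\<lambda>e. a * X e + b * Y e) = (\<lambda>v. a * genfun k X v + b * genfun k Y v)"
  by (simp add: fun_eq_iff genfun_def cA_def cB_def cC_def c0_def algebra_simps sum.distrib sum_distrib_left add_divide_distrib diff_divide_distrib)

section \<open>Brackets\<close>

lemma sum_J1: "(\<Sum>d\<in>J1. f d) = f XX + f YY + f uu + f pp + (f qq :: real)"
  by (simp add: J1_def)

text \<open>The derivative of R along the contact field of Q, minus Q_u R.\<close>

definition lagrange_bracket :: "jfun \<Rightarrow> jfun \<Rightarrow> jfun" where
  "lagrange_bracket Q R = (\<lambda>v. - (pd pp Q v * pd XX R v) - pd qq Q v * pd YY R v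
     + (Q v - v pp * pd pp Q v - v qq * pd qq Q v) * pd uu R v
     + (pd XX Q v + v pp * pd uu Q v) * pd pp R v + (pd YY Q v + v qq * pd uu Q v) * pd qq R v
     - pd uu Q v * R v)"

lemma contact_vf_simps:
  "contact_vf Q XX = (\<lambda>v. - pd pp Q v)" "contact_vf Q YY = (\<lambda>v. - pd qq Q v)"
  "contact_vf Q uu = (\<lambda>v. Q v - v pp * pd pp Q v - v qq * pd qq Q v)"
  "contact_vf Q pp = (\<lambda>v. pd XX Q v + v pp * pd uu Q v)" "contact_vf Q qq = (\<lambda>v. pd YY Q v + v qq * pd uu Q v)"
  by (simp_all add: contact_vf_def)

lemma vf_bracket_contact_vf:
  assumes Q: "smooth Q" and R: "smooth R"
  shows "vf_bracket (contact_vf Q) (contact_vf R) = contact_vf (lagrange_bracket Q R)"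
proof
  fix c
  have base: "vf_bracket (contact_vf Q) (contact_vf R) c = contact_vf (lagrange_bracket Q R) c" if "c \<in> J1"
  proof -
    from that consider "c = XX" | "c = YY" | "c = uu" | "c = pp" | "c = qq"
      by (auto simp: J1_def)
    then show ?thesis
      by cases (simp_all add: vf_bracket_def sum_J1 contact_vf_simps lagrange_bracket_def Q R pd_commute[OF Q] pd_commute[OF R],
        simp_all add: fun_eq_iff algebra_simps)
  qed
  have "contact_vf F c = (\<lambda>v. 0)" if "c \<notin> J1" for F
    using that by (auto simp: contact_vf_def J1_def split: jvar.splits)
  then show "vf_bracket (contact_vf Q) (contact_vf R) c = contact_vf (lagrange_bracket Q R) c"
    using base by (cases "c \<in> J1") (simp_all add: vf_bracket_def)
qed

section \<open>Structure constants of the model, paired with monomials\<close>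

lemma sum_nidx: "(\<Sum>p\<in>nidx k. f p) = f (1,0) + f (0,1) + (\<Sum>p\<in>nset k. f p :: real)"
proof -
  have "nidx k = insert (1,0) (insert (0,1) (nset k))" by (auto simp: nidx_def nset_def)
  moreover have "(1,0) \<notin> insert (0,1) (nset k)" "(0,1) \<notin> nset k" by (auto simp: nset_def)
  ultimately show ?thesis by (simp add: add.assoc)
qed

lemma nsetD: "q \<in> nset k \<Longrightarrow> 1 \<le> fst q \<and> 1 \<le> snd q \<and> fst q + snd q \<le> k + 1"
  by (auto simp: nset_def)

lemma nset_neq: "q \<in> nset k \<Longrightarrow> q \<noteq> (Suc 0, 0) \<and> q \<noteq> (0, Suc 0) \<and> (Suc 0, 0) \<noteq> q \<and> (0, Suc 0) \<noteq> q"
  by (auto simp: nset_def)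

text \<open>Brackets inside the nilpotent part have degree at most -2 and the action of gl_2
  preserves the degree, so in degree -1 only the standard representation is visible.\<close>

lemma mbr_g1:
  "mbr k X Y (N 1 0) = Y (N 1 0) * X (G 1 1) + Y (N 0 1) * X (G 1 2)
     - X (N 1 0) * Y (G 1 1) - X (N 0 1) * Y (G 1 2)"
  "mbr k X Y (N 0 1) = Y (N 1 0) * X (G 2 1) + Y (N 0 1) * X (G 2 2)
     - X (N 1 0) * Y (G 2 1) - X (N 0 1) * Y (G 2 2)"
proof -
  have nb0: "nb k p q (N 1 0) = 0" "nb k p q (N 0 1) = 0" for p q
    by (auto simp: nb_def dl_def)
  have rho0: "rho_b A q (N 1 0) = 0" "rho_b A q (N 0 1) = 0" if "q \<in> nset k" for A q
    using nsetD[OF that] by (cases q; auto simp: rho_b_def Let_def dl_def)+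
  have rb: "rho_b A (1,0) (N 1 0) = A 1 1" "rho_b A (0,1) (N 1 0) = A 1 2"
    "rho_b A (1,0) (N 0 1) = A 2 1" "rho_b A (0,1) (N 0 1) = A 2 2" for A
    by (simp_all add: rho_b_def dl_def)
  show "mbr k X Y (N 1 0) = Y (N 1 0) * X (G 1 1) + Y (N 0 1) * X (G 1 2)
      - X (N 1 0) * Y (G 1 1) - X (N 0 1) * Y (G 1 2)"
    unfolding mbr_def gidx.case nb0 sum_nidx rb by (simp add: rho0[simplified])
  show "mbr k X Y (N 0 1) = Y (N 1 0) * X (G 2 1) + Y (N 0 1) * X (G 2 2)
      - X (N 1 0) * Y (G 2 1) - X (N 0 1) * Y (G 2 2)"
    unfolding mbr_def gidx.case nb0 sum_nidx rb by (simp add: rho0[simplified])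
qed

lemma mbr_gl:
  "mbr k X Y (G r s) = X (G r 1) * Y (G 1 s) - Y (G r 1) * X (G 1 s) + (X (G r 2) * Y (G 2 s) - Y (G r 2) * X (G 2 s))"
  by (simp add: mbr_def)

text \<open>An index with a + b > k + 1 lies outside the sum, but there \<open>dmonom\<close> is 0
  as well.\<close>

lemma sum_dl_dmonom:
  "(\<Sum>e\<in>nset k. dl (N a b) (N (fst e) (snd e)) * dmonom k (fst e) (snd e) v)
    = (if 1 \<le> a \<and> 1 \<le> b then dmonom k a b v else 0)"
proof -
  have "(\<Sum>e\<in>nset k. dl (N a b) (N (fst e) (snd e)) * dmonom k (fst e) (snd e) v)
      = (\<Sum>e\<in>nset k. if e = (a, b) then dmonom k a b v else 0)"
    by (rule sum.cong) (auto simp: dl_def)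
  also have "\<dots> = (if (a, b) \<in> nset k then dmonom k a b v else 0)" by simp
  finally show ?thesis by (auto simp: nset_def dmonom_def)
qed

text \<open>The truncation conditions in \<open>nb\<close> are absorbed by the convention that
  \<open>dmonom\<close> vanishes beyond i + j = k + 1.\<close>

lemma sum_nb_dmonom:
  assumes "q \<in> nset k" "q' \<in> nset k"
  shows "(\<Sum>e\<in>nset k. nb k (1,0) q (N (fst e) (snd e)) * dmonom k (fst e) (snd e) v) = dmonom k (Suc (fst q)) (snd q) v"
    "(\<Sum>e\<in>nset k. nb k (0,1) q (N (fst e) (snd e)) * dmonom k (fst e) (snd e) v) = dmonom k (fst q) (Suc (snd q)) v"
    "(\<Sum>e\<in>nset k. nb k q (1,0) (N (fst e) (snd e)) * dmonom k (fst e) (snd e) v) = - dmonom k (Suc (fst q)) (snd q) v"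
    "(\<Sum>e\<in>nset k. nb k q (0,1) (N (fst e) (snd e)) * dmonom k (fst e) (snd e) v) = - dmonom k (fst q) (Suc (snd q)) v"
    "(\<Sum>e\<in>nset k. nb k q q' (N (fst e) (snd e)) * dmonom k (fst e) (snd e) v) = 0"
proof -
  have "nb k q q' e = 0" for e using nset_neq[OF assms(1)] nset_neq[OF assms(2)] by (simp add: nb_def)
  then show "(\<Sum>e\<in>nset k. nb k q q' (N (fst e) (snd e)) * dmonom k (fst e) (snd e) v) = 0" by simp
  note q = nset_neq[OF assms(1)] nsetD[OF assms(1)]
  have out: "dmonom k a b v = 0" if "k + 1 < a + b" for a b using that by (simp add: dmonom_def)
  show "(\<Sum>e\<in>nset k. nb k (1,0) q (N (fst e) (snd e)) * dmonom k (fst e) (snd e) v) = dmonom k (Suc (fst q)) (snd q) v"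
    using q sum_dl_dmonom[of "Suc (fst q)" "snd q" k v] out[of "Suc (fst q)" "snd q"]
    by (cases "fst q + snd q + 1 \<le> k + 1") (simp_all add: nb_def)
  show "(\<Sum>e\<in>nset k. nb k (0,1) q (N (fst e) (snd e)) * dmonom k (fst e) (snd e) v) = dmonom k (fst q) (Suc (snd q)) v"
    using q sum_dl_dmonom[of "fst q" "Suc (snd q)" k v] out[of "fst q" "Suc (snd q)"]
    by (cases "fst q + snd q + 1 \<le> k + 1") (simp_all add: nb_def)
  show "(\<Sum>e\<in>nset k. nb k q (1,0) (N (fst e) (snd e)) * dmonom k (fst e) (snd e) v) = - dmonom k (Suc (fst q)) (snd q) v"
    using q sum_dl_dmonom[of "Suc (fst q)" "snd q" k v] out[of "Suc (fst q)" "snd q"]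
    by (cases "fst q + snd q + 1 \<le> k + 1") (simp_all add: nb_def sum_negf)
  show "(\<Sum>e\<in>nset k. nb k q (0,1) (N (fst e) (snd e)) * dmonom k (fst e) (snd e) v) = - dmonom k (fst q) (Suc (snd q)) v"
    using q sum_dl_dmonom[of "fst q" "Suc (snd q)" k v] out[of "fst q" "Suc (snd q)"]
    by (cases "fst q + snd q + 1 \<le> k + 1") (simp_all add: nb_def sum_negf)
qed

lemma sum_nb_dmonom_base:
  assumes "1 \<le> k"
  shows "(\<Sum>e\<in>nset k. nb k (1,0) (0,1) (N (fst e) (snd e)) * dmonom k (fst e) (snd e) v) = dmonom k 1 1 v"
    "(\<Sum>e\<in>nset k. nb k (0,1) (1,0) (N (fst e) (snd e)) * dmonom k (fst e) (snd e) v) = - dmonom k 1 1 v"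
    "(\<Sum>e\<in>nset k. nb k (1,0) (1,0) (N (fst e) (snd e)) * dmonom k (fst e) (snd e) v) = 0"
    "(\<Sum>e\<in>nset k. nb k (0,1) (0,1) (N (fst e) (snd e)) * dmonom k (fst e) (snd e) v) = 0"
  using sum_dl_dmonom[of "Suc 0" "Suc 0" k v] by (simp_all add: nb_def sum_negf)

text \<open>Image of \<open>rho_b\<close> under e_ij \<mapsto> \<open>dmonom k i j\<close>. The
  trace raises the weights i - 1 and j - 1 of the polynomial part to i and j.\<close>

definition gl_dmonom :: "nat \<Rightarrow> (nat \<Rightarrow> nat \<Rightarrow> real) \<Rightarrow> nat \<Rightarrow> nat \<Rightarrow> jfun" where
  "gl_dmonom k A i j v = (real i * A 1 1 + real j * A 2 2) * dmonom k i j v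
    + real (i - 1) * A 2 1 * dmonom k (i - 1) (j + 1) v + real (j - 1) * A 1 2 * dmonom k (i + 1) (j - 1) v"

lemma sum_rho_dmonom:
  "q \<in> nset k \<Longrightarrow> (\<Sum>e\<in>nset k. rho_b A q (N (fst e) (snd e)) * dmonom k (fst e) (snd e) v) = gl_dmonom k A (fst q) (snd q) v"
  "(\<Sum>e\<in>nset k. rho_b A (1,0) (N (fst e) (snd e)) * dmonom k (fst e) (snd e) v) = 0"
  "(\<Sum>e\<in>nset k. rho_b A (0,1) (N (fst e) (snd e)) * dmonom k (fst e) (snd e) v) = 0"
proof -
  assume q: "q \<in> nset k"
  define i j where ij: "i = fst q" "j = snd q"
  have ge: "1 \<le> i" "1 \<le> j" using nsetD[OF q] ij by auto
  have "rho_b A q (N (fst e) (snd e)) * m = (real i * A 1 1 + real j * A 2 2) * (dl (N i j) (N (fst e) (snd e)) * m)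
      + real (i - 1) * A 2 1 * (dl (N (i - 1) (j + 1)) (N (fst e) (snd e)) * m)
      + real (j - 1) * A 1 2 * (dl (N (i + 1) (j - 1)) (N (fst e) (snd e)) * m)" for e m
    using nset_neq[OF q] ge by (simp add: rho_b_def Let_def ij[symmetric] of_nat_diff algebra_simps)
  then have "(\<Sum>e\<in>nset k. rho_b A q (N (fst e) (snd e)) * dmonom k (fst e) (snd e) v)
      = (real i * A 1 1 + real j * A 2 2) * (\<Sum>e\<in>nset k. dl (N i j) (N (fst e) (snd e)) * dmonom k (fst e) (snd e) v)
      + real (i - 1) * A 2 1 * (\<Sum>e\<in>nset k. dl (N (i - 1) (j + 1)) (N (fst e) (snd e)) * dmonom k (fst e) (snd e) v)
      + real (j - 1) * A 1 2 * (\<Sum>e\<in>nset k. dl (N (i + 1) (j - 1)) (N (fst e) (snd e)) * dmonom k (fst e) (snd e) v)"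
    by (simp only: sum.distrib sum_distrib_left)
  also have "\<dots> = gl_dmonom k A i j v"
    unfolding sum_dl_dmonom gl_dmonom_def using ge by (cases "i = 1"; cases "j = 1") auto
  finally show "(\<Sum>e\<in>nset k. rho_b A q (N (fst e) (snd e)) * dmonom k (fst e) (snd e) v) = gl_dmonom k A (fst q) (snd q) v"
    by (simp add: ij)
next
  have "dl (N (Suc 0) 0) (N (fst e) (snd e)) = 0" "dl (N 0 (Suc 0)) (N (fst e) (snd e)) = 0" if "e \<in> nset k" for e
    using nsetD[OF that] by (auto simp: dl_def)
  then show "(\<Sum>e\<in>nset k. rho_b A (1,0) (N (fst e) (snd e)) * dmonom k (fst e) (snd e) v) = 0"
    "(\<Sum>e\<in>nset k. rho_b A (0,1) (N (fst e) (snd e)) * dmonom k (fst e) (snd e) v) = 0"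
    by (simp_all add: rho_b_def)
qed

definition dmonom_sum :: "nat \<Rightarrow> (gidx \<Rightarrow> real) \<Rightarrow> jfun" where
  "dmonom_sum k X v = (\<Sum>q\<in>nset k. X (N (fst q) (snd q)) * dmonom k (fst q) (snd q) v)"

text \<open>Elements of degree at most -2 commute with each other, so only their products with the
  degree -1 part and with gl_2 survive, besides the bracket of \<open>e_10\<close> and
  \<open>e_01\<close>.\<close>

lemma dmonom_sum_mbr:
  assumes "1 \<le> k"
  shows "dmonom_sum k (mbr k X Y) v = (X (N 1 0) * Y (N 0 1) - X (N 0 1) * Y (N 1 0)) * dmonom k 1 1 v
    + (\<Sum>q\<in>nset k. Y (N (fst q) (snd q)) * (X (N 1 0) * dmonom k (Suc (fst q)) (snd q) v
        + X (N 0 1) * dmonom k (fst q) (Suc (snd q)) v + gl_dmonom k (\<lambda>r s. X (G r s)) (fst q) (snd q) v))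
    - (\<Sum>q\<in>nset k. X (N (fst q) (snd q)) * (Y (N 1 0) * dmonom k (Suc (fst q)) (snd q) v
        + Y (N 0 1) * dmonom k (fst q) (Suc (snd q)) v + gl_dmonom k (\<lambda>r s. Y (G r s)) (fst q) (snd q) v))"
proof -
  define nm where "nm p q = (\<Sum>e\<in>nset k. nb k p q (N (fst e) (snd e)) * dmonom k (fst e) (snd e) v)" for p q
  define rm where "rm A q = (\<Sum>e\<in>nset k. rho_b A q (N (fst e) (snd e)) * dmonom k (fst e) (snd e) v)" for A q
  have sw: "(\<Sum>e\<in>S. (\<Sum>q\<in>T. f q * g q e) * h e) = (\<Sum>q\<in>T. f q * (\<Sum>e\<in>S. g q e * h e))"
    for S :: "(nat \<times> nat) set" and T :: "(nat \<times> nat) set" and f g and h :: "_ \<Rightarrow> real"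
    unfolding sum_distrib_left sum_distrib_right by (subst sum.swap) (simp add: mult_ac)
  have sw2: "(\<Sum>e\<in>S. (\<Sum>p\<in>T. \<Sum>q\<in>T. f p q * g p q e) * h e) = (\<Sum>p\<in>T. \<Sum>q\<in>T. f p q * (\<Sum>e\<in>S. g p q e * h e))"
    for S :: "(nat \<times> nat) set" and T :: "(nat \<times> nat) set" and f g and h :: "_ \<Rightarrow> real"
    using sw[of "\<lambda>_. 1" "\<lambda>p e. \<Sum>q\<in>T. f p q * g p q e" T h S] unfolding mult_1 sw by simp
  have "dmonom_sum k (mbr k X Y) v = (\<Sum>p\<in>nidx k. \<Sum>q\<in>nidx k. X (N (fst p) (snd p)) * Y (N (fst q) (snd q)) * nm p q)
      + (\<Sum>q\<in>nidx k. Y (N (fst q) (snd q)) * rm (\<lambda>r s. X (G r s)) q)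
      - (\<Sum>p\<in>nidx k. X (N (fst p) (snd p)) * rm (\<lambda>r s. Y (G r s)) p)"
    unfolding dmonom_sum_def mbr_def gidx.case distrib_right left_diff_distrib sum.distrib sum_subtractf sw sw2 nm_def rm_def ..
  also have "(\<Sum>p\<in>nidx k. \<Sum>q\<in>nidx k. X (N (fst p) (snd p)) * Y (N (fst q) (snd q)) * nm p q)
      = X (N 1 0) * Y (N 0 1) * dmonom k 1 1 v - X (N 0 1) * Y (N 1 0) * dmonom k 1 1 v
        + (\<Sum>q\<in>nset k. X (N 1 0) * Y (N (fst q) (snd q)) * dmonom k (Suc (fst q)) (snd q) v)
        + (\<Sum>q\<in>nset k. X (N 0 1) * Y (N (fst q) (snd q)) * dmonom k (fst q) (Suc (snd q)) v)
        - (\<Sum>q\<in>nset k. X (N (fst q) (snd q)) * Y (N 1 0) * dmonom k (Suc (fst q)) (snd q) v)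
        - (\<Sum>q\<in>nset k. X (N (fst q) (snd q)) * Y (N 0 1) * dmonom k (fst q) (Suc (snd q)) v)"
    unfolding sum_nidx nm_def sum_nb_dmonom_base[OF assms]
    by (simp add: sum_nb_dmonom[simplified] sum.distrib sum_negf sum_subtractf cong: sum.cong)
  also have "(\<Sum>q\<in>nidx k. Y (N (fst q) (snd q)) * rm (\<lambda>r s. X (G r s)) q)
      = (\<Sum>q\<in>nset k. Y (N (fst q) (snd q)) * gl_dmonom k (\<lambda>r s. X (G r s)) (fst q) (snd q) v)"
    unfolding sum_nidx rm_def sum_rho_dmonom(2,3) by (simp add: sum_rho_dmonom(1))
  also have "(\<Sum>q\<in>nidx k. X (N (fst q) (snd q)) * rm (\<lambda>r s. Y (G r s)) q)
      = (\<Sum>q\<in>nset k. X (N (fst q) (snd q)) * gl_dmonom k (\<lambda>r s. Y (G r s)) (fst q) (snd q) v)"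
    unfolding sum_nidx rm_def sum_rho_dmonom(2,3) by (simp add: sum_rho_dmonom(1))
  finally show ?thesis
    by (simp add: sum.distrib algebra_simps)
qed

section \<open>Action of the point fields on monomials\<close>

lemma divided_power_mult: "x * (x ^ n / fact n) = real (Suc n) * (x ^ Suc n / fact (Suc n))" for x :: real
  by (simp add: fact_Suc del: of_nat_Suc)

lemma divided_power_cancel: "real (Suc n) * y / fact (Suc n) = y / fact n"
  by (simp add: fact_Suc del: of_nat_Suc)

text \<open>In the first identity the boundary i + j = k + 1 is consistent: the left side is cut off
  and the factor on the right is 0.\<close>

lemma dmonom_mult:
  "(i, j) \<in> nset k \<Longrightarrow> v XX * dmonom k (Suc i) j v = real (k + 1 - i - j) * dmonom k i j v"
  "1 \<le> i \<Longrightarrow> 1 \<le> j \<Longrightarrow> v YY * dmonom k i j v = dmonom k (i - 1) (Suc j) v"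
  "1 \<le> j \<Longrightarrow> v YY * (real (j - 1) * dmonom k (Suc i) (j - 1) v) = real (j - 1) * dmonom k i j v"
proof -
  assume "(i, j) \<in> nset k"
  then have ij: "i + j \<le> k + 1" by (auto simp: nset_def)
  show "v XX * dmonom k (Suc i) j v = real (k + 1 - i - j) * dmonom k i j v"
  proof (cases "i + j = k + 1")
    case False
    then obtain a where a: "k + 1 = i + j + Suc a" using ij by (metis add_Suc_right le_neq_implies_less less_imp_Suc_add)
    have e: "k + 1 - i - j = Suc a" "k + 1 - Suc i - j = a" "i + j \<le> k + 1" "Suc i + j \<le> k + 1" using a by auto
    have "v XX * (v XX ^ a / fact a * c) = real (Suc a) * (v XX ^ Suc a / fact (Suc a) * c)" for c
      using divided_power_mult[of "v XX" a] by (metis mult.assoc)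
    then show ?thesis by (simp only: dmonom_def e if_True simp_thms)
  qed (simp add: dmonom_def)
next
  assume ij: "1 \<le> i" "1 \<le> j"
  then obtain i' j' where e: "i = Suc i'" "j = Suc j'" by (metis One_nat_def Suc_le_D)
  show "v YY * dmonom k i j v = dmonom k (i - 1) (Suc j) v" by (simp add: dmonom_def e)
next
  assume "1 \<le> j"
  then obtain j' where e: "j = Suc j'" by (metis One_nat_def Suc_le_D)
  show "v YY * (real (j - 1) * dmonom k (Suc i) (j - 1) v) = real (j - 1) * dmonom k i j v"
    by (cases j') (simp_all add: dmonom_def e)
qed

lemma pd_dmonom:
  assumes "(i, j) \<in> nset k"
  shows "pd XX (dmonom k i j) = dmonom k (Suc i) j"
    "pd YY (dmonom k i j) = (\<lambda>v. real (j - 1) * dmonom k (Suc i) (j - 1) v)"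
proof -
  have ij: "i + j \<le> k + 1" "1 \<le> j" using assms by (auto simp: nset_def)
  then obtain a where a: "k + 1 = i + j + a" by (metis le_iff_add)
  obtain j' where j: "j = Suc j'" using ij by (metis One_nat_def Suc_le_D)
  have e: "k + 1 - i - j = a" using a by auto
  have m: "dmonom k i j = (\<lambda>v. v XX ^ a / fact a * v YY ^ j')"
    using ij unfolding dmonom_def[abs_def] e by (simp add: j)
  show "pd XX (dmonom k i j) = dmonom k (Suc i) j"
  proof (cases a)
    case 0 then show ?thesis using a unfolding m by (simp add: dmonom_def[abs_def])
  next
    case (Suc a')
    have "k + 1 - Suc i - j = a'" "Suc i + j \<le> k + 1" using a Suc by auto
    moreover have "pd XX (\<lambda>v. v XX ^ Suc a' / fact (Suc a') * v YY ^ j')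
        = (\<lambda>v. real (Suc a') * v XX ^ a' / fact (Suc a') * v YY ^ j')"
      by (simp del: fact_Suc of_nat_Suc power_Suc)
    ultimately show ?thesis unfolding m Suc divided_power_cancel by (simp add: dmonom_def[abs_def] j)
  qed
  show "pd YY (dmonom k i j) = (\<lambda>v. real (j - 1) * dmonom k (Suc i) (j - 1) v)"
  proof (cases j')
    case 0 then show ?thesis unfolding m by (simp add: j)
  next
    case (Suc j'')
    have "k + 1 - Suc i - (j - 1) = a" "Suc i + (j - 1) \<le> k + 1" using a Suc j by auto
    moreover have "pd YY (\<lambda>v. v XX ^ a / fact a * v YY ^ Suc j'')
        = (\<lambda>v. v XX ^ a / fact a * (real (Suc j'') * v YY ^ j''))"
      by (simp del: power_Suc of_nat_Suc)
    ultimately show ?thesis unfolding m Suc by (simp add: dmonom_def[abs_def] j Suc mult_ac)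
  qed
qed

text \<open>For a function R of x and y alone, the bracket of \<open>genfun k X\<close> with R is A
  R_x + B R_y - C R. On the monomials this operator reproduces the action prescribed by the
  model.\<close>

lemma action_dmonom:
  assumes q: "(i, j) \<in> nset k"
  shows "cA X v * dmonom k (Suc i) j v + cB X v * (real (j - 1) * dmonom k (Suc i) (j - 1) v) - cC k X v * dmonom k i j v
    = X (N 1 0) * dmonom k (Suc i) j v + X (N 0 1) * dmonom k i (Suc j) v + gl_dmonom k (\<lambda>r s. X (G r s)) i j v"
proof -
  have ij: "1 \<le> i" "1 \<le> j" "i + j \<le> k + 1" using q by (auto simp: nset_def)
  have a: "real (k + 1 - i - j) = real k + 1 - real i - real j" using ij by auto
  define m where "m = dmonom k i j v"
  define mx where "mx = dmonom k (Suc i) j v"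
  define my where "my = real (j - 1) * dmonom k (Suc i) (j - 1) v"
  define m1 where "m1 = dmonom k (i - 1) (Suc j) v"
  have 1: "v XX * mx = (real k + 1 - real i - real j) * m" "v YY * m = m1" "v YY * mx = dmonom k i (Suc j) v"
    "v YY * my = (real j - 1) * m"
    using dmonom_mult(1)[OF q, of v] dmonom_mult(2)[of i j v k] dmonom_mult(2)[of "Suc i" j v k] dmonom_mult(3)[of j v k i] ij a
    by (simp_all add: m_def mx_def my_def m1_def of_nat_diff)
  have 2: "v XX * v YY * mx = (real k + 1 - real i - real j) * m1" "v YY * v YY * my = (real j - 1) * m1"
    using 1 by (metis mult.commute mult.left_commute)+
  have "cA X v * mx + cB X v * my - cC k X v * m
      = X (N 1 0) * mx + X (N 0 1) * (v YY * mx) - X (G 1 1) * (v XX * mx) - X (G 2 1) * (v XX * v YY * mx)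
        + X (G 1 2) * my + (X (G 2 2) - X (G 1 1)) * (v YY * my) - X (G 2 1) * (v YY * v YY * my)
        + (real k * X (G 1 1) + X (G 2 2)) * m + (real k - 1) * X (G 2 1) * (v YY * m)"
    by (simp add: cA_def cB_def cC_def algebra_simps)
  also have "\<dots> = X (N 1 0) * mx + X (N 0 1) * dmonom k i (Suc j) v
      + ((real i * X (G 1 1) + real j * X (G 2 2)) * m + (real i - 1) * X (G 2 1) * m1 + X (G 1 2) * my)"
    unfolding 1 2 by (simp add: algebra_simps)
  also have "(real i * X (G 1 1) + real j * X (G 2 2)) * m + (real i - 1) * X (G 2 1) * m1 + X (G 1 2) * my
      = gl_dmonom k (\<lambda>r s. X (G r s)) i j v"
    using ij by (simp add: gl_dmonom_def m_def m1_def my_def of_nat_diff)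
  finally show ?thesis by (simp add: m_def mx_def my_def)
qed

lemma c0_eq: "c0 k X v = X (G 2 1) * (v XX ^ (k + 1) / fact (k + 1)) - X (N 0 1) * (v XX ^ k / fact k) - dmonom_sum k X v"
  by (simp add: c0_def dmonom_sum_def)

lemma pd_c0:
  assumes "1 \<le> k"
  shows "pd XX (c0 k X) v = X (G 2 1) * (v XX ^ k / fact k) - X (N 0 1) * dmonom k 1 1 v
      - (\<Sum>q\<in>nset k. X (N (fst q) (snd q)) * dmonom k (Suc (fst q)) (snd q) v)"
    and "pd YY (c0 k X) v = - (\<Sum>q\<in>nset k. X (N (fst q) (snd q)) * (real (snd q - 1) * dmonom k (Suc (fst q)) (snd q - 1) v))"
proof -
  obtain k' where k: "k = Suc k'" using assms by (metis One_nat_def Suc_le_D)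
  have e: "c0 k X = (\<lambda>v. X (G 2 1) * (v XX ^ (k + 1) / fact (k + 1)) - X (N 0 1) * (v XX ^ k / fact k)
      - (\<Sum>q\<in>nset k. X (N (fst q) (snd q)) * dmonom k (fst q) (snd q) v))"
    by (simp add: c0_eq dmonom_sum_def fun_eq_iff)
  have p: "pd XX (dmonom k (fst q) (snd q)) = dmonom k (Suc (fst q)) (snd q)"
      "pd YY (dmonom k (fst q) (snd q)) = (\<lambda>v. real (snd q - 1) * dmonom k (Suc (fst q)) (snd q - 1) v)"
    if "q \<in> nset k" for q using that by (cases q; simp add: pd_dmonom)+
  have f: "real (Suc k) * v XX ^ k / fact (Suc k) = v XX ^ k / fact k" "real k * v XX ^ (k - Suc 0) / fact k = dmonom k 1 1 v"
    by (rule divided_power_cancel) (simp add: k dmonom_def divided_power_cancel del: fact_Suc of_nat_Suc)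
  show "pd XX (c0 k X) v = X (G 2 1) * (v XX ^ k / fact k) - X (N 0 1) * dmonom k 1 1 v
      - (\<Sum>q\<in>nset k. X (N (fst q) (snd q)) * dmonom k (Suc (fst q)) (snd q) v)"
    unfolding e by (simp add: p del: fact_Suc of_nat_Suc power_Suc cong: sum.cong)
      (simp only: times_divide_eq_right[symmetric] f[unfolded One_nat_def times_divide_eq_right[symmetric]])
  show "pd YY (c0 k X) v = - (\<Sum>q\<in>nset k. X (N (fst q) (snd q)) * (real (snd q - 1) * dmonom k (Suc (fst q)) (snd q - 1) v))"
    unfolding e by (simp add: p cong: sum.cong)
qed

lemma c0_mbr:
  assumes "1 \<le> k"
  shows "c0 k (mbr k X Y) v
    = (cA X v * pd XX (c0 k Y) v + cB X v * pd YY (c0 k Y) v - cC k X v * c0 k Y v)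
    - (cA Y v * pd XX (c0 k X) v + cB Y v * pd YY (c0 k X) v - cC k Y v * c0 k X v)"
proof -
  obtain k' where k: "k = Suc k'" using assms by (metis One_nat_def Suc_le_D)
  define xm where "xm = dmonom k 1 1 v"
  define xk where "xk = v XX ^ k / fact k"
  define xn where "xn = v XX ^ (k + 1) / fact (k + 1)"
  have rel: "v XX * xm = real k * xk" "v XX * xk = (real k + 1) * xn"
    using divided_power_mult[of "v XX" k'] divided_power_mult[of "v XX" k]
    by (simp_all add: xm_def xk_def xn_def k dmonom_def del: fact_Suc)
  define T where "T X Y = (\<Sum>q\<in>nset k. Y (N (fst q) (snd q)) * (X (N 1 0) * dmonom k (Suc (fst q)) (snd q) v
        + X (N 0 1) * dmonom k (fst q) (Suc (snd q)) v + gl_dmonom k (\<lambda>r s. X (G r s)) (fst q) (snd q) v))"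
    for X Y :: "gidx \<Rightarrow> real"
  have L: "cA X v * pd XX (c0 k Y) v + cB X v * pd YY (c0 k Y) v - cC k X v * c0 k Y v
      = Y (G 2 1) * (cA X v * xk - cC k X v * xn) - Y (N 0 1) * (cA X v * xm - cC k X v * xk) - T X Y" for X Y
  proof -
    have "T X Y = (\<Sum>q\<in>nset k. Y (N (fst q) (snd q)) * (cA X v * dmonom k (Suc (fst q)) (snd q) v
        + cB X v * (real (snd q - 1) * dmonom k (Suc (fst q)) (snd q - 1) v) - cC k X v * dmonom k (fst q) (snd q) v))"
      unfolding T_def
    proof (rule sum.cong)
      fix q assume "q \<in> nset k"
      then show "Y (N (fst q) (snd q)) * (X (N 1 0) * dmonom k (Suc (fst q)) (snd q) v
          + X (N 0 1) * dmonom k (fst q) (Suc (snd q)) v + gl_dmonom k (\<lambda>r s. X (G r s)) (fst q) (snd q) v)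
          = Y (N (fst q) (snd q)) * (cA X v * dmonom k (Suc (fst q)) (snd q) v
          + cB X v * (real (snd q - 1) * dmonom k (Suc (fst q)) (snd q - 1) v) - cC k X v * dmonom k (fst q) (snd q) v)"
        by (subst action_dmonom) simp_all
    qed simp
    also have "\<dots> = cA X v * (\<Sum>q\<in>nset k. Y (N (fst q) (snd q)) * dmonom k (Suc (fst q)) (snd q) v)
        + cB X v * (\<Sum>q\<in>nset k. Y (N (fst q) (snd q)) * (real (snd q - 1) * dmonom k (Suc (fst q)) (snd q - 1) v))
        - cC k X v * dmonom_sum k Y v"
      unfolding dmonom_sum_def by (simp add: sum.distrib sum_subtractf sum_distrib_left algebra_simps)
    finally show ?thesis
      unfolding pd_c0[OF assms] c0_eq xm_def xk_def xn_def by (simp only: algebra_simps)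
  qed
  \<comment> \<open>These are the contributions of the two leading terms of \<open>c0\<close>. After
    reduction by \<open>rel\<close>, every term containing y is symmetric in X and Y and cancels in
    the antisymmetrised difference.\<close>
  have S: "Y (G 2 1) * (cA X v * xk - cC k X v * xn) - Y (N 0 1) * (cA X v * xm - cC k X v * xk)
      = Y (G 2 1) * (X (N 1 0) * xk + X (N 0 1) * (v YY * xk) + (X (G 2 2) - X (G 1 1)) * xn - 2 * X (G 2 1) * (v YY * xn))
      - Y (N 0 1) * (X (N 1 0) * xm + X (N 0 1) * (v YY * xm) + X (G 2 2) * xk - X (G 2 1) * (v YY * xk))" for X Y
  proof -
    have "cA X v * xk - cC k X v * xn = X (N 1 0) * xk + X (N 0 1) * (v YY * xk) - X (G 1 1) * (v XX * xk)
        - X (G 2 1) * (v YY * (v XX * xk)) + (real k * X (G 1 1) + X (G 2 2)) * xn + (real k - 1) * X (G 2 1) * (v YY * xn)"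
      by (simp add: cA_def cC_def algebra_simps)
    then have 1: "cA X v * xk - cC k X v * xn = X (N 1 0) * xk + X (N 0 1) * (v YY * xk)
        + (X (G 2 2) - X (G 1 1)) * xn - 2 * X (G 2 1) * (v YY * xn)"
      unfolding rel by (simp add: algebra_simps)
    have "cA X v * xm - cC k X v * xk = X (N 1 0) * xm + X (N 0 1) * (v YY * xm) - X (G 1 1) * (v XX * xm)
        - X (G 2 1) * (v YY * (v XX * xm)) + (real k * X (G 1 1) + X (G 2 2)) * xk + (real k - 1) * X (G 2 1) * (v YY * xk)"
      by (simp add: cA_def cC_def algebra_simps)
    then have 2: "cA X v * xm - cC k X v * xk = X (N 1 0) * xm + X (N 0 1) * (v YY * xm) + X (G 2 2) * xk - X (G 2 1) * (v YY * xk)"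
      unfolding rel by (simp add: algebra_simps)
    show ?thesis unfolding 1 2 ..
  qed
  have "dmonom_sum k (mbr k X Y) v = (X (N 1 0) * Y (N 0 1) - X (N 0 1) * Y (N 1 0)) * xm + T X Y - T Y X"
    unfolding dmonom_sum_mbr[OF assms] T_def xm_def ..
  then show ?thesis
    unfolding L S c0_eq[of k "mbr k X Y"] mbr_g1 mbr_gl xk_def[symmetric] xn_def[symmetric] by (simp add: algebra_simps)
qed

lemma pd_coeffs [simp]:
  "pd XX (cA X) = cAx X" "pd YY (cA X) = cAy X" "pd XX (cB X) = (\<lambda>v. 0)" "pd YY (cB X) = cBy X"
  "pd XX (cC k X) = (\<lambda>v. 0)" "pd YY (cC k X) = (\<lambda>v. - ((real k - 1) * X (G 2 1)))"
  by (simp_all add: cA_def[abs_def] cAx_def[abs_def] cAy_def[abs_def] cB_def[abs_def] cBy_def[abs_def]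
      cC_def[abs_def] fun_eq_iff algebra_simps)

lemma pd_genfun_base:
  "pd XX (genfun k X) v = - (cAx X v * v pp) + pd XX (c0 k X) v"
  "pd YY (genfun k X) v = - (cAy X v * v pp) - cBy X v * v qq - (real k - 1) * X (G 2 1) * v uu + pd YY (c0 k X) v"
  "pd uu (genfun k X) v = cC k X v"
proof -
  have z: "pd uu (cA X) = (\<lambda>v. 0)" "pd uu (cB X) = (\<lambda>v. 0)" "pd uu (cC k X) = (\<lambda>v. 0)" "pd uu (c0 k X) = (\<lambda>v. 0)"
    by (rule pd_eq_0[of "{XX, YY}"]; simp)+
  show "pd XX (genfun k X) v = - (cAx X v * v pp) + pd XX (c0 k X) v"
    "pd YY (genfun k X) v = - (cAy X v * v pp) - cBy X v * v qq - (real k - 1) * X (G 2 1) * v uu + pd YY (c0 k X) v"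
    "pd uu (genfun k X) v = cC k X v"
    unfolding genfun_def[abs_def] by (simp_all add: z)
qed

text \<open>Both sides are affine in p, q and u, so the identity splits into one for each of A, B, C
  and the remaining function of x and y.\<close>

lemma lagrange_bracket_genfun:
  assumes "1 \<le> k"
  shows "lagrange_bracket (genfun k X) (genfun k Y) = genfun k (mbr k X Y)"
proof
  fix v
  have A: "cA (mbr k X Y) v = cA X v * cAx Y v + cB X v * cAy Y v - cAx X v * cA Y v - cAy X v * cB Y v"
    unfolding cA_def mbr_g1 mbr_gl by (simp add: cAx_def cAy_def cB_def algebra_simps)
  have B: "cB (mbr k X Y) v = cB X v * cBy Y v - cBy X v * cB Y v"
    unfolding cB_def mbr_g1 mbr_gl by (simp add: cBy_def algebra_simps)
  have C: "cC k (mbr k X Y) v = - (cB X v * ((real k - 1) * Y (G 2 1))) + cB Y v * ((real k - 1) * X (G 2 1))"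
    unfolding cC_def mbr_g1 mbr_gl by (simp add: cB_def algebra_simps)
  show "lagrange_bracket (genfun k X) (genfun k Y) v = genfun k (mbr k X Y) v"
    unfolding genfun_def[of k "mbr k X Y"] A B C c0_mbr[OF assms]
    by (simp add: lagrange_bracket_def pd_genfun pd_genfun_base, simp add: genfun_def algebra_simps)
qed

section \<open>All symmetries are explicit\<close>

lemma depends_only_drop:
  assumes F: "smooth F" "depends_only S F" and 0: "pd c F = (\<lambda>v. 0)"
  shows "depends_only (S - {c}) F"
  unfolding depends_only_def
proof (intro allI impI)
  fix v w :: jpt assume vw: "\<forall>d\<in>S - {c}. v d = w d"
  have "((\<lambda>t. F (v(c := t))) has_real_derivative 0) (at t)" for t
    using part_diff_DERIV[OF smooth_part_diff[OF F(1)], of v c t] by (simp add: 0)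
  then have "F (v(c := v c)) = F (v(c := w c))" using DERIV_isconst_all by blast
  also have "\<dots> = F w" by (rule depends_onlyD[OF F(2)]) (use vw in auto)
  finally show "F v = F w" by simp
qed

lemma constant_function:
  assumes "smooth F" "depends_only {XX, YY} F" "pd XX F = (\<lambda>v. 0)" "pd YY F = (\<lambda>v. 0)"
  obtains a where "F = (\<lambda>v. a)"
proof -
  have "depends_only ({XX, YY} - {XX} - {YY}) F"
    by (intro depends_only_drop assms)
  then have "depends_only {} F" by (simp add: insert_Diff_if)
  then have "F v = F (\<lambda>_. 0)" for v by (rule depends_onlyD) auto
  then show thesis using that[of "F (\<lambda>_. 0)"] by (simp add: fun_eq_iff)
qed

lemma depends_base:
  assumes "smooth F" "depends_only (jets 1) F" "pd uu F = (\<lambda>v. 0)" "pd pp F = (\<lambda>v. 0)" "pd qq F = (\<lambda>v. 0)"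
  shows "depends_only {XX, YY} F"
proof -
  have "depends_only (jets 1 - {uu} - {pp} - {qq}) F"
    by (intro depends_only_drop assms)
  moreover have "jets 1 - {uu} - {pp} - {qq} = {XX, YY}"
    unfolding J1_eq_jets[symmetric] by (auto simp: J1_def)
  ultimately show ?thesis by simp
qed

text \<open>Identities known only at truncated jets may be differentiated along coordinates whose
  variation preserves the truncation.\<close>

lemma pd_cong_along:
  "(\<And>t. F (w(c := t)) = H (w(c := t))) \<Longrightarrow> pd c F w = pd c H w"
  by (simp add: pd_def)

lemma total_deriv_base:
  "depends_only {XX, YY} F \<Longrightarrow> total_deriv M a b F = base_deriv a b F"
proof (induction a b rule: total_deriv_induct)
  case (y b) then show ?case by (simp add: total_deriv_Suc_y base_deriv_Suc_y D_base_function depends_base_deriv)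
next
  case (x a b) then show ?case by (simp add: total_deriv_Suc_x base_deriv_Suc_x D_base_function depends_base_deriv)
qed simp

section \<open>Coefficients one order below the top\<close>

text \<open>The factors are the binomials n + 1 over 1 and n + 1 over 2, accumulated because each
  commutation of a partial derivative with \<open>Dx\<close> contributes one lower
  coefficient.\<close>

lemma pd_total_deriv_order_pred_x:
  assumes Q: "smooth Q" "depends_only (jets 1) Q"
  shows "n \<le> M \<Longrightarrow> pd (UU n 0) (total_deriv M (Suc n) 0 Q) = (\<lambda>v. real (Suc n) * Dx M (pd uu Q) v
    + real n * real (Suc n) / 2 * Dx M (Dx M (pd pp Q)) v)"
proof (induction n)
  case 0 show ?case by (simp add: total_deriv_Suc_x pd_Dx Q)
next
  case (Suc n)
  have "pd (UU (Suc n) 0) (total_deriv M (Suc (Suc n)) 0 Q)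
      = (\<lambda>v. Dx M (pd (UU (Suc n) 0) (total_deriv M (Suc n) 0 Q)) v + pd (UU n 0) (total_deriv M (Suc n) 0 Q) v)"
    using Suc.prems by (subst total_deriv_Suc_x) (simp add: pd_Dx Q)
  also have "pd (UU (Suc n) 0) (total_deriv M (Suc n) 0 Q) = (\<lambda>v. pd uu Q v + real (Suc n) * Dx M (pd pp Q) v)"
    using Suc.prems pd_total_deriv_order_eq[OF Q, of "Suc n" 0 M "Suc n" 0] by simp
  finally show ?case
    using Suc by (simp add: Q fun_eq_iff) (simp add: field_simps)
qed

lemma pd_total_deriv_order_pred_y:
  assumes Q: "smooth Q" "depends_only (jets 1) Q"
  shows "n \<le> M \<Longrightarrow> pd (UU 0 n) (total_deriv M 0 (Suc n) Q) = (\<lambda>v. real (Suc n) * Dy M (pd uu Q) v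
    + real n * real (Suc n) / 2 * Dy M (Dy M (pd qq Q)) v)"
proof (induction n)
  case 0 show ?case by (simp add: total_deriv_Suc_y pd_Dy Q)
next
  case (Suc n)
  have "pd (UU 0 (Suc n)) (total_deriv M 0 (Suc (Suc n)) Q)
      = (\<lambda>v. Dy M (pd (UU 0 (Suc n)) (total_deriv M 0 (Suc n) Q)) v + pd (UU 0 n) (total_deriv M 0 (Suc n) Q) v)"
    using Suc.prems by (subst total_deriv_Suc_y) (simp add: pd_Dy Q)
  also have "pd (UU 0 (Suc n)) (total_deriv M 0 (Suc n) Q) = (\<lambda>v. pd uu Q v + real (Suc n) * Dy M (pd qq Q) v)"
    using Suc.prems pd_total_deriv_order_eq[OF Q, of 0 "Suc n" M 0 "Suc n"] by simp
  finally show ?case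
    using Suc by (simp add: Q fun_eq_iff) (simp add: field_simps)
qed

text \<open>The coordinate has one x-index while all total derivatives are along y, so only Q_p
  contributes, with factor n + 2 over 2.\<close>

lemma pd_total_deriv_order_pred_yx:
  assumes Q: "smooth Q" "depends_only (jets 1) Q"
  shows "Suc n \<le> M \<Longrightarrow> pd (UU 1 n) (total_deriv M 0 (Suc (Suc n)) Q) =
    (\<lambda>v. real (Suc n) * real (Suc (Suc n)) / 2 * Dy M (Dy M (pd pp Q)) v)"
proof (induction n)
  case 0
  have "pd (UU 1 0) (total_deriv M 0 (Suc 0) Q) = (\<lambda>v. Dy M (pd pp Q) v)"
    using 0 pd_total_deriv_order_eq[OF Q, of 0 1 M 1 0] by simp
  then show ?case using Q by (simp add: total_deriv_Suc_y[of M "Suc 0"] pd_Dy)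
next
  case (Suc n)
  have "pd (UU 1 (Suc n)) (total_deriv M 0 (Suc (Suc (Suc n))) Q)
      = (\<lambda>v. Dy M (pd (UU 1 (Suc n)) (total_deriv M 0 (Suc (Suc n)) Q)) v + pd (UU 1 n) (total_deriv M 0 (Suc (Suc n)) Q) v)"
    using Suc.prems by (subst total_deriv_Suc_y) (simp add: pd_Dy Q)
  also have "pd (UU 1 (Suc n)) (total_deriv M 0 (Suc (Suc n)) Q) = (\<lambda>v. real (Suc (Suc n)) * Dy M (pd pp Q) v)"
    using Suc.prems pd_total_deriv_order_eq[OF Q, of 0 "Suc (Suc n)" M 1 "Suc n"] by simp
  finally show ?case
    using Suc by (simp add: Q fun_eq_iff) (simp add: field_simps)
qed

text \<open>Commuting partial derivatives past \<open>Dx\<close> expresses each one through the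
  partial derivative with raised x-index. Those of order 2 vanish, hence R_p and R_q do, then R_u,
  and finally \<open>Dx M R\<close> is just R_x.\<close>

lemma Dx_zero_imp:
  assumes R: "smooth R" and 0: "Dx M R = (\<lambda>v. 0)" and M: "1 \<le> M"
    and dep: "depends_only (jets 1) R"
  shows "pd uu R = (\<lambda>v. 0)" "pd pp R = (\<lambda>v. 0)" "pd qq R = (\<lambda>v. 0)" "pd XX R = (\<lambda>v. 0)"
proof -
  have high: "pd (UU i j) R = (\<lambda>v. 0)" if "1 < i + j" for i j
    by (rule pd_eq_0[OF dep]) (use that in simp)
  have "pd (UU (Suc i) j) (Dx M R) = (\<lambda>v. 0)" for i j by (simp add: 0)
  then have step: "pd (UU i j) R v = - Dx M (pd (UU (Suc i) j) R) v" if "i + j \<le> M" for i j v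
    using pd_Dx(4)[OF R that] by (metis add_eq_0_iff)
  show p: "pd pp R = (\<lambda>v. 0)" and q: "pd qq R = (\<lambda>v. 0)"
    using step[of "Suc 0" 0] step[of 0 "Suc 0"] M by (auto simp: high fun_eq_iff)
  show u: "pd uu R = (\<lambda>v. 0)"
    using step[of 0 0] by (auto simp: p fun_eq_iff)
  have "Dx M R = pd XX R" by (rule D_base_function depends_base R dep u p q)+
  then show "pd XX R = (\<lambda>v. 0)" using 0 by simp
qed

section \<open>Polynomials recovered by Taylor expansion\<close>

lemma Taylor_coord:
  assumes F: "smooth F" and 0: "(pd c ^^ n) F = (\<lambda>v. 0)"
  shows "F v = (\<Sum>m<n. (pd c ^^ m) F (v(c := 0)) / fact m * v c ^ m)"
proof -
  have s: "smooth ((pd c ^^ m) F)" for m by (induction m) (auto simp: F)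
  have "\<exists>t. \<bar>t\<bar> \<le> \<bar>v c\<bar> \<and> F (v(c := v c)) = (\<Sum>m<n. ((pd c ^^ m) F (v(c := 0)) / fact m) * v c ^ m)
      + ((pd c ^^ n) F (v(c := t)) / fact n) * v c ^ n"
    by (rule Maclaurin_all_le[where diff = "\<lambda>m t. (pd c ^^ m) F (v(c := t))" and f = "\<lambda>t. F (v(c := t))"])
      (use part_diff_DERIV[OF smooth_part_diff[OF s]] in auto)
  then show ?thesis by (simp add: 0)
qed

text \<open>The expansion in y has coefficients depending on x; that of y^b is expanded to order k -
  b, where its remainder is a derivative of total order k.\<close>

lemma Taylor_plane:
  assumes F: "smooth F" "depends_only {XX, YY} F" and 0: "\<And>a b. a + b = k \<Longrightarrow> base_deriv a b F = (\<lambda>v. 0)"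
  shows "F v = (\<Sum>b<k. \<Sum>a<k - b. base_deriv a b F (\<lambda>_. 0) / (fact a * fact b) * v XX ^ a * v YY ^ b)"
proof -
  have bdy: "(pd YY ^^ b) F = base_deriv 0 b F" for b by (simp add: base_deriv_def)
  have bdx: "(pd XX ^^ a) (base_deriv 0 b F) = base_deriv a b F" for a b by (simp add: base_deriv_def)
  have "F v = (\<Sum>b<k. base_deriv 0 b F (v(YY := 0)) / fact b * v YY ^ b)"
    using Taylor_coord[OF F(1), where c = YY and n = k and v = v] 0[of 0 k] unfolding bdy by simp
  also have "\<dots> = (\<Sum>b<k. (\<Sum>a<k - b. base_deriv a b F (\<lambda>_. 0) / fact a * v XX ^ a) / fact b * v YY ^ b)"
  proof (rule sum.cong)
    fix b assume b: "b \<in> {..<k}"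
    have "base_deriv a b F (v(YY := 0, XX := 0)) = base_deriv a b F (\<lambda>_. 0)" for a
      by (rule depends_onlyD[OF depends_base_deriv[OF F(2)]]) auto
    then have "base_deriv 0 b F (v(YY := 0)) = (\<Sum>a<k - b. base_deriv a b F (\<lambda>_. 0) / fact a * v XX ^ a)"
      using Taylor_coord[OF smooth_base_deriv[OF F(1), where a = 0 and b = b], where c = XX and n = "k - b" and v = "v(YY := 0)"] b 0[of "k - b" b]
      unfolding bdx by simp
    then show "base_deriv 0 b F (v(YY := 0)) / fact b * v YY ^ b
        = (\<Sum>a<k - b. base_deriv a b F (\<lambda>_. 0) / fact a * v XX ^ a) / fact b * v YY ^ b" by simp
  qed simp
  also have "\<dots> = (\<Sum>b<k. \<Sum>a<k - b. base_deriv a b F (\<lambda>_. 0) / (fact a * fact b) * v XX ^ a * v YY ^ b)"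
    by (simp add: sum_divide_distrib sum_distrib_right)
  finally show ?thesis .
qed

text \<open>The exponents correspond by a = k + 1 - i - j and b = j - 1. Only (j - 1)! is divided
  out of the coefficient since \<open>dmonom\<close> already contains 1/a!.\<close>

lemma polynomial_eq_dmonom_sum:
  assumes X: "\<And>i j. (i, j) \<in> nset k \<Longrightarrow> X (N i j) = - base_deriv (k + 1 - i - j) (j - 1) F (\<lambda>_. 0) / fact (j - 1)"
  shows "(\<Sum>b<k. \<Sum>a<k - b. base_deriv a b F (\<lambda>_. 0) / (fact a * fact b) * v XX ^ a * v YY ^ b) = - dmonom_sum k X v"
proof -
  have "(\<Sum>b<k. \<Sum>a<k - b. base_deriv a b F (\<lambda>_. 0) / (fact a * fact b) * v XX ^ a * v YY ^ b)
      = (\<Sum>(b,a)\<in>Sigma {..<k} (\<lambda>b. {..<k - b}). base_deriv a b F (\<lambda>_. 0) / (fact a * fact b) * v XX ^ a * v YY ^ b)"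
    by (simp add: sum.Sigma)
  also have "\<dots> = (\<Sum>q\<in>nset k. - (X (N (fst q) (snd q)) * dmonom k (fst q) (snd q) v))"
  proof (rule sum.reindex_bij_witness[of _ "\<lambda>q. (snd q - 1, k + 1 - fst q - snd q)" "\<lambda>p. (k - snd p - fst p, fst p + 1)"])
    fix p assume "p \<in> Sigma {..<k} (\<lambda>b. {..<k - b})"
    then obtain a b where p: "p = (b, a)" "a + b < k" by auto
    then have "(k - a - b, Suc b) \<in> nset k" "k + 1 - (k - a - b) - Suc b = a" "k - a - b + Suc b \<le> k + 1" by (auto simp: nset_def)
    then show "- (X (N (fst (k - snd p - fst p, fst p + 1)) (snd (k - snd p - fst p, fst p + 1)))
        * dmonom k (fst (k - snd p - fst p, fst p + 1)) (snd (k - snd p - fst p, fst p + 1)) v)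
      = (case p of (b, a) \<Rightarrow> base_deriv a b F (\<lambda>_. 0) / (fact a * fact b) * v XX ^ a * v YY ^ b)"
      using X[of "k - a - b" "Suc b"] by (simp add: p(1) dmonom_def mult_ac)
  qed (auto simp: nset_def)
  finally show ?thesis by (simp add: dmonom_sum_def sum_negf)
qed

lemma contact_syms_diff:
  assumes "smooth Q" "smooth R" "contact_vf Q \<in> contact_syms k m" "contact_vf R \<in> contact_syms k m"
  shows "contact_vf (\<lambda>v. Q v - R v) \<in> contact_syms k m"
proof -
  have e: "(\<lambda>v. Q v - R v) = (\<lambda>v. 1 * Q v + (- 1) * R v)" by simp
  have p: "prol k (contact_vf (\<lambda>v. Q v - R v)) a b w = prol k (contact_vf Q) a b w - prol k (contact_vf R) a b w" for a b w
    unfolding e by (subst prol_contact_vf_lin[OF assms(1,2)]) simp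
  have "depends_only J1 Q" "depends_only J1 R"
    using assms(3,4) unfolding contact_syms_def contact_field_iff by (auto simp: contact_vf_inject)
  then have "contact_field (contact_vf (\<lambda>v. Q v - R v))"
    unfolding contact_field_iff using assms(1,2) by (intro exI[of _ "\<lambda>v. Q v - R v"]) simp
  moreover have "\<exists>a bb. \<forall>i\<le>k. prol k (contact_vf (\<lambda>v. Q v - R v)) (k - i) i w
      = a * dPl m i l z + (\<Sum>j = 1..m. bb j * dPz m i j l z)"
    if w: "on_system k m l z w \<and> regular_par k m l z" for l z w
  proof -
    obtain a bb where 1: "\<And>i. i \<le> k \<Longrightarrow> prol k (contact_vf Q) (k - i) i w = a * dPl m i l z + (\<Sum>j = 1..m. bb j * dPz m i j l z)"
      using assms(3) w unfolding contact_syms_def by blast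
    obtain a' bb' where 2: "\<And>i. i \<le> k \<Longrightarrow> prol k (contact_vf R) (k - i) i w = a' * dPl m i l z + (\<Sum>j = 1..m. bb' j * dPz m i j l z)"
      using assms(4) w unfolding contact_syms_def by blast
    show ?thesis
      by (intro exI[of _ "a - a'"] exI[of _ "\<lambda>j. bb j - bb' j"])
        (simp add: p 1 2 algebra_simps sum_subtractf)
  qed
  ultimately show ?thesis unfolding contact_syms_def by blast
qed

lemma genfun_cong: "(\<And>e. e \<in> Iset k \<Longrightarrow> X e = Y e) \<Longrightarrow> genfun k X = genfun k Y"
proof -
  assume e: "\<And>e. e \<in> Iset k \<Longrightarrow> X e = Y e"
  have "X (N (Suc 0) 0) = Y (N (Suc 0) 0)" "X (N 0 (Suc 0)) = Y (N 0 (Suc 0))"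
    "X (G 1 1) = Y (G 1 1)" "X (G 1 2) = Y (G 1 2)" "X (G 2 1) = Y (G 2 1)" "X (G 2 2) = Y (G 2 2)"
    by (auto intro!: e simp: Iset_def nidx_def)
  moreover have "X (N (fst q) (snd q)) = Y (N (fst q) (snd q))" if "q \<in> nset k" for q
    using nsetD[OF that] by (intro e) (auto simp: Iset_def nidx_def)
  ultimately show ?thesis
    by (simp add: fun_eq_iff genfun_def cA_def cB_def cC_def c0_def)
qed

lemma symmetry_imp_genfun:
  assumes k: "2 < k" and m: "m < k" and V: "V \<in> contact_syms k m"
  shows "\<exists>X. V = contact_vf (genfun k X)"
proof -
  define M where "M = Suc k"
  obtain Q where Q: "smooth Q" "depends_only (jets 1) Q" and VQ: "V = contact_vf Q"
    using V unfolding contact_syms_def contact_field_iff J1_eq_jets by auto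
  define S where "S = pd pp Q"
  define R where "R = pd qq Q"
  define U where "U = pd uu Q"
  have smooth: "smooth S" "smooth R" "smooth U" by (simp_all add: S_def R_def U_def Q)
  have dep: "depends_only (jets 1) S" "depends_only (jets 1) R" "depends_only (jets 1) U"
    by (simp_all only: S_def R_def U_def depends_only_pd Q)
  \<comment> \<open>Truncation supplies the points at which the pointwise conditions are known.
    Functions on jets of order 2 do not notice it because k > 2, so conditions on them hold
    everywhere.\<close>
  define tr :: "jpt \<Rightarrow> jpt" where "tr w = (\<lambda>d. case d of UU a b \<Rightarrow> if k \<le> a + b then 0 else w d | _ \<Rightarrow> w d)" for w
  have tr0: "k \<le> a + b \<Longrightarrow> tr w (UU a b) = 0" for a b w by (simp add: tr_def)
  note pw = symmetry_pointwise[OF Q k m V[unfolded VQ], where w = "tr w" for w, OF tr0, folded M_def]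
  have trF: "F (tr w) = F w" if "depends_only (jets 2) F" for F w
    by (rule depends_onlyD[OF that]) (use k in \<open>auto simp: tr_def jets_def\<close>)
  have trb: "F (tr w) = F w" if "depends_only {XX, YY} F" for F w
    by (rule depends_onlyD[OF that]) (auto simp: tr_def)
  have trup: "(tr w)(UU a b := t) = tr (w(UU a b := t))" if "a + b < k" for w a b t
    using that by (auto simp: tr_def fun_eq_iff split: jvar.split)
  have DxR: "Dx M R = (\<lambda>v. 0)"
    using pw(1) trF[OF depends_Dx_pd[OF Q(2)]] by (simp add: fun_eq_iff R_def)
  have "1 \<le> M" by (simp add: M_def)
  note R0 = Dx_zero_imp[OF smooth(2) DxR this dep(2)]
  define E where "E = (\<lambda>w. U w + real (k + 1) * Dx M S w - Dy M R w)"
  have dU2: "depends_only (jets 2) U" by (rule depends_only_mono[OF dep(3) jets_mono]) simp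
  have "depends_only (jets 2) E"
    unfolding E_def using depends_Dx_pd[OF Q(2)] depends_Dy_pd[OF Q(2)] dU2 by (simp add: S_def R_def)
  from trF[OF this] pw(2) have E0: "E = (\<lambda>v. 0)"
    by (simp add: fun_eq_iff E_def S_def R_def U_def)
  \<comment> \<open>The coordinate \<open>UU 2 0\<close> enters E only through
    \<open>Dx M S\<close>, with coefficient (k+1) S_p.\<close>
  have Spp: "pd pp S = (\<lambda>v. 0)"
  proof
    fix v
    have h: "pd (UU 2 0) U = (\<lambda>v. 0)" "pd (UU 2 0) S = (\<lambda>v. 0)" "pd (UU 2 0) R = (\<lambda>v. 0)"
      using dep by (auto intro: pd_eq_0)
    have "pd (UU 2 0) (Dx M S) = (\<lambda>v. Dx M (pd (UU 2 0) S) v + pd pp S v)"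
      using pd_Dx(4)[OF smooth(1), of 1 0 M] k by (simp add: M_def numeral_2_eq_2)
    then have "pd (UU 2 0) E v = real (k + 1) * pd pp S v"
      unfolding E_def by (simp add: smooth h pd_Dy)
    then show "pd pp S v = 0" unfolding E0 by simp
  qed
  have Sqq: "pd qq S = (\<lambda>v. 0)"
    using R0(2) pd_commute[OF Q(1), of qq pp] by (simp add: S_def R_def)
  have "pd uu S = (\<lambda>v. 0)"
  proof
    fix v
    have "pd pp U = pd uu S" by (simp add: U_def S_def pd_commute[OF Q(1), of pp])
    moreover have "pd pp (Dx M S) = (\<lambda>v. Dx M (pd pp S) v + pd uu S v)"
      using pd_Dx(4)[OF smooth(1), of 0 0 M] by simp
    \<comment> \<open>The term \<open>Dx M S\<close> contributes k + 1, and U_p = S_u contributes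
      the remaining 1.\<close>
    ultimately have "pd pp E v = real (k + 2) * pd uu S v"
      unfolding E_def by (simp add: smooth Spp R0 pd_Dy) (simp add: algebra_simps)
    then show "pd uu S v = 0" unfolding E0 by simp
  qed
  note S0 = this Spp Sqq
  have bS: "depends_only {XX, YY} S" by (rule depends_base[OF smooth(1) dep(1) S0])
  have bR: "depends_only {XX, YY} R" by (rule depends_base[OF smooth(2) dep(2) R0(1-3)])
  have U_eq: "U = (\<lambda>v. pd YY R v - real (k + 1) * pd XX S v)"
    using E0 unfolding E_def by (simp add: D_base_function bS bR fun_eq_iff) (simp add: algebra_simps)
  have bU: "depends_only {XX, YY} U" unfolding U_eq by (simp add: bS bR)
  obtain n where n: "k = Suc (Suc n)" "1 \<le> n" using k by (metis Suc_lessE Suc_leI numeral_2_eq_2 One_nat_def)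
  have Uy: "pd YY U = (\<lambda>v. pd YY (pd YY R) v - real (k + 1) * pd XX (pd YY S) v)"
    unfolding U_eq by (simp add: smooth pd_commute[OF smooth(1), of YY])
  have Ux: "pd XX U = (\<lambda>v. - (real (k + 1) * pd XX (pd XX S) v))"
    unfolding U_eq using R0(4) by (simp add: smooth pd_commute[OF smooth(2), of XX])
  \<comment> \<open>Coefficient of u_(k-1,0) in D_x^k Q = D_y S, whose right side depends on x and y
    only. With U_x = -(k+1) S_xx it equals -k(k+3)/2 times S_xx.\<close>
  have Sxx: "pd XX (pd XX S) = (\<lambda>v. 0)"
  proof
    fix w
    have "pd (UU (Suc n) 0) (total_deriv M k 0 Q) (tr w) = pd (UU (Suc n) 0) (Dy M S) (tr w)"
      by (rule pd_cong_along) (simp add: trup n(1) pw(3)[unfolded n(1)] S_def)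
    also have "\<dots> = 0"
      using pd_eq_0[OF depends_only_pd[OF bS, of YY], of "UU (Suc n) 0"] by (simp add: D_base_function bS)
    also have "pd (UU (Suc n) 0) (total_deriv M k 0 Q) = (\<lambda>v. real k * pd XX U v + real (k - 1) * real k / 2 * pd XX (pd XX S) v)"
      using pd_total_deriv_order_pred_x[OF Q, of "Suc n" M] n
      by (simp add: M_def S_def[symmetric] U_def[symmetric] D_base_function bS bU)
    finally have "real k * (real k + 3) / 2 * pd XX (pd XX S) (tr w) = 0"
      unfolding Ux using n by (simp add: field_simps)
    then have "pd XX (pd XX S) (tr w) = 0" using n by simp
    then show "pd XX (pd XX S) w = 0" using trb[of "pd XX (pd XX S)"] bS by simp
  qed
  \<comment> \<open>Coefficient of u_(1,k-2) in D_y^k Q = 0.\<close>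
  have Syy: "pd YY (pd YY S) = (\<lambda>v. 0)"
  proof
    fix w
    have "pd (UU 1 n) (total_deriv M 0 k Q) (tr w) = pd (UU 1 n) (\<lambda>_. 0) (tr w)"
      using pw(4)[where i = k] k by (intro pd_cong_along) (simp add: trup n(1))
    also have "\<dots> = 0" by simp
    also have "pd (UU 1 n) (total_deriv M 0 k Q) = (\<lambda>v. real (k - 1) * real k / 2 * pd YY (pd YY S) v)"
      using pd_total_deriv_order_pred_yx[OF Q, of n M] n
      by (simp add: M_def S_def[symmetric] D_base_function bS)
    finally have "pd YY (pd YY S) (tr w) = 0" using n by simp
    then show "pd YY (pd YY S) w = 0" using trb[of "pd YY (pd YY S)"] bS by simp
  qed
  \<comment> \<open>Coefficient of u_(0,k-1) in D_y^k Q = 0; inserting U_y gives k(k+1)/2 times R_yy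
    - 2 S_xy.\<close>
  have Ryy: "pd YY (pd YY R) = (\<lambda>v. 2 * pd XX (pd YY S) v)"
  proof
    fix w
    have "pd (UU 0 (Suc n)) (total_deriv M 0 k Q) (tr w) = pd (UU 0 (Suc n)) (\<lambda>_. 0) (tr w)"
      using pw(4)[where i = k] k by (intro pd_cong_along) (simp add: trup n(1))
    also have "\<dots> = 0" by simp
    also have "pd (UU 0 (Suc n)) (total_deriv M 0 k Q) = (\<lambda>v. real k * pd YY U v + real (k - 1) * real k / 2 * pd YY (pd YY R) v)"
      using pd_total_deriv_order_pred_y[OF Q, of "Suc n" M] n
      by (simp add: M_def R_def[symmetric] U_def[symmetric] D_base_function bR bU)
    finally have "real k * (real k + 1) / 2 * (pd YY (pd YY R) (tr w) - 2 * pd XX (pd YY S) (tr w)) = 0"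
      unfolding Uy using n by (simp add: field_simps)
    then have "pd YY (pd YY R) (tr w) - 2 * pd XX (pd YY S) (tr w) = 0" using n by simp
    then show "pd YY (pd YY R) w = 2 * pd XX (pd YY S) w"
      using trb[of "pd YY (pd YY R)" w] trb[of "pd XX (pd YY S)" w] bR bS by simp
  qed
  have Sc: "pd YY (pd XX S) = pd XX (pd YY S)" by (rule pd_commute[OF smooth(1)])
  have "pd XX (pd XX (pd YY S)) = (\<lambda>v. 0)"
    using Sxx Sc pd_commute[of "pd XX S" XX YY] smooth(1) by simp
  moreover have "pd YY (pd XX (pd YY S)) = (\<lambda>v. 0)"
    using Syy pd_commute[of "pd YY S" YY XX] smooth(1) by simp
  ultimately obtain s3 where s3: "pd XX (pd YY S) = (\<lambda>v. s3)"
    using constant_function[of "pd XX (pd YY S)"] smooth bS by (metis depends_only_pd smooth_pd)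
  obtain s1 where "(\<lambda>v. pd XX S v - s3 * v YY) = (\<lambda>v. s1)"
    by (rule constant_function[of "\<lambda>v. pd XX S v - s3 * v YY"]) (simp_all add: smooth bS Sxx Sc s3)
  then have Sx: "pd XX S = (\<lambda>v. s1 + s3 * v YY)" by (simp add: fun_eq_iff algebra_simps)
  obtain s2 where "(\<lambda>v. pd YY S v - s3 * v XX) = (\<lambda>v. s2)"
    by (rule constant_function[of "\<lambda>v. pd YY S v - s3 * v XX"]) (simp_all add: smooth bS Syy Sc s3)
  then have Sy: "pd YY S = (\<lambda>v. s2 + s3 * v XX)" by (simp add: fun_eq_iff algebra_simps)
  obtain s0 where "(\<lambda>v. S v - s1 * v XX - s2 * v YY - s3 * v XX * v YY) = (\<lambda>v. s0)"
    by (rule constant_function[of "\<lambda>v. S v - s1 * v XX - s2 * v YY - s3 * v XX * v YY"]) (simp_all add: smooth bS Sx Sy)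
  then have S: "S = (\<lambda>v. s0 + s1 * v XX + s2 * v YY + s3 * v XX * v YY)" by (simp add: fun_eq_iff algebra_simps)
  have Rx: "pd XX (pd YY R) = (\<lambda>v. 0)"
    using R0(4) by (simp add: pd_commute[OF smooth(2), of XX])
  obtain b1 where "(\<lambda>v. pd YY R v - 2 * s3 * v YY) = (\<lambda>v. b1)"
    by (rule constant_function[of "\<lambda>v. pd YY R v - 2 * s3 * v YY"]) (simp_all add: smooth bR Ryy Rx s3)
  then have Ry: "pd YY R = (\<lambda>v. b1 + 2 * s3 * v YY)" by (simp add: fun_eq_iff algebra_simps)
  obtain b0 where "(\<lambda>v. R v - b1 * v YY - s3 * (v YY * v YY)) = (\<lambda>v. b0)"
    by (rule constant_function[of "\<lambda>v. R v - b1 * v YY - s3 * (v YY * v YY)"])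
      (simp_all add: smooth bR Ry R0)
  then have R: "R = (\<lambda>v. b0 + b1 * v YY + s3 * (v YY * v YY))" by (simp add: fun_eq_iff algebra_simps)
  \<comment> \<open>Read off from Q_p = -A and Q_q = -B by comparing coefficients with
    \<open>cA\<close> and \<open>cB\<close>; \<open>U_eq\<close> then makes Q_u agree as
    well.\<close>
  define X1 where "X1 = (\<lambda>e. if e = N 1 0 then - s0 else if e = N 0 1 then - s2 else if e = G 1 1 then s1
    else if e = G 2 1 then s3 else if e = G 1 2 then - b0 else if e = G 2 2 then s1 - b1 else 0)"
  define F where "F = (\<lambda>v. Q v - genfun k X1 v)"
  have F: "smooth F" "depends_only (jets 1) F"
    using Q depends_genfun[of k X1, unfolded J1_eq_jets] by (simp_all add: F_def)
  have "pd pp F v = 0" "pd qq F v = 0" "pd uu F v = 0" for v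
  proof -
    show "pd pp F v = 0" using S by (simp add: F_def Q pd_genfun S_def[symmetric] cA_def X1_def)
    show "pd qq F v = 0" using R by (simp add: F_def Q pd_genfun R_def[symmetric] cB_def X1_def)
    show "pd uu F v = 0" using U_eq by (simp add: F_def Q pd_genfun_base U_def[symmetric] Sx Ry cC_def X1_def algebra_simps)
  qed
  then have F0: "pd uu F = (\<lambda>v. 0)" "pd pp F = (\<lambda>v. 0)" "pd qq F = (\<lambda>v. 0)" by auto
  have bF: "depends_only {XX, YY} F" by (rule depends_base[OF F F0])
  \<comment> \<open>Symmetries form a linear space, so the pointwise conditions apply again to the
    remainder F. As F_p = 0, they say that all its derivatives of order k vanish.\<close>
  have "contact_vf F \<in> contact_syms k m"
    unfolding F_def using V k by (intro contact_syms_diff) (simp_all add: Q VQ genfun_symmetry)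
  note pwF = symmetry_pointwise[OF F k m this, where w = "tr w" for w, OF tr0, folded M_def]
  have PP0: "base_deriv a b F = (\<lambda>v. 0)" if "a + b = k" for a b
  proof
    fix w
    have "total_deriv M (k - b) b F (tr w) = 0"
    proof (cases b)
      case 0 then show ?thesis using pwF(3) by (simp add: F0)
    next
      case (Suc b') then show ?thesis using pwF(4)[where i = b] that by simp
    qed
    moreover have "k - b = a" using that by simp
    ultimately show "base_deriv a b F w = 0" using trb[OF depends_base_deriv[OF bF]] by (simp add: total_deriv_base[OF bF])
  qed
  define X2 where "X2 = (\<lambda>e. case e of N i j \<Rightarrow>
    if (i, j) \<in> nset k then - base_deriv (k + 1 - i - j) (j - 1) F (\<lambda>_. 0) / fact (j - 1) else 0 | G r s \<Rightarrow> 0)"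
  have "F v = - dmonom_sum k X2 v" for v
    by (rule trans[OF Taylor_plane[OF F(1) bF PP0] polynomial_eq_dmonom_sum]) (simp_all add: X2_def)
  moreover have "genfun k X2 v = - dmonom_sum k X2 v" for v
    by (simp add: genfun_def c0_eq cA_def cB_def cC_def X2_def nset_def)
  ultimately have "Q = (\<lambda>v. 1 * genfun k X1 v + 1 * genfun k X2 v)"
    by (simp add: fun_eq_iff F_def algebra_simps)
  then have "V = contact_vf (genfun k (\<lambda>e. 1 * X1 e + 1 * X2 e))" unfolding genfun_lin VQ by simp
  then show ?thesis by blast
qed

section \<open>Dimension and isomorphisms\<close>

lemma base_deriv_zero: "base_deriv a b (\<lambda>v. 0) = (\<lambda>v. 0)"
  by (induction a b rule: total_deriv_induct) (auto simp: base_deriv_Suc_x base_deriv_Suc_y)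

lemma base_deriv_monomial_at_0:
  "base_deriv a b (\<lambda>v. v XX ^ r * v YY ^ s) (\<lambda>_. 0) = (if r = a \<and> s = b then fact a * fact b else 0)"
proof -
  have z: "(\<Prod>i<n. real (t - i)) * 0 ^ (t - n) = (if t = n then fact n else 0)" for n t :: nat
  proof -
    have "(\<Prod>i<n. real (n - i)) = fact n" by (simp add: fact_prod_rev lessThan_atLeast0)
    moreover have "(\<Prod>i<n. real (t - i)) = 0" if "t < n" by (rule prod_zero) (use that in auto)
    ultimately show ?thesis by (cases t n rule: linorder_cases) auto
  qed
  show ?thesis unfolding base_deriv_monomial z by simp
qed

text \<open>Derivatives at the origin are dual to the monomials up to (j - 1)!, the factorial of the
  power of y, which is not a divided power.\<close>

lemma base_deriv_dmonom_at_0: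
  assumes "(i, j) \<in> nset k" "(i', j') \<in> nset k"
  shows "base_deriv (k + 1 - i' - j') (j' - 1) (dmonom k i j) (\<lambda>_. 0) = (if (i, j) = (i', j') then fact (j - 1) else 0)"
proof -
  have "dmonom k i j = (\<lambda>v. 1 / fact (k + 1 - i - j) * (v XX ^ (k + 1 - i - j) * v YY ^ (j - 1)))"
    using assms by (auto simp: dmonom_def nset_def)
  then have "base_deriv (k + 1 - i' - j') (j' - 1) (dmonom k i j)
      = (\<lambda>v. 1 / fact (k + 1 - i - j) * base_deriv (k + 1 - i' - j') (j' - 1) (\<lambda>v. v XX ^ (k + 1 - i - j) * v YY ^ (j - 1)) v)"
    by (simp only: base_deriv_cmult smooth_mult smooth_power smooth_coord)
  moreover have "k + 1 - i - j = k + 1 - i' - j' \<and> j - 1 = j' - 1 \<longleftrightarrow> (i, j) = (i', j')"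
    using assms by (auto simp: nset_def)
  ultimately show ?thesis by (auto simp: base_deriv_monomial_at_0)
qed

lemma dmonom_sum_eq_0:
  assumes 0: "dmonom_sum k X = (\<lambda>v. 0)" and q: "(i, j) \<in> nset k"
  shows "X (N i j) = 0"
proof -
  define a b where "a = k + 1 - i - j" "b = j - 1"
  have "base_deriv a b (dmonom_sum k X) (\<lambda>_. 0) = (\<Sum>q\<in>nset k. X (N (fst q) (snd q)) * base_deriv a b (dmonom k (fst q) (snd q)) (\<lambda>_. 0))"
    unfolding dmonom_sum_def[abs_def] by (simp add: base_deriv_sum base_deriv_cmult)
  also have "\<dots> = (\<Sum>q'\<in>nset k. if q' = (i, j) then X (N i j) * fact b else 0)"
  proof (rule sum.cong)
    fix q' assume q': "q' \<in> nset k"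
    show "X (N (fst q') (snd q')) * base_deriv a b (dmonom k (fst q') (snd q')) (\<lambda>_. 0)
        = (if q' = (i, j) then X (N i j) * fact b else 0)"
      using base_deriv_dmonom_at_0[of "fst q'" "snd q'" k i j] q q' by (cases q') (auto simp: a_b_def)
  qed simp
  also have "\<dots> = X (N i j) * fact b" using q by simp
  finally show ?thesis unfolding 0 base_deriv_zero by simp
qed

text \<open>Q_p and Q_q recover A and B and with them six parameters; what is left is a combination
  of independent monomials.\<close>

lemma genfun_eq_0:
  assumes X: "X \<in> mcarrier k" and 0: "genfun k X = (\<lambda>v. 0)"
  shows "X = (\<lambda>e. 0)"
proof -
  have "cA X v = 0" "cB X v = 0" for v
    using pd_genfun[of k X v] unfolding 0 by simp_all
  then have "cA X (\<lambda>d. if d = XX then x else if d = YY then y else 0) = 0"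
    "cB X (\<lambda>d. if d = XX then x else if d = YY then y else 0) = 0" for x y by auto
  then have A: "X (N 1 0) + X (N 0 1) * y - X (G 1 1) * x - X (G 2 1) * x * y = 0"
    and B: "X (G 1 2) + (X (G 2 2) - X (G 1 1)) * y - X (G 2 1) * (y * y) = 0" for x y :: real
    by (simp_all add: cA_def cB_def)
  have g: "X (N (Suc 0) 0) = 0" "X (N 0 (Suc 0)) = 0" "X (G (Suc 0) (Suc 0)) = 0" "X (G 2 (Suc 0)) = 0"
      "X (G (Suc 0) 2) = 0" "X (G 2 2) = 0"
    using A[of 0 0] A[of 0 1] A[of 1 0] A[of 1 1] B[of 0] B[of 1] by simp_all
  have "dmonom_sum k X v = 0" for v
  proof -
    have "genfun k X v = - dmonom_sum k X v" by (simp add: genfun_def c0_eq cA_def cB_def cC_def g)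
    then show ?thesis by (simp add: 0)
  qed
  then have "dmonom_sum k X = (\<lambda>v. 0)" by auto
  from dmonom_sum_eq_0[OF this] have n: "X (N i j) = 0" if "(i, j) \<in> nset k" for i j using that by blast
  show ?thesis
  proof
    fix e
    show "X e = 0"
    proof (cases "e \<in> Iset k")
      case False then show ?thesis using X by (simp add: mcarrier_def)
    next
      case True
      then show ?thesis using g n unfolding Iset_def nidx_def nset_def by auto
    qed
  qed
qed

lemma inj_on_genfun: "inj_on (\<lambda>X. contact_vf (genfun k X)) (mcarrier k)"
proof (rule inj_onI)
  fix X Y assume X: "X \<in> mcarrier k" and Y: "Y \<in> mcarrier k" and e: "contact_vf (genfun k X) = contact_vf (genfun k Y)"
  have "genfun k (\<lambda>e. 1 * X e + (- 1) * Y e) = (\<lambda>v. 0)"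
    unfolding genfun_lin using e by (simp add: contact_vf_inject)
  moreover have "(\<lambda>e. 1 * X e + (- 1) * Y e) \<in> mcarrier k"
    using X Y by (simp add: mcarrier_def)
  ultimately have "(\<lambda>e. 1 * X e + (- 1) * Y e) = (\<lambda>e. 0)" by (intro genfun_eq_0)
  then show "X = Y" by (simp add: fun_eq_iff)
qed

text \<open>The left side is free of m, so all these systems, including the one with m = 0, have the
  very same symmetry fields.\<close>

lemma image_genfun:
  assumes "2 < k" "m < k"
  shows "(\<lambda>X. contact_vf (genfun k X)) ` mcarrier k = contact_syms k m"
proof (intro equalityI subsetI)
  fix V assume "V \<in> contact_syms k m"
  then obtain X where X: "V = contact_vf (genfun k X)" using symmetry_imp_genfun assms by blast
  have "genfun k X = genfun k (\<lambda>e. if e \<in> Iset k then X e else 0)" by (rule genfun_cong) simp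
  then show "V \<in> (\<lambda>X. contact_vf (genfun k X)) ` mcarrier k"
    by (intro image_eqI[of _ _ "\<lambda>e. if e \<in> Iset k then X e else 0"]) (auto simp: X mcarrier_def)
next
  fix V assume "V \<in> (\<lambda>X. contact_vf (genfun k X)) ` mcarrier k"
  then show "V \<in> contact_syms k m" using genfun_symmetry assms by auto
qed

lemma contact_vf_genfun_lin: "contact_vf (genfun k (\<lambda>e. a * X e + b * Y e)) = vf_lin a (contact_vf (genfun k X)) b (contact_vf (genfun k Y))"
  by (simp add: genfun_lin contact_vf_lin)

lemma contact_vf_genfun_sum:
  "finite I \<Longrightarrow> contact_vf (genfun k (\<lambda>e. \<Sum>x\<in>I. c x * dl x e)) = (\<lambda>d w. \<Sum>x\<in>I. c x * contact_vf (genfun k (dl x)) d w)"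
proof (induction rule: finite_induct)
  case empty
  have "genfun k (\<lambda>e. 0) = (\<lambda>v. 0)" by (simp add: fun_eq_iff genfun_def cA_def cB_def cC_def c0_def)
  moreover have "contact_vf (\<lambda>v. 0) = (\<lambda>d w. 0)" by (auto simp: contact_vf_def fun_eq_iff split: jvar.split)
  ultimately show ?case by simp
next
  case (insert x I)
  have "contact_vf (genfun k (\<lambda>e. c x * dl x e + 1 * (\<Sum>x\<in>I. c x * dl x e)))
      = (\<lambda>d w. c x * contact_vf (genfun k (dl x)) d w + 1 * (\<Sum>x\<in>I. c x * contact_vf (genfun k (dl x)) d w))"
    unfolding contact_vf_genfun_lin insert.IH by (simp add: vf_lin_def)
  then show ?case using insert by simp
qed

lemma card_nset: "card (nset k) = k * (k + 1) div 2"
proof -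
  have "bij_betw (\<lambda>(i, j). (Suc i, Suc j)) (Sigma {..<k} (\<lambda>i. {..<k - i})) (nset k)"
    by (rule bij_betw_byWitness[where f' = "\<lambda>(i, j). (i - 1, j - 1)"]) (auto simp: nset_def)
  then have "card (nset k) = (\<Sum>i<k. k - i)"
    using bij_betw_same_card by fastforce
  also have "\<dots> = (\<Sum>i<k. Suc (k - Suc i))"
    by (rule sum.cong) auto
  also have "\<dots> = (\<Sum>i<k. Suc i)" by (rule sum.nat_diff_reindex)
  also have "\<dots> = k * (k + 1) div 2" by (induction k) auto
  finally show ?thesis .
qed

lemma finite_Iset: "finite (Iset k)" and card_Iset: "card (Iset k) = k * (k + 1) div 2 + 6"
proof -
  have nidx: "nidx k = insert (1,0) (insert (0,1) (nset k))" by (auto simp: nidx_def nset_def)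
  have I: "Iset k = (\<lambda>q. N (fst q) (snd q)) ` nidx k \<union> {G 1 1, G 1 2, G 2 1, G 2 2}"
    unfolding Iset_def by (intro arg_cong2[where f = union]) (force, auto)
  have fin: "finite (nidx k)" unfolding nidx by simp
  then show "finite (Iset k)" unfolding I by simp
  have "card (nidx k) = k * (k + 1) div 2 + 2"
  proof -
    have "(1,0) \<notin> insert (0,1) (nset k)" "(0,1) \<notin> nset k" by (auto simp: nset_def)
    then show ?thesis unfolding nidx by (simp add: card_nset)
  qed
  moreover have "card ((\<lambda>q. N (fst q) (snd q)) ` nidx k) = card (nidx k)"
    by (rule card_image) (auto simp: inj_on_def)
  moreover have "card {G 1 1, G 1 2, G 2 1, G 2 2} = 4" by simp
  ultimately show "card (Iset k) = k * (k + 1) div 2 + 6"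
    unfolding I using fin by (subst card_Un_disjoint) auto
qed

lemma sum_dl: "finite I \<Longrightarrow> (\<Sum>x\<in>I. c x * dl x e) = (if e \<in> I then c e else 0)"
  by (simp add: dl_def if_distrib[of "\<lambda>t. _ * t"] cong: if_cong)

lemma genfun_basis:
  assumes "2 < k" "m < k"
  shows "\<exists>B. vf_basis (contact_syms k m) B \<and> card B = k * (k + 1) div 2 + 6"
proof -
  define T where "T X = contact_vf (genfun k X)" for X
  define B where "B = (\<lambda>e. T (dl e)) ` Iset k"
  have dl: "dl e \<in> mcarrier k" if "e \<in> Iset k" for e
    using that by (auto simp: mcarrier_def dl_def)
  have inj: "inj_on (\<lambda>e. T (dl e)) (Iset k)"
  proof (rule inj_onI)
    fix e e' assume "e \<in> Iset k" "e' \<in> Iset k" "T (dl e) = T (dl e')"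
    then have "dl e = dl e'" using inj_on_genfun[of k] dl unfolding T_def inj_on_def by blast
    then show "e = e'" by (metis dl_def zero_neq_one)
  qed
  have sumB: "(\<lambda>d w. \<Sum>b\<in>B. c b * b d w) = T (\<lambda>e. \<Sum>x\<in>Iset k. c (T (dl x)) * dl x e)" for c
    unfolding T_def contact_vf_genfun_sum[OF finite_Iset] by (simp add: B_def T_def[symmetric] sum.reindex[OF inj])
  have "vf_basis (contact_syms k m) B"
    unfolding vf_basis_def
  proof (intro conjI allI impI)
    show "finite B" by (simp add: B_def finite_Iset)
    show "B \<subseteq> contact_syms k m" using genfun_symmetry assms by (auto simp: B_def T_def)
  next
    fix c :: "vfield \<Rightarrow> real" assume 0: "(\<lambda>d w. \<Sum>b\<in>B. c b * b d w) = (\<lambda>d w. 0)"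
    define X where "X = (\<lambda>e. \<Sum>x\<in>Iset k. c (T (dl x)) * dl x e)"
    have X: "X e = (if e \<in> Iset k then c (T (dl e)) else 0)" for e
      unfolding X_def by (rule sum_dl[OF finite_Iset])
    have "contact_vf (genfun k X) = (\<lambda>d w. 0)" using 0 unfolding sumB T_def X_def .
    then have "genfun k X = charf (\<lambda>d w. 0)" using charf_contact_vf[of "genfun k X"] by simp
    then have "genfun k X = (\<lambda>v. 0)" by (simp add: charf_def)
    then have "X = (\<lambda>e. 0)" by (intro genfun_eq_0[of _ k]) (simp_all add: mcarrier_def X)
    then have "c (T (dl e)) = 0" if "e \<in> Iset k" for e
      using X[of e] that by simp
    then show "\<forall>b\<in>B. c b = 0" by (simp add: B_def)
  next
    show "\<forall>V\<in>contact_syms k m. \<exists>c. V = (\<lambda>d w. \<Sum>b\<in>B. c b * b d w)"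
    proof
      fix V assume "V \<in> contact_syms k m"
      then have "V \<in> (\<lambda>X. contact_vf (genfun k X)) ` mcarrier k" unfolding image_genfun[OF assms] .
      then obtain X where X: "X \<in> mcarrier k" "V = T X" unfolding T_def by blast
      \<comment> \<open>In \<open>vf_basis\<close> coefficients are indexed by the basis fields
        themselves, hence the passage back to indices in \<open>Iset k\<close>.\<close>
      define c where "c b = X (inv_into (Iset k) (\<lambda>e. T (dl e)) b)" for b
      have "(\<lambda>e. \<Sum>x\<in>Iset k. c (T (dl x)) * dl x e) = (\<lambda>e. \<Sum>x\<in>Iset k. X x * dl x e)"
        by (intro ext sum.cong) (simp_all add: c_def inv_into_f_f[OF inj])
      also have "\<dots> = X" using X(1) by (auto simp: sum_dl[OF finite_Iset] mcarrier_def fun_eq_iff)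
      finally have "V = (\<lambda>d w. \<Sum>b\<in>B. c b * b d w)" unfolding sumB X(2) by simp
      then show "\<exists>c. V = (\<lambda>d w. \<Sum>b\<in>B. c b * b d w)" by (intro exI[of _ c])
    qed
  qed
  moreover have "card B = k * (k + 1) div 2 + 6"
    unfolding B_def card_image[OF inj] by (rule card_Iset)
  ultimately show ?thesis by blast
qed

theorem theorem5:
  fixes k m :: nat
  assumes "k > 2" and "0 < m" and "m < k"
  shows "(\<exists>B. vf_basis (contact_syms k m) B \<and> card B = k * (k + 1) div 2 + 6)
       \<and> (\<exists>T. lie_iso_model k (contact_syms k m) T)
       \<and> (\<exists>T. lie_iso_vf (contact_syms k 0) (contact_syms k m) T)"
proof (intro conjI)
  have k: "2 < k" "m < k" "0 < k" "1 \<le> k" using assms by auto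
  show "\<exists>B. vf_basis (contact_syms k m) B \<and> card B = k * (k + 1) div 2 + 6"
    by (rule genfun_basis[OF k(1,2)])
  have "bij_betw (\<lambda>X. contact_vf (genfun k X)) (mcarrier k) (contact_syms k m)"
    using inj_on_genfun image_genfun[OF k(1,2)] by (simp add: bij_betw_def)
  moreover have "contact_vf (genfun k (mbr k X Y)) = vf_bracket (contact_vf (genfun k X)) (contact_vf (genfun k Y))" for X Y
    by (simp add: vf_bracket_contact_vf lagrange_bracket_genfun[OF k(4)])
  ultimately show "\<exists>T. lie_iso_model k (contact_syms k m) T"
    unfolding lie_iso_model_def by (intro exI[of _ "\<lambda>X. contact_vf (genfun k X)"]) (simp add: contact_vf_genfun_lin)
  \<comment> \<open>The isomorphism with the case m = 0 can therefore be taken to be the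
    identity.\<close>
  have "contact_syms k 0 = contact_syms k m"
    using image_genfun[OF k(1,2)] image_genfun[OF k(1,3)] by simp
  then show "\<exists>T. lie_iso_vf (contact_syms k 0) (contact_syms k m) T"
    unfolding lie_iso_vf_def by (intro exI[of _ "\<lambda>V. V"]) (simp add: bij_betw_def)
qed

end
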